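(* Let $m\ge1$ and let $0\neq w\in\bigotimes^3\mathbb{C}^m$ be a polystable tensor. Then $\sqrt m/a(w)\le e'(w)$ if $m>2$. Moreover, if $m=n^2$, equality $\sqrt m/a(w)=e'(w)$ holds if and only if $F_n(w)\ne0$. In this case, the fundamental invariant of $w$ is $\Phi_w=F_n(w)^{-1}F_n$ on $\overline{Gw}$.
   Context: Work over $\mathbb{C}$. $\mathrm{GL}_m^3$ acts on $\bigotimes^3\mathbb{C}^m$ by $(g_1,g_2,g_3)w=(g_1\otimes g_2\otimes g_3)w$; $Gw$ is the $\mathrm{GL}_m^3$-orbit of $w$. A tensor is polystable if its $\mathrm{SL}_m^3$-orbit is closed. For nonzero polystable $w$ the stabilizer period $a(w)$ is the (finite) order of $\chi(\mathrm{stab}(w))\subseteq\mathbb{C}^\times$, where $\mathrm{stab}(w)\subseteq\mathrm{GL}_m^3$ is the stabilizer and $\chi(g_1,g_2,g_3)=\det(g_1)\det(g_2)\det(g_3)$. The minimal degree $e(w)$ is the smallest positive $d$ such that the space $\mathcal{O}(\overline{Gw})^{\mathrm{SL}_m^3}_d$ of $\mathrm{SL}_m^3$-invariant, degree $d$ homogeneous regular functions on $\overline{Gw}$ is nonzero (these spaces are at most one-dimensional, and zero unless $m\,a(w)$ divides $d$); $e'(w):=e(w)/(m\,a(w))$ is the minimal exponent. The fundamental invariant $\Phi_w$ is the unique element of $\mathcal{O}(\overline{Gw})^{\mathrm{SL}_m^3}_{e(w)}$ with $\Phi_w(w)=1$. For $m=n^2$, $F_n\colon\bigotimes^3\mathbb{C}^{n^2}\to\mathbb{C}$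 is, up to scaling, the unique nonzero homogeneous $\mathrm{SL}_m^3$-invariant polynomial of degree $n^3$. Explicitly, writing $w=\sum_{a,b,c}w_{abc}\,e_a\otimes e_b\otimes e_c$, $$F_n(w)=\sum_{\alpha,\beta,\gamma\colon[n]^3\to[n^2]}\mathrm{sgn}_x(\alpha)\,\mathrm{sgn}_y(\beta)\,\mathrm{sgn}_z(\gamma)\prod_{p\in[n]^3}w_{\alpha(p)\beta(p)\gamma(p)},$$ where $[k]=\{1,\dots,k\}$; a total ordering of $[n]^3$ is fixed; the $x$-slices (resp. $y$-, $z$-slices) of $[n]^3$ are the $n$ subsets obtained by fixing the first (resp. second, third) coordinate, each ordered by the induced ordering; and for a map $\alpha\colon[n]^3\to[n^2]$, $\mathrm{sgn}_x(\alpha)$ is the product over all $x$-slices of the signs of the permutations given by $\alpha$ restricted to the slice if $\alpha$ is bijective onto $[n^2]$ on each $x$-slice, and $0$ otherwise; $\mathrm{sgn}_y,\mathrm{sgn}_z$ are defined analogously. *)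

theory Defs
  imports "Jordan_Normal_Form.Determinant" "HOL-Combinatorics.Permutations"
    "HOL-Library.FuncSet" Complex_Main
begin

text \<open>
  Indices are 0-based: the set \<open>[k]\<close> is rendered as \<open>{..<k}\<close>.  A tensor in the threefold tensor
  power of \<open>\<complex>\<^sup>m\<close> is its coordinate array, extended by zero outside \<open>[m]\<^sup>3\<close>.
\<close>

type_synonym tensor3 = "nat \<times> nat \<times> nat \<Rightarrow> complex"
type_synonym mat3 = "complex mat \<times> complex mat \<times> complex mat"

definition cube :: "nat \<Rightarrow> (nat \<times> nat \<times> nat) set" where
  "cube m = {..<m} \<times> {..<m} \<times> {..<m}"

definition tensors :: "nat \<Rightarrow> tensor3 set" where
  "tensors m = {w. \<forall>i. i \<notin> cube m \<longrightarrow> w i = 0}"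

definition tscale :: "complex \<Rightarrow> tensor3 \<Rightarrow> tensor3" where
  "tscale t w = (\<lambda>i. t * w i)"


section \<open>Groups and their action\<close>

definition GL :: "nat \<Rightarrow> complex mat set" where
  "GL m = {A \<in> carrier_mat m m. invertible_mat A}"

definition SL :: "nat \<Rightarrow> complex mat set" where
  "SL m = {A \<in> carrier_mat m m. det A = 1}"

definition GL3 :: "nat \<Rightarrow> mat3 set" where
  "GL3 m = GL m \<times> GL m \<times> GL m"

definition SL3 :: "nat \<Rightarrow> mat3 set" where
  "SL3 m = SL m \<times> SL m \<times> SL m"

text \<open>The coordinates of \<open>(g\<^sub>1 \<otimes> g\<^sub>2 \<otimes> g\<^sub>3) w\<close>.\<close>

definition act :: "nat \<Rightarrow> mat3 \<Rightarrow> tensor3 \<Rightarrow> tensor3" where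
  "act m = (\<lambda>(g1, g2, g3) w (a, b, c).
     if (a, b, c) \<in> cube m
     then \<Sum>(i, j, k)\<in>cube m. g1 $$ (a, i) * g2 $$ (b, j) * g3 $$ (c, k) * w (i, j, k)
     else 0)"

definition orbit :: "nat \<Rightarrow> mat3 set \<Rightarrow> tensor3 \<Rightarrow> tensor3 set" where
  "orbit m G w = (\<lambda>g. act m g w) ` G"


section \<open>Polynomial functions, Zariski topology, regular functions\<close>

text \<open>
  An exponent vector \<open>\<mu>\<close> stands for the monomial with exponent \<open>\<mu> i\<close> at the coordinate \<open>i\<close>.
\<close>

definition polynomial_fun :: "nat \<Rightarrow> (tensor3 \<Rightarrow> complex) \<Rightarrow> bool" where
  "polynomial_fun m p \<longleftrightarrow>
     (\<exists>(M :: (nat \<times> nat \<times> nat \<Rightarrow> nat) set) coef. finite M \<and>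
        p = (\<lambda>v. \<Sum>\<mu>\<in>M. coef \<mu> * (\<Prod>i\<in>cube m. v i ^ \<mu> i)))"

definition zariski_closed :: "nat \<Rightarrow> tensor3 set \<Rightarrow> bool" where
  "zariski_closed m X \<longleftrightarrow>
     (\<exists>P. (\<forall>p\<in>P. polynomial_fun m p) \<and> X = {v \<in> tensors m. \<forall>p\<in>P. p v = 0})"

definition zariski_closure :: "nat \<Rightarrow> tensor3 set \<Rightarrow> tensor3 set" where
  "zariski_closure m X = zariski_closed m hull X"

text \<open>
  Functions on a closed set \<open>X\<close> are represented by functions that are \<open>undefined\<close> outside \<open>X\<close>, so
  that equality of regular functions on \<open>X\<close> is equality in HOL.
\<close>

definition regular_funs :: "nat \<Rightarrow> tensor3 set \<Rightarrow> (tensor3 \<Rightarrow> complex) set" where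
  "regular_funs m X = {f \<in> extensional X. \<exists>p. polynomial_fun m p \<and> (\<forall>v\<in>X. f v = p v)}"

definition polystable :: "nat \<Rightarrow> tensor3 \<Rightarrow> bool" where
  "polystable m w \<longleftrightarrow> zariski_closed m (orbit m (SL3 m) w)"

definition orbit_closure :: "nat \<Rightarrow> tensor3 \<Rightarrow> tensor3 set" where
  "orbit_closure m w = zariski_closure m (orbit m (GL3 m) w)"


section \<open>Stabilizer period, minimal degree, minimal exponent, fundamental invariant\<close>

definition stabilizer :: "nat \<Rightarrow> tensor3 \<Rightarrow> mat3 set" where
  "stabilizer m w = {g \<in> GL3 m. act m g w = w}"

definition chi :: "mat3 \<Rightarrow> complex" where
  "chi = (\<lambda>(g1, g2, g3). det g1 * det g2 * det g3)"

definition stabilizer_period :: "nat \<Rightarrow> tensor3 \<Rightarrow> nat" where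
  "stabilizer_period m w = card (chi ` stabilizer m w)"

text \<open>
  The orbit closure is a cone, so being homogeneous of degree \<open>d\<close> makes sense for functions on it.
\<close>

definition invariants :: "nat \<Rightarrow> tensor3 \<Rightarrow> nat \<Rightarrow> (tensor3 \<Rightarrow> complex) set" where
  "invariants m w d = {f \<in> regular_funs m (orbit_closure m w).
     (\<forall>t. \<forall>v\<in>orbit_closure m w. f (tscale t v) = t ^ d * f v) \<and>
     (\<forall>g\<in>SL3 m. \<forall>v\<in>orbit_closure m w. f (act m g v) = f v)}"

definition minimal_degree :: "nat \<Rightarrow> tensor3 \<Rightarrow> nat" where
  "minimal_degree m w =
     (LEAST d. d > 0 \<and> (\<exists>f\<in>invariants m w d. \<exists>v\<in>orbit_closure m w. f v \<noteq> 0))"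

definition minimal_exponent :: "nat \<Rightarrow> tensor3 \<Rightarrow> real" where
  "minimal_exponent m w = real (minimal_degree m w) / (real m * real (stabilizer_period m w))"

definition fundamental_invariant :: "nat \<Rightarrow> tensor3 \<Rightarrow> tensor3 \<Rightarrow> complex" where
  "fundamental_invariant m w = (THE f. f \<in> invariants m w (minimal_degree m w) \<and> f w = 1)"


section \<open>The invariant \<open>F\<^sub>n\<close>\<close>

text \<open>
  Below, \<open>r\<close> is a total ordering of \<open>[n]\<^sup>3\<close>.  The rank of \<open>p \<in> S\<close> is its 0-based position in \<open>S\<close>
  with respect to the induced ordering; \<open>inv_into S (rank r S)\<close> enumerates \<open>S\<close> increasingly.
\<close>

definition rank ::
  "(nat \<times> nat \<times> nat) rel \<Rightarrow> (nat \<times> nat \<times> nat) set \<Rightarrow> nat \<times> nat \<times> nat \<Rightarrow> nat" where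
  "rank r S p = card {q \<in> S. (q, p) \<in> r \<and> q \<noteq> p}"

definition slice_sign ::
  "(nat \<times> nat \<times> nat) rel \<Rightarrow> nat \<Rightarrow> (nat \<times> nat \<times> nat) set \<Rightarrow> (nat \<times> nat \<times> nat \<Rightarrow> nat) \<Rightarrow> int" where
  "slice_sign r n S \<alpha> =
     (if bij_betw \<alpha> S {..<n^2}
      then sign (\<lambda>k. if k < n^2 then \<alpha> (inv_into S (rank r S) k) else k)
      else 0)"

definition sgn_x :: "(nat \<times> nat \<times> nat) rel \<Rightarrow> nat \<Rightarrow> (nat \<times> nat \<times> nat \<Rightarrow> nat) \<Rightarrow> int" where
  "sgn_x r n \<alpha> = (\<Prod>i<n. slice_sign r n {(x, y, z) \<in> cube n. x = i} \<alpha>)"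

definition sgn_y :: "(nat \<times> nat \<times> nat) rel \<Rightarrow> nat \<Rightarrow> (nat \<times> nat \<times> nat \<Rightarrow> nat) \<Rightarrow> int" where
  "sgn_y r n \<beta> = (\<Prod>i<n. slice_sign r n {(x, y, z) \<in> cube n. y = i} \<beta>)"

definition sgn_z :: "(nat \<times> nat \<times> nat) rel \<Rightarrow> nat \<Rightarrow> (nat \<times> nat \<times> nat \<Rightarrow> nat) \<Rightarrow> int" where
  "sgn_z r n \<gamma> = (\<Prod>i<n. slice_sign r n {(x, y, z) \<in> cube n. z = i} \<gamma>)"

definition F :: "(nat \<times> nat \<times> nat) rel \<Rightarrow> nat \<Rightarrow> tensor3 \<Rightarrow> complex" where
  "F r n w =
     (\<Sum>\<alpha> \<in> cube n \<rightarrow>\<^sub>E {..<n^2}. \<Sum>\<beta> \<in> cube n \<rightarrow>\<^sub>E {..<n^2}. \<Sum>\<gamma> \<in> cube n \<rightarrow>\<^sub>E {..<n^2}.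
        of_int (sgn_x r n \<alpha> * sgn_y r n \<beta> * sgn_z r n \<gamma>) * (\<Prod>p\<in>cube n. w (\<alpha> p, \<beta> p, \<gamma> p)))"

end

theory Submission
  imports Defs "Jordan_Normal_Form.Char_Poly"
begin

text \<open>
  Everything rests on knowing what an \<open>SL\<^sub>m\<^sup>3\<close>-invariant looks like.  Suppose that an invariant of
  degree \<open>d > 0\<close> on the closure of \<open>Gw\<close> does not vanish at \<open>w\<close>.  Scalar matrices in \<open>SL\<^sub>m\<close> force
  \<open>d = k m\<close>, and averaging the monomials of a representing polynomial over the group shows that
  some form of the following kind is nonzero at \<open>w\<close>: fix three partitions of \<open>d\<close> points into \<open>k\<close>
  blocks of size \<open>m\<close>, and sum
  \<open>sgn(\<alpha>) sgn(\<beta>) sgn(\<gamma>) \<Prod>\<^sub>p w(\<alpha> p, \<beta> p, \<gamma> p)\<close>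
  over all labellings \<open>\<alpha>, \<beta>, \<gamma>\<close> of the points by \<open>[m]\<close>, where a labelling contributes the
  product of the signs of its restrictions to the blocks of its own partition
  (\<open>block_form\<close>, \<open>invariants_block_form\<close>).

  If two points lie in a common block of each of the three partitions, exchanging them multiplies
  the form by \<open>(-1)\<^sup>3\<close>, so the form is zero.  In a nonzero form the points are therefore
  separated by their triples of blocks; this gives \<open>k m \<le> k\<^sup>3\<close>, that is \<open>\<surd>m \<le> k\<close>
  (\<open>block_form_nonzero_bound\<close>).  If \<open>m = k\<^sup>2\<close> the triples fill the cube \<open>[k]\<^sup>3\<close>, the three
  partitions become the partitions into slices, and the form is \<open>F\<^sub>k\<close> up to sign
  (\<open>block_form_nonzero_imp_F_nonzero\<close>).  Since \<open>F\<^sub>n\<close> is itself an invariant of degree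
  \<open>n\<^sup>3 = n m\<close> and the minimal exponent is \<open>k / a(w)\<close> when the minimal degree is \<open>k m\<close>, the
  inequality and the description of equality follow.  The last claim holds because an
  invariant of given degree is determined by its value at \<open>w\<close> (\<open>invariants_determined\<close>).

  The Reynolds operator is replaced by a finite weighted sum over matrices in \<open>GL\<^sub>m\<close>.  Write \<open>s\<close> for
  the product of block signs on \<open>d = k m\<close> points.  There are weights \<open>c\<^sub>t\<close> and matrices \<open>g\<^sub>t\<close> with
  \<open>\<Sum>\<^sub>t c\<^sub>t \<Prod>\<^sub>j g\<^sub>t(\<alpha> j, \<beta> j) = \<Sum>\<^sub>\<sigma> s(\<alpha> \<circ> \<sigma>) s(\<beta> \<circ> \<sigma>)\<close>
  for all labellings \<open>\<alpha>, \<beta>\<close> (\<open>exists_det_quadrature\<close>); they come from the polarization identity.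
  Translating by \<open>h\<close> multiplies \<open>s\<close> by \<open>det(h)\<^sup>k\<close>, hence
  \<open>\<Sum>\<^sub>t c\<^sub>t f(g\<^sub>t h) = det(h)\<^sup>k \<Sum>\<^sub>t c\<^sub>t f(g\<^sub>t)\<close> for every form \<open>f\<close> of degree \<open>d\<close> in the matrix
  entries, while the sum is nonzero for \<open>f = det\<^sup>k\<close>, being a sum of squares up to a factor
  (\<open>det_quadrature_relative_invariance\<close>, \<open>det_quadrature_det_power\<close>).

  Polystability ensures that there are invariants of positive degree at all: some polynomial
  vanishes on the closed orbit \<open>SL\<^sub>m\<^sup>3 w\<close> but not at \<open>0\<close>, so that a polynomial without constant term
  is constant and nonzero on the orbit, and its average contains an invariant of positive degree
  that does not vanish at \<open>w\<close> (\<open>polystable_nonzero_invariant\<close>).  This makes \<open>e(w)\<close> a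
  genuine minimum and forces the values of \<open>\<chi>\<close> on the stabilizer to be roots of unity, so that
  \<open>a(w)\<close> is finite.
\<close>

section \<open>Signs of labellings and polarization\<close>

text \<open>The Levi-Civita symbol of the word \<open>f 0, \<dots>, f (m - 1)\<close>.\<close>
definition alt_sign :: "nat \<Rightarrow> (nat \<Rightarrow> nat) \<Rightarrow> int" where
  "alt_sign m f = (if bij_betw f {..<m} {..<m} then sign (\<lambda>i. if i < m then f i else i) else 0)"

lemma alt_sign_cong:
  assumes "\<And>i. i < m \<Longrightarrow> f i = g i"
  shows "alt_sign m f = alt_sign m g"
proof -
  have "bij_betw f {..<m} {..<m} = bij_betw g {..<m} {..<m}"
    by (rule bij_betw_cong) (use assms in auto)
  moreover have "(\<lambda>i. if i < m then f i else i) = (\<lambda>i. if i < m then g i else i)"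
    using assms by auto
  ultimately show ?thesis by (simp add: alt_sign_def)
qed

lemma extend_id_permutes:
  assumes "bij_betw f {..<m} {..<m}"
  shows "(\<lambda>i. if i < m then f i else i) permutes {..<m}"
proof (rule bij_imp_permutes)
  show "bij_betw (\<lambda>i. if i < m then f i else i) {..<m} {..<m}"
    using assms by (subst bij_betw_cong[where g = f]) auto
qed auto

lemma alt_sign_permutes:
  assumes "p permutes {..<m}"
  shows "alt_sign m p = sign p"
proof -
  have "(\<lambda>i. if i < m then p i else i) = p"
    using permutes_not_in[OF assms] by auto
  then show ?thesis
    using permutes_imp_bij[OF assms] by (simp add: alt_sign_def)
qed

lemma alt_sign_comp:
  assumes "\<rho> permutes {..<m}"
  shows "alt_sign m (\<lambda>i. f (\<rho> i)) = sign \<rho> * alt_sign m f"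
proof -
  have b: "bij_betw \<rho> {..<m} {..<m}" by (rule permutes_imp_bij[OF assms])
  have iff: "bij_betw (\<lambda>i. f (\<rho> i)) {..<m} {..<m} = bij_betw f {..<m} {..<m}"
    using bij_betw_comp_iff[OF b, of f "{..<m}"] by (simp add: comp_def)
  show ?thesis
  proof (cases "bij_betw f {..<m} {..<m}")
    case True
    have lt: "\<rho> i < m \<longleftrightarrow> i < m" for i using permutes_in_image[OF assms, of i] by simp
    have "(\<lambda>i. if i < m then f (\<rho> i) else i) = (\<lambda>i. if i < m then f i else i) \<circ> \<rho>"
      using lt permutes_not_in[OF assms] by auto
    moreover have "permutation \<rho>" by (rule permutes_imp_permutation[OF _ assms]) simp
    moreover have "permutation (\<lambda>i. if i < m then f i else i)"
      by (rule permutes_imp_permutation[OF _ extend_id_permutes[OF True]]) simp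
    ultimately show ?thesis
      using True iff by (simp add: alt_sign_def sign_compose)
  next
    case False
    then show ?thesis using iff by (simp add: alt_sign_def)
  qed
qed

text \<open>
  The left-hand side is the Leibniz expansion of the matrix whose columns are the columns
  \<open>\<gamma> 0, \<dots>, \<gamma> (m - 1)\<close> of \<open>A\<close>: a permutation of the columns of \<open>A\<close>, or a matrix with two equal
  columns.
\<close>
lemma sum_alt_sign_prod:
  fixes A :: "complex mat"
  assumes A: "A \<in> carrier_mat m m" and \<gamma>: "\<And>i. i < m \<Longrightarrow> \<gamma> i < m"
  shows "(\<Sum>\<phi>\<in>{..<m} \<rightarrow>\<^sub>E {..<m}. of_int (alt_sign m \<phi>) * (\<Prod>i<m. A $$ (\<phi> i, \<gamma> i)))
    = det A * of_int (alt_sign m \<gamma>)"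
proof -
  let ?B = "mat m m (\<lambda>(i, j). A $$ (i, \<gamma> j))"
  have fin: "finite ({..<m} \<rightarrow>\<^sub>E {..<m})" by (intro finite_PiE) auto
  have "(\<Sum>\<phi>\<in>{..<m} \<rightarrow>\<^sub>E {..<m}. of_int (alt_sign m \<phi>) * (\<Prod>i<m. A $$ (\<phi> i, \<gamma> i)))
      = (\<Sum>\<phi>\<in>{\<phi> \<in> {..<m} \<rightarrow>\<^sub>E {..<m}. bij_betw \<phi> {..<m} {..<m}}.
           of_int (alt_sign m \<phi>) * (\<Prod>i<m. A $$ (\<phi> i, \<gamma> i)))"
    using fin by (intro sum.mono_neutral_right) (auto simp: alt_sign_def)
  also have "\<dots> = (\<Sum>p | p permutes {..<m}. of_int (sign p) * (\<Prod>j<m. ?B $$ (p j, j)))"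
  proof (rule sum.reindex_bij_witness
      [where i = "\<lambda>p. restrict p {..<m}" and j = "\<lambda>\<phi> i. if i < m then \<phi> i else i"])
    fix \<phi> assume \<phi>: "\<phi> \<in> {\<phi> \<in> {..<m} \<rightarrow>\<^sub>E {..<m}. bij_betw \<phi> {..<m} {..<m}}"
    let ?p = "\<lambda>i. if i < m then \<phi> i else i"
    show "restrict ?p {..<m} = \<phi>" using \<phi> by (auto simp: PiE_def extensional_def restrict_def)
    show p: "?p \<in> {p. p permutes {..<m}}" using extend_id_permutes[of \<phi> m] \<phi> by simp
    show "of_int (sign ?p) * (\<Prod>j<m. ?B $$ (?p j, j))
        = of_int (alt_sign m \<phi>) * (\<Prod>i<m. A $$ (\<phi> i, \<gamma> i))"
    proof (intro arg_cong2[where f = "(*)"] prod.cong)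
      show "of_int (sign ?p) = (of_int (alt_sign m \<phi>) :: complex)"
        using \<phi> by (simp add: alt_sign_def)
      fix j assume j: "j \<in> {..<m}"
      then have "\<phi> j < m" using \<phi> by (auto simp: PiE_def Pi_def)
      then show "?B $$ (?p j, j) = A $$ (\<phi> j, \<gamma> j)" using j by simp
    qed simp
  next
    fix p assume p: "p \<in> {p. p permutes {..<m}}"
    then have p: "p permutes {..<m}" by simp
    have lt: "p i < m \<longleftrightarrow> i < m" for i using permutes_in_image[OF p, of i] by simp
    show "(\<lambda>i. if i < m then restrict p {..<m} i else i) = p"
      using permutes_not_in[OF p] by auto
    have "bij_betw (restrict p {..<m}) {..<m} {..<m}"
      using permutes_imp_bij[OF p] by (subst bij_betw_cong[where g = p]) auto
    then show "restrict p {..<m} \<in> {\<phi> \<in> {..<m} \<rightarrow>\<^sub>E {..<m}. bij_betw \<phi> {..<m} {..<m}}"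
      using lt by auto
  qed
  also have "\<dots> = det ?B"
    by (subst det_col[of _ m]) (auto simp: atLeast0LessThan)
  also have "\<dots> = det A * of_int (alt_sign m \<gamma>)"
  proof (cases "bij_betw \<gamma> {..<m} {..<m}")
    case True
    let ?q = "\<lambda>i. if i < m then \<gamma> i else i"
    have q: "?q permutes {0..<m}" using extend_id_permutes[OF True] by (simp add: atLeast0LessThan)
    have tA: "transpose_mat A \<in> carrier_mat m m" using A by simp
    have BC: "?B = transpose_mat (mat m m (\<lambda>(i, j). transpose_mat A $$ (?q i, j)))"
      (is "_ = transpose_mat ?C")
    proof (rule eq_matI)
      fix i j assume "i < dim_row (transpose_mat ?C)" "j < dim_col (transpose_mat ?C)"
      then have "i < m" "j < m" by simp_all
      then show "?B $$ (i, j) = transpose_mat ?C $$ (i, j)" using A \<gamma>[of j] by simp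
    qed simp_all
    have "det ?B = det (mat m m (\<lambda>(i, j). transpose_mat A $$ (?q i, j)))"
      unfolding BC by (rule det_transpose[OF mat_carrier])
    also have "\<dots> = of_int (sign ?q) * det A"
      using det_permute_rows[OF tA q] det_transpose[OF A] by simp
    finally show ?thesis using True by (simp add: alt_sign_def)
  next
    case False
    have "\<not> inj_on \<gamma> {..<m}"
    proof
      assume "inj_on \<gamma> {..<m}"
      moreover have "\<gamma> ` {..<m} \<subseteq> {..<m}" using \<gamma> by auto
      ultimately have "bij_betw \<gamma> {..<m} {..<m}"
        by (simp add: bij_betw_def endo_inj_surj)
      with False show False by simp
    qed
    then obtain i j where ij: "i < m" "j < m" "i \<noteq> j" "\<gamma> i = \<gamma> j"
      by (auto simp: inj_on_def)
    have "det ?B = 0"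
      by (rule det_identical_columns[of _ m i j]) (use ij in \<open>auto intro!: eq_vecI\<close>)
    then show ?thesis using False by (simp add: alt_sign_def)
  qed
  finally show ?thesis .
qed

text \<open>
  A partition of \<open>D\<close> into \<open>k\<close> blocks of size \<open>m\<close>, together with an enumeration of each block:
  \<open>e b i\<close> is the \<open>i\<close>-th point of block \<open>b\<close>.
\<close>
definition block_enum :: "nat \<Rightarrow> nat \<Rightarrow> 'a set \<Rightarrow> (nat \<Rightarrow> nat \<Rightarrow> 'a) \<Rightarrow> bool" where
  "block_enum m k D e \<longleftrightarrow> bij_betw (\<lambda>(b, i). e b i) ({..<k} \<times> {..<m}) D"

definition block_sign :: "nat \<Rightarrow> nat \<Rightarrow> (nat \<Rightarrow> nat \<Rightarrow> 'a) \<Rightarrow> ('a \<Rightarrow> nat) \<Rightarrow> int" where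
  "block_sign m k e \<alpha> = (\<Prod>b<k. alt_sign m (\<lambda>i. \<alpha> (e b i)))"

lemma block_enum_in: "block_enum m k D e \<Longrightarrow> b < k \<Longrightarrow> i < m \<Longrightarrow> e b i \<in> D"
  by (auto simp: block_enum_def bij_betw_def)

lemma block_enum_finite: "block_enum m k D e \<Longrightarrow> finite D"
  unfolding block_enum_def by (metis bij_betw_finite finite_SigmaI finite_lessThan)

lemma block_enum_card: "block_enum m k D e \<Longrightarrow> card D = k * m"
  unfolding block_enum_def by (metis bij_betw_same_card card_cartesian_product card_lessThan)

lemma block_enum_comp:
  "block_enum m k D e \<Longrightarrow> bij_betw \<pi> D D' \<Longrightarrow> block_enum m k D' (\<lambda>b i. \<pi> (e b i))"
  unfolding block_enum_def
  by (drule (1) bij_betw_trans) (simp add: comp_def case_prod_unfold)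

lemma block_enum_prod:
  assumes "block_enum m k D e"
  shows "(\<Prod>j\<in>D. f j) = (\<Prod>b<k. \<Prod>i<m. f (e b i))"
proof -
  have "(\<Prod>j\<in>D. f j) = (\<Prod>x\<in>{..<k} \<times> {..<m}. f ((\<lambda>(b, i). e b i) x))"
    using assms unfolding block_enum_def by (rule prod.reindex_bij_betw[symmetric])
  also have "\<dots> = (\<Prod>b<k. \<Prod>i<m. f (e b i))"
    by (simp add: prod.cartesian_product case_prod_beta)
  finally show ?thesis .
qed

lemma block_sign_cong:
  assumes "block_enum m k D e" "\<And>j. j \<in> D \<Longrightarrow> \<alpha> j = \<beta> j"
  shows "block_sign m k e \<alpha> = block_sign m k e \<beta>"
  unfolding block_sign_def
  by (intro prod.cong refl alt_sign_cong assms(2) block_enum_in[OF assms(1)]) auto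

text \<open>
  The block sign, as a tensor in the \<open>k m\<close>-th power of \<open>\<complex>\<^sup>m\<close>, is a product of \<open>k\<close> volume forms, so a
  matrix acts on it through \<open>det\<^sup>k\<close>.  All invariance statements below come from this identity.
\<close>
lemma sum_block_sign_prod:
  fixes A :: "complex mat"
  assumes A: "A \<in> carrier_mat m m" and e: "block_enum m k D e" and \<gamma>: "\<And>j. j \<in> D \<Longrightarrow> \<gamma> j < m"
  shows "(\<Sum>\<beta>\<in>D \<rightarrow>\<^sub>E {..<m}. of_int (block_sign m k e \<beta>) * (\<Prod>j\<in>D. A $$ (\<beta> j, \<gamma> j)))
    = det A ^ k * of_int (block_sign m k e \<gamma>)"
proof -
  let ?P = "{..<m} \<rightarrow>\<^sub>E {..<m}"
  let ?t = "\<lambda>b \<phi>. of_int (alt_sign m \<phi>) * (\<Prod>i<m. A $$ (\<phi> i, \<gamma> (e b i)))"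
  define d where "d = inv_into ({..<k} \<times> {..<m}) (\<lambda>(b, i). e b i)"
  have bij: "bij_betw (\<lambda>(b, i). e b i) ({..<k} \<times> {..<m}) D" using e by (simp add: block_enum_def)
  have d_e: "d (e b i) = (b, i)" if "b < k" "i < m" for b i
    unfolding d_def using bij_betw_inv_into_left[OF bij, of "(b, i)"] that by simp
  have e_d: "e (fst (d j)) (snd (d j)) = j" if "j \<in> D" for j
    unfolding d_def using bij_betw_inv_into_right[OF bij that] by (simp add: case_prod_beta)
  have d_in: "fst (d j) < k" "snd (d j) < m" if "j \<in> D" for j
  proof -
    have "d j \<in> {..<k} \<times> {..<m}"
      using bij_betwE[OF bij_betw_inv_into[OF bij]] that by (auto simp: d_def)
    then show "fst (d j) < k" "snd (d j) < m" by auto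
  qed
  have finP: "finite ?P" by (intro finite_PiE) auto
  have "det A ^ k * of_int (block_sign m k e \<gamma>) = (\<Prod>b<k. det A * of_int (alt_sign m (\<lambda>i. \<gamma> (e b i))))"
    by (simp add: block_sign_def prod.distrib)
  also have "\<dots> = (\<Prod>b<k. \<Sum>\<phi>\<in>?P. ?t b \<phi>)"
    by (intro prod.cong refl sum_alt_sign_prod[OF A, symmetric] \<gamma> block_enum_in[OF e]) auto
  also have "\<dots> = (\<Sum>\<Phi>\<in>{..<k} \<rightarrow>\<^sub>E ?P. \<Prod>b<k. ?t b (\<Phi> b))"
    using finP by (subst prod_sum_PiE) auto
  also have "\<dots> = (\<Sum>\<beta>\<in>D \<rightarrow>\<^sub>E {..<m}. of_int (block_sign m k e \<beta>) * (\<Prod>j\<in>D. A $$ (\<beta> j, \<gamma> j)))"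
  proof (rule sum.reindex_bij_witness
      [where i = "\<lambda>\<beta>. \<lambda>b\<in>{..<k}. \<lambda>i\<in>{..<m}. \<beta> (e b i)"
        and j = "\<lambda>\<Phi>. \<lambda>j\<in>D. \<Phi> (fst (d j)) (snd (d j))"])
    fix \<Phi> assume \<Phi>: "\<Phi> \<in> {..<k} \<rightarrow>\<^sub>E ?P"
    let ?\<beta> = "\<lambda>j\<in>D. \<Phi> (fst (d j)) (snd (d j))"
    have \<beta>e: "?\<beta> (e b i) = \<Phi> b i" if "b < k" "i < m" for b i
      using that d_e block_enum_in[OF e] by simp
    show "?\<beta> \<in> D \<rightarrow>\<^sub>E {..<m}"
      using \<Phi> d_in by (auto simp: PiE_def Pi_def)
    show "(\<lambda>b\<in>{..<k}. \<lambda>i\<in>{..<m}. ?\<beta> (e b i)) = \<Phi>"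
    proof (intro ext)
      fix b i
      show "(\<lambda>b\<in>{..<k}. \<lambda>i\<in>{..<m}. ?\<beta> (e b i)) b i = \<Phi> b i"
      proof (cases "b < k")
        case True
        then have "\<Phi> b \<in> ?P" using \<Phi> by auto
        then show ?thesis using True \<beta>e by (cases "i < m") (auto simp: PiE_def extensional_def)
      next
        case False
        then show ?thesis using \<Phi> by (auto simp: PiE_def extensional_def)
      qed
    qed
    show "of_int (block_sign m k e ?\<beta>) * (\<Prod>j\<in>D. A $$ (?\<beta> j, \<gamma> j)) = (\<Prod>b<k. ?t b (\<Phi> b))"
    proof -
      have 1: "alt_sign m (\<lambda>i. ?\<beta> (e b i)) = alt_sign m (\<Phi> b)" if "b < k" for b
        by (rule alt_sign_cong) (use that \<beta>e in auto)
      have "(\<Prod>j\<in>D. A $$ (?\<beta> j, \<gamma> j)) = (\<Prod>b<k. \<Prod>i<m. A $$ (?\<beta> (e b i), \<gamma> (e b i)))"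
        by (rule block_enum_prod[OF e])
      also have "\<dots> = (\<Prod>b<k. \<Prod>i<m. A $$ (\<Phi> b i, \<gamma> (e b i)))"
        by (intro prod.cong refl) (use \<beta>e in auto)
      finally show ?thesis
        using 1 by (simp add: block_sign_def prod.distrib)
    qed
  next
    fix \<beta> assume \<beta>: "\<beta> \<in> D \<rightarrow>\<^sub>E {..<m}"
    show "(\<lambda>b\<in>{..<k}. \<lambda>i\<in>{..<m}. \<beta> (e b i)) \<in> {..<k} \<rightarrow>\<^sub>E ?P"
      using \<beta> block_enum_in[OF e] by (auto simp: PiE_def Pi_def)
    show "(\<lambda>j\<in>D. (\<lambda>b\<in>{..<k}. \<lambda>i\<in>{..<m}. \<beta> (e b i)) (fst (d j)) (snd (d j))) = \<beta>"
      using \<beta> d_in e_d by (auto simp: PiE_def extensional_def restrict_def)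
  qed
  finally show ?thesis by simp
qed

text \<open>Expand the product over \<open>l \<in> D\<close> of \<open>1 - [l \<notin> A]\<close>.\<close>
lemma sum_alternating_supersets:
  assumes "finite D" "A \<subseteq> D"
  shows "(\<Sum>S\<in>Pow D. if A \<subseteq> S then (-1) ^ card (D - S) else 0) = (if A = D then 1 else 0 :: 'a :: comm_ring_1)"
proof -
  let ?g = "\<lambda>l. if l \<in> A then 0 else (-1) :: 'a"
  have "(\<Prod>l\<in>D. 1 + ?g l) = (\<Sum>S\<in>Pow D. prod (\<lambda>_. 1) S * prod ?g (D - S))"
    using assms(1) by (rule prod_add)
  also have "\<dots> = (\<Sum>S\<in>Pow D. if A \<subseteq> S then (-1) ^ card (D - S) else 0)"
  proof (intro sum.cong refl)
    fix S assume S: "S \<in> Pow D"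
    show "prod (\<lambda>_. 1) S * prod ?g (D - S) = (if A \<subseteq> S then (-1) ^ card (D - S) else 0)"
    proof (cases "A \<subseteq> S")
      case True
      then have "prod ?g (D - S) = (\<Prod>l\<in>D - S. -1)" by (intro prod.cong) auto
      then show ?thesis using True by simp
    next
      case False
      then obtain l where "l \<in> A" "l \<notin> S" by auto
      then have "prod ?g (D - S) = 0" using assms by (intro prod_zero) auto
      then show ?thesis using False by simp
    qed
  qed
  also have "(\<Prod>l\<in>D. 1 + ?g l) = (if A = D then 1 else 0)"
  proof (cases "A = D")
    case False
    then obtain l where "l \<in> D" "l \<notin> A" using assms by auto
    then have "(\<Prod>l\<in>D. 1 + ?g l) = 0" using assms by (intro prod_zero) auto
    then show ?thesis using False by simp
  qed auto
  finally show ?thesis by simp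
qed

text \<open>
  The \<open>d\<close>-th finite difference of \<open>d\<close>-th powers yields the symmetrized product, whatever the base
  point \<open>y\<close>.  In the expansion of the product a choice function \<open>\<theta>\<close> takes from factor \<open>j\<close> either
  some \<open>x l j\<close> or, encoded as \<open>\<theta> j = d\<close>, the term \<open>y j\<close>; the alternating sum over \<open>S\<close> leaves only
  those \<open>\<theta>\<close> that hit every \<open>l < d\<close>, and these are the permutations.  The freedom in \<open>y\<close> is what
  later makes the matrices invertible.
\<close>
lemma polarization:
  fixes x :: "nat \<Rightarrow> nat \<Rightarrow> 'a :: comm_ring_1" and y :: "nat \<Rightarrow> 'a"
  shows "(\<Sum>S\<in>Pow {..<d}. (-1) ^ card ({..<d} - S) * (\<Prod>j<d. y j + (\<Sum>l\<in>S. x l j)))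
    = (\<Sum>\<sigma> | \<sigma> permutes {..<d}. \<Prod>j<d. x (\<sigma> j) j)"
proof -
  define z where "z l j = (if l = d then y j else x l j)" for l j
  let ?\<Theta> = "{..<d} \<rightarrow>\<^sub>E {..d}"
  let ?A = "\<lambda>\<theta>. \<theta> ` {..<d} \<inter> {..<d}"
  have fin\<Theta>: "finite ?\<Theta>" by (intro finite_PiE) auto
  have expand: "(\<Prod>j<d. y j + (\<Sum>l\<in>S. x l j))
      = (\<Sum>\<theta>\<in>?\<Theta>. if ?A \<theta> \<subseteq> S then \<Prod>j<d. z (\<theta> j) j else 0)" if S: "S \<subseteq> {..<d}" for S
  proof -
    have finS: "finite S" using S finite_subset by blast
    have "(\<Prod>j<d. y j + (\<Sum>l\<in>S. x l j)) = (\<Prod>j<d. \<Sum>l\<in>insert d S. z l j)"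
    proof (intro prod.cong refl)
      fix j
      have "(\<Sum>l\<in>S. x l j) = (\<Sum>l\<in>S. z l j)" using S by (intro sum.cong) (auto simp: z_def)
      moreover have "d \<notin> S" using S by auto
      ultimately show "y j + (\<Sum>l\<in>S. x l j) = (\<Sum>l\<in>insert d S. z l j)"
        using finS by (simp add: z_def)
    qed
    also have "\<dots> = (\<Sum>\<theta>\<in>{..<d} \<rightarrow>\<^sub>E insert d S. \<Prod>j<d. z (\<theta> j) j)"
      using finS by (subst prod_sum_PiE) auto
    also have "{..<d} \<rightarrow>\<^sub>E insert d S = {\<theta> \<in> ?\<Theta>. ?A \<theta> \<subseteq> S}"
    proof (intro equalityI subsetI)
      fix \<theta> assume \<theta>: "\<theta> \<in> {..<d} \<rightarrow>\<^sub>E insert d S"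
      have "insert d S \<subseteq> {..d}" using S by auto
      then have "\<theta> \<in> ?\<Theta>" using \<theta> PiE_mono[of "{..<d}" "\<lambda>_. insert d S" "\<lambda>_. {..d}"] by auto
      moreover have "?A \<theta> \<subseteq> S" using PiE_mem[OF \<theta>] by force
      ultimately show "\<theta> \<in> {\<theta> \<in> ?\<Theta>. ?A \<theta> \<subseteq> S}" by simp
    next
      fix \<theta> assume "\<theta> \<in> {\<theta> \<in> ?\<Theta>. ?A \<theta> \<subseteq> S}"
      then have \<theta>: "\<theta> \<in> ?\<Theta>" "?A \<theta> \<subseteq> S" by simp_all
      show "\<theta> \<in> {..<d} \<rightarrow>\<^sub>E insert d S"
      proof (rule PiE_I)
        fix j assume j: "j \<in> {..<d}"
        then have "\<theta> j \<le> d" using PiE_mem[OF \<theta>(1) j] by simp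
        then consider "\<theta> j = d" | "\<theta> j < d" by linarith
        then show "\<theta> j \<in> insert d S"
        proof cases
          case 2
          then have "\<theta> j \<in> ?A \<theta>" using j by simp
          then show ?thesis using \<theta>(2) by blast
        qed simp
      qed (rule PiE_arb[OF \<theta>(1)])
    qed
    also have "(\<Sum>\<theta>\<in>\<dots>. \<Prod>j<d. z (\<theta> j) j)
        = (\<Sum>\<theta>\<in>?\<Theta>. if ?A \<theta> \<subseteq> S then \<Prod>j<d. z (\<theta> j) j else 0)"
      using fin\<Theta> by (simp add: sum.inter_filter)
    finally show ?thesis .
  qed
  have "(\<Sum>S\<in>Pow {..<d}. (-1) ^ card ({..<d} - S) * (\<Prod>j<d. y j + (\<Sum>l\<in>S. x l j)))
      = (\<Sum>S\<in>Pow {..<d}. \<Sum>\<theta>\<in>?\<Theta>.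
          (if ?A \<theta> \<subseteq> S then (-1) ^ card ({..<d} - S) else 0) * (\<Prod>j<d. z (\<theta> j) j))"
    by (intro sum.cong refl) (auto simp: expand sum_distrib_left intro!: sum.cong)
  also have "\<dots> = (\<Sum>\<theta>\<in>?\<Theta>. (\<Sum>S\<in>Pow {..<d}. if ?A \<theta> \<subseteq> S then (-1) ^ card ({..<d} - S) else 0)
       * (\<Prod>j<d. z (\<theta> j) j))"
    by (subst sum.swap) (simp add: sum_distrib_right)
  also have "\<dots> = (\<Sum>\<theta>\<in>?\<Theta>. if ?A \<theta> = {..<d} then \<Prod>j<d. z (\<theta> j) j else 0)"
    by (intro sum.cong refl) (simp add: sum_alternating_supersets)
  also have "\<dots> = (\<Sum>\<theta>\<in>{\<theta> \<in> ?\<Theta>. ?A \<theta> = {..<d}}. \<Prod>j<d. z (\<theta> j) j)"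
    using fin\<Theta> by (simp add: sum.inter_filter)
  also have "\<dots> = (\<Sum>\<sigma> | \<sigma> permutes {..<d}. \<Prod>j<d. x (\<sigma> j) j)"
  proof (rule sum.reindex_bij_witness
      [where i = "\<lambda>\<sigma>. restrict \<sigma> {..<d}" and j = "\<lambda>\<theta> i. if i < d then \<theta> i else i"])
    fix \<theta> assume \<theta>: "\<theta> \<in> {\<theta> \<in> ?\<Theta>. ?A \<theta> = {..<d}}"
    let ?p = "\<lambda>i. if i < d then \<theta> i else i"
    have sub: "{..<d} \<subseteq> \<theta> ` {..<d}" using \<theta> by auto
    then have im: "\<theta> ` {..<d} = {..<d}"
      by (metis card_image_le card_seteq finite_imageI finite_lessThan)
    then have "bij_betw \<theta> {..<d} {..<d}"
      by (simp add: bij_betw_def finite_surj_inj)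
    then show "?p \<in> {p. p permutes {..<d}}" using extend_id_permutes by simp
    show "restrict ?p {..<d} = \<theta>" using \<theta> by (auto simp: PiE_def extensional_def restrict_def)
    show "(\<Prod>j<d. x (?p j) j) = (\<Prod>j<d. z (\<theta> j) j)"
    proof (intro prod.cong refl)
      fix j assume "j \<in> {..<d}"
      then have "\<theta> j \<in> {..<d}" "j < d" using im by auto
      then show "x (?p j) j = z (\<theta> j) j" by (simp add: z_def)
    qed
  next
    fix p assume "p \<in> {p. p permutes {..<d}}"
    then have p: "p permutes {..<d}" by simp
    have lt: "p i < d \<longleftrightarrow> i < d" for i using permutes_in_image[OF p, of i] by simp
    show "(\<lambda>i. if i < d then restrict p {..<d} i else i) = p"
      using permutes_not_in[OF p] by auto
    show "restrict p {..<d} \<in> {\<theta> \<in> ?\<Theta>. ?A \<theta> = {..<d}}"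
      using lt permutes_image[OF p] by (auto simp: less_imp_le)
  qed
  finally show ?thesis .
qed

section \<open>A finite sum over matrices that picks out powers of the determinant\<close>

lemma GL_iff: "A \<in> GL m \<longleftrightarrow> A \<in> carrier_mat m m \<and> det A \<noteq> 0"
proof
  assume A: "A \<in> GL m"
  then have c: "A \<in> carrier_mat m m" by (simp add: GL_def)
  from A obtain B where B: "A * B = 1\<^sub>m m" "B * A = 1\<^sub>m (dim_row B)"
    by (auto simp: GL_def invertible_mat_def inverts_mat_def)
  have "dim_col B = m" using arg_cong[OF B(1), of dim_col] by simp
  moreover have "dim_row B = m" using arg_cong[OF B(2), of dim_col] c by simp
  ultimately have "B \<in> carrier_mat m m" by auto
  then have "det A * det B = det (1\<^sub>m m :: complex mat)"
    unfolding B(1)[symmetric] by (rule det_mult[OF c, symmetric])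
  then show "A \<in> carrier_mat m m \<and> det A \<noteq> 0" using c by auto
next
  assume A: "A \<in> carrier_mat m m \<and> det A \<noteq> 0"
  then have "A \<in> Units (ring_mat TYPE(complex) m ())" by (intro det_non_zero_imp_unit) auto
  then obtain B where "B \<in> carrier_mat m m" "A * B = 1\<^sub>m m" "B * A = 1\<^sub>m m"
    by (auto simp: Units_def ring_mat_def)
  then show "A \<in> GL m"
    using A unfolding GL_def invertible_mat_def inverts_mat_def by fastforce
qed

text \<open>Finitely many matrices have only finitely many eigenvalues together.\<close>
lemma exists_scalar_shift_invertible:
  fixes X :: "'t \<Rightarrow> complex mat"
  assumes "finite T" "\<And>t. t \<in> T \<Longrightarrow> X t \<in> carrier_mat m m"
  shows "\<exists>z. \<forall>t\<in>T. X t + z \<cdot>\<^sub>m 1\<^sub>m m \<in> GL m"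
proof -
  let ?R = "\<Union>t\<in>T. {r. poly (char_poly (X t)) r = 0}"
  have "finite ?R"
  proof (intro finite_UN_I assms(1) poly_roots_finite)
    fix t assume "t \<in> T"
    from degree_monic_char_poly[OF assms(2)[OF this]] show "char_poly (X t) \<noteq> 0" by auto
  qed
  then obtain r where r: "r \<notin> ?R" using ex_new_if_finite[OF infinite_UNIV_char_0] by blast
  have "X t + (- r) \<cdot>\<^sub>m 1\<^sub>m m \<in> GL m" if t: "t \<in> T" for t
  proof -
    have X: "X t \<in> carrier_mat m m" by (rule assms(2)[OF t])
    have "\<not> eigenvalue (X t) r" using r t eigenvalue_root_char_poly[OF X] by auto
    then have "det (char_matrix (X t) r) \<noteq> 0" using eigenvalue_det[OF X] by simp
    then show ?thesis using X by (auto simp: GL_iff char_matrix_def)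
  qed
  then show ?thesis by blast
qed

text \<open>
  The symmetrization of the product of two block signs.  It has to be symmetric, since only
  symmetric tensors are combinations of powers \<open>g\<^sup>\<otimes>\<^sup>d\<close>.
\<close>
definition sign_kernel :: "nat \<Rightarrow> nat \<Rightarrow> (nat \<Rightarrow> nat \<Rightarrow> nat) \<Rightarrow> (nat \<Rightarrow> nat) \<Rightarrow> (nat \<Rightarrow> nat) \<Rightarrow> int" where
  "sign_kernel m k e \<alpha> \<beta> = (\<Sum>\<sigma> | \<sigma> permutes {..<k * m}.
     block_sign m k (\<lambda>b i. \<sigma> (e b i)) \<alpha> * block_sign m k (\<lambda>b i. \<sigma> (e b i)) \<beta>)"

text \<open>
  Weights \<open>c\<close> and nodes \<open>g\<close> that represent this kernel as a combination of powers \<open>g\<^sup>\<otimes>\<^sup>d\<close> with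
  \<open>d = k m\<close>.
  Summation over the nodes is the counterpart of applying the \<open>k\<close>-th power of Cayley's
  \<open>\<Omega>\<close>-operator to a form of degree \<open>k m\<close> in the matrix entries.
\<close>
definition det_quadrature ::
  "nat \<Rightarrow> nat \<Rightarrow> (nat \<Rightarrow> nat \<Rightarrow> nat) \<Rightarrow> 't set \<Rightarrow> ('t \<Rightarrow> complex) \<Rightarrow> ('t \<Rightarrow> complex mat) \<Rightarrow> bool" where
  "det_quadrature m k e T c g \<longleftrightarrow> block_enum m k {..<k * m} e \<and> finite T \<and> g ` T \<subseteq> GL m \<and>
     (\<forall>\<alpha> \<beta>. (\<forall>j<k * m. \<alpha> j < m \<and> \<beta> j < m) \<longrightarrow>
        (\<Sum>t\<in>T. c t * (\<Prod>j<k * m. g t $$ (\<alpha> j, \<beta> j))) = of_int (sign_kernel m k e \<alpha> \<beta>))"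

lemma sum_block_sign_delta:
  assumes "block_enum m k {..<d} e" "\<And>j. j < d \<Longrightarrow> \<alpha> j < m"
  shows "(\<Sum>\<psi>\<in>{..<d} \<rightarrow>\<^sub>E {..<m}. of_int (block_sign m k e \<psi>) * (\<Prod>j<d. if \<psi> j = \<alpha> j then 1 else 0))
    = (of_int (block_sign m k e \<alpha>) :: complex)"
proof -
  have "(\<Sum>\<psi>\<in>{..<d} \<rightarrow>\<^sub>E {..<m}. of_int (block_sign m k e \<psi>) * (\<Prod>j<d. if \<psi> j = \<alpha> j then 1 else 0 :: complex))
    = (\<Sum>\<psi>\<in>{..<d} \<rightarrow>\<^sub>E {..<m}. of_int (block_sign m k e \<psi>) * (\<Prod>j<d. 1\<^sub>m m $$ (\<psi> j, \<alpha> j)))"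
    by (intro sum.cong refl arg_cong2[where f = "(*)"] prod.cong) (auto simp: PiE_iff assms(2))
  also have "\<dots> = of_int (block_sign m k e \<alpha>)"
    using sum_block_sign_prod[OF one_carrier_mat assms(1), of \<alpha>] assms(2) by simp
  finally show ?thesis .
qed

text \<open>
  A product of two block signs is a combination of the tensors \<open>\<Otimes>\<^sub>j E(\<psi> j, \<phi> j)\<close> of matrix units,
  and polarization writes the symmetrization of each of them through powers of
  \<open>z 1 + \<Sum>\<^sub>l\<^sub>\<in>\<^sub>S E(\<psi> l, \<phi> l)\<close>.  A node is thus indexed by \<open>(\<psi>, \<phi>, S)\<close>.
\<close>
lemma exists_det_quadrature:
  assumes e: "block_enum m k {..<k * m} e"
  shows "\<exists>(T :: ((nat \<Rightarrow> nat) \<times> (nat \<Rightarrow> nat) \<times> nat set) set) c g. det_quadrature m k e T c g"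
proof -
  let ?d = "k * m"
  let ?P = "{..<?d} \<rightarrow>\<^sub>E {..<m}"
  let ?bs = "\<lambda>\<alpha>. of_int (block_sign m k e \<alpha>) :: complex"
  define T where "T = ?P \<times> ?P \<times> Pow {..<?d}"
  define X where "X = (\<lambda>(\<psi> :: nat \<Rightarrow> nat, \<phi> :: nat \<Rightarrow> nat, S :: nat set). mat m m (\<lambda>(a, b). \<Sum>l\<in>S. if \<psi> l = a \<and> \<phi> l = b then 1 else 0 :: complex))"
  have finP: "finite ?P" by (intro finite_PiE) auto
  have finT: "finite T" unfolding T_def using finP by auto
  have "X t \<in> carrier_mat m m" for t by (simp add: X_def case_prod_unfold)
  then obtain z where z: "\<And>t. t \<in> T \<Longrightarrow> X t + z \<cdot>\<^sub>m 1\<^sub>m m \<in> GL m"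
    using exists_scalar_shift_invertible[OF finT, of X m] by blast
  define g where "g t = X t + z \<cdot>\<^sub>m 1\<^sub>m m" for t
  define c where "c = (\<lambda>(\<psi>, \<phi>, S). ?bs \<psi> * ?bs \<phi> * (-1) ^ card ({..<?d} - S))"
  have "(\<Sum>t\<in>T. c t * (\<Prod>j<?d. g t $$ (\<alpha> j, \<beta> j))) = of_int (sign_kernel m k e \<alpha> \<beta>)"
    if \<alpha>\<beta>: "\<forall>j<?d. \<alpha> j < m \<and> \<beta> j < m" for \<alpha> \<beta>
  proof -
    define y where "y j = (if \<alpha> j = \<beta> j then z else 0)" for j
    define x where "x \<psi> \<phi> l j = (if \<psi> l = \<alpha> j \<and> \<phi> l = \<beta> j then 1 else 0 :: complex)"
      for \<psi> \<phi> :: "nat \<Rightarrow> nat" and l j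
    have "(\<Sum>t\<in>T. c t * (\<Prod>j<?d. g t $$ (\<alpha> j, \<beta> j)))
        = (\<Sum>\<psi>\<in>?P. \<Sum>\<phi>\<in>?P. \<Sum>S\<in>Pow {..<?d}. c (\<psi>, \<phi>, S) * (\<Prod>j<?d. g (\<psi>, \<phi>, S) $$ (\<alpha> j, \<beta> j)))"
      by (simp add: T_def sum.cartesian_product case_prod_unfold)
    also have "\<dots> = (\<Sum>\<psi>\<in>?P. \<Sum>\<phi>\<in>?P. ?bs \<psi> * ?bs \<phi> *
        (\<Sum>S\<in>Pow {..<?d}. (-1) ^ card ({..<?d} - S) * (\<Prod>j<?d. y j + (\<Sum>l\<in>S. x \<psi> \<phi> l j))))"
    proof (intro sum.cong refl)
      fix \<psi> \<phi>
      have "(\<Prod>j<?d. g (\<psi>, \<phi>, S) $$ (\<alpha> j, \<beta> j)) = (\<Prod>j<?d. y j + (\<Sum>l\<in>S. x \<psi> \<phi> l j))" for S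
        by (intro prod.cong refl) (simp add: g_def X_def y_def x_def \<alpha>\<beta>)
      then show "(\<Sum>S\<in>Pow {..<?d}. c (\<psi>, \<phi>, S) * (\<Prod>j<?d. g (\<psi>, \<phi>, S) $$ (\<alpha> j, \<beta> j)))
        = ?bs \<psi> * ?bs \<phi> *
        (\<Sum>S\<in>Pow {..<?d}. (-1) ^ card ({..<?d} - S) * (\<Prod>j<?d. y j + (\<Sum>l\<in>S. x \<psi> \<phi> l j)))"
        by (simp add: c_def sum_distrib_left mult.assoc)
    qed
    also have "\<dots> = (\<Sum>\<psi>\<in>?P. \<Sum>\<phi>\<in>?P. ?bs \<psi> * ?bs \<phi> *
        (\<Sum>\<sigma> | \<sigma> permutes {..<?d}. \<Prod>j<?d. x \<psi> \<phi> (\<sigma> j) j))"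
      by (simp only: polarization)
    also have "\<dots> = (\<Sum>\<sigma> | \<sigma> permutes {..<?d}. \<Sum>\<psi>\<in>?P. \<Sum>\<phi>\<in>?P. ?bs \<psi> * ?bs \<phi> * (\<Prod>j<?d. x \<psi> \<phi> (\<sigma> j) j))"
      unfolding sum_distrib_left
      by (rule trans[OF sum.cong[OF refl sum.swap] sum.swap])
    also have "\<dots> = (\<Sum>\<sigma> | \<sigma> permutes {..<?d}.
        of_int (block_sign m k (\<lambda>b i. inv_into UNIV \<sigma> (e b i)) \<alpha> * block_sign m k (\<lambda>b i. inv_into UNIV \<sigma> (e b i)) \<beta>))"
    proof (intro sum.cong refl)
      fix \<sigma> assume "\<sigma> \<in> {\<sigma>. \<sigma> permutes {..<?d}}"
      then have \<sigma>: "\<sigma> permutes {..<?d}" by simp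
      have inv_lt: "inv_into UNIV \<sigma> j < ?d" if "j < ?d" for j
        using permutes_in_image[OF permutes_inv[OF \<sigma>], of j] that by simp
      have pr: "(\<Prod>j<?d. x \<psi> \<phi> (\<sigma> j) j) = (\<Prod>j<?d. if \<psi> j = \<alpha> (inv_into UNIV \<sigma> j) then 1 else 0)
          * (\<Prod>j<?d. if \<phi> j = \<beta> (inv_into UNIV \<sigma> j) then 1 else 0)" for \<psi> \<phi>
      proof -
        have "(\<Prod>j<?d. x \<psi> \<phi> (\<sigma> j) j) = (\<Prod>j<?d. x \<psi> \<phi> (\<sigma> (inv_into UNIV \<sigma> j)) (inv_into UNIV \<sigma> j))"
          by (rule prod.permute[OF permutes_inv[OF \<sigma>], unfolded comp_def])
        also have "\<dots> = (\<Prod>j<?d. x \<psi> \<phi> j (inv_into UNIV \<sigma> j))"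
          by (simp add: permutes_inverses[OF \<sigma>])
        finally show ?thesis by (auto simp: x_def prod.distrib[symmetric] intro!: prod.cong)
      qed
      have "(\<Sum>\<psi>\<in>?P. \<Sum>\<phi>\<in>?P. ?bs \<psi> * ?bs \<phi> * (\<Prod>j<?d. x \<psi> \<phi> (\<sigma> j) j))
          = (\<Sum>\<psi>\<in>?P. ?bs \<psi> * (\<Prod>j<?d. if \<psi> j = \<alpha> (inv_into UNIV \<sigma> j) then 1 else 0))
          * (\<Sum>\<phi>\<in>?P. ?bs \<phi> * (\<Prod>j<?d. if \<phi> j = \<beta> (inv_into UNIV \<sigma> j) then 1 else 0))"
        by (simp add: pr sum_product mult_ac)
      also have "\<dots> = ?bs (\<lambda>j. \<alpha> (inv_into UNIV \<sigma> j)) * ?bs (\<lambda>j. \<beta> (inv_into UNIV \<sigma> j))"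
        by (subst (1 2) sum_block_sign_delta[OF e]) (use \<alpha>\<beta> inv_lt in auto)
      finally show "(\<Sum>\<psi>\<in>?P. \<Sum>\<phi>\<in>?P. ?bs \<psi> * ?bs \<phi> * (\<Prod>j<?d. x \<psi> \<phi> (\<sigma> j) j))
        = of_int (block_sign m k (\<lambda>b i. inv_into UNIV \<sigma> (e b i)) \<alpha> * block_sign m k (\<lambda>b i. inv_into UNIV \<sigma> (e b i)) \<beta>)"
        by (simp add: block_sign_def)
    qed
    also have "\<dots> = of_int (sign_kernel m k e \<alpha> \<beta>)"
      unfolding sign_kernel_def of_int_sum
      by (rule sum_permutations_inverse[symmetric])
    finally show ?thesis .
  qed
  then have "det_quadrature m k e T c g"
    using e finT z by (auto simp: det_quadrature_def g_def)
  then show ?thesis by blast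
qed

text \<open>
  Forms of degree \<open>N\<close> in the entries of an \<open>m \<times> m\<close> matrix.  The last rule identifies functions that
  agree on the matrices of the right size, since \<open>det\<close> is given by the Leibniz formula only there.
\<close>
inductive entry_form :: "nat \<Rightarrow> nat \<Rightarrow> (complex mat \<Rightarrow> complex) \<Rightarrow> bool" for m where
  unit: "entry_form m 0 (\<lambda>_. 1)"
| zero: "entry_form m N (\<lambda>_. 0)"
| entry: "entry_form m N f \<Longrightarrow> a < m \<Longrightarrow> b < m \<Longrightarrow> entry_form m (Suc N) (\<lambda>A. A $$ (a, b) * f A)"
| add: "entry_form m N f \<Longrightarrow> entry_form m N g \<Longrightarrow> entry_form m N (\<lambda>A. f A + g A)"
| scale: "entry_form m N f \<Longrightarrow> entry_form m N (\<lambda>A. c * f A)"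
| cong: "entry_form m N f \<Longrightarrow> (\<And>A. A \<in> carrier_mat m m \<Longrightarrow> f' A = f A) \<Longrightarrow> entry_form m N f'"

lemma entry_form_entry: "a < m \<Longrightarrow> b < m \<Longrightarrow> entry_form m 1 (\<lambda>A. A $$ (a, b))"
  using entry_form.entry[OF entry_form.unit, of a m b] by simp

lemma entry_form_mult:
  assumes "entry_form m N f" "entry_form m N' f'"
  shows "entry_form m (N + N') (\<lambda>A. f A * f' A)"
  using assms(1)
proof induction
  case unit
  then show ?case using assms(2) by simp
next
  case (zero N)
  then show ?case by (simp add: entry_form.zero)
next
  case (entry N f a b)
  then show ?case using entry_form.entry[OF entry.IH, of a b] by (simp add: mult.assoc)
next
  case (add N f g)
  then show ?case using entry_form.add[OF add.IH] by (simp add: distrib_right)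
next
  case (scale N f c)
  then show ?case using entry_form.scale[OF scale.IH] by (simp add: mult.assoc)
next
  case (cong N f g)
  then show ?case by (auto intro: entry_form.cong[OF cong.IH])
qed

lemma entry_form_sum:
  "(\<And>x. x \<in> I \<Longrightarrow> entry_form m N (f x)) \<Longrightarrow> entry_form m N (\<lambda>A. \<Sum>x\<in>I. f x A)"
  by (induction I rule: infinite_finite_induct) (auto intro: entry_form.zero entry_form.add)

lemma entry_form_prod:
  "finite I \<Longrightarrow> (\<And>x. x \<in> I \<Longrightarrow> entry_form m 1 (f x)) \<Longrightarrow> entry_form m (card I) (\<lambda>A. \<Prod>x\<in>I. f x A)"
proof (induction I rule: finite_induct)
  case empty
  then show ?case by (simp add: entry_form.unit)
next
  case (insert x I)
  then show ?case using entry_form_mult[of m 1 "f x" "card I" "\<lambda>A. \<Prod>x\<in>I. f x A"] by simp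
qed

lemma entry_form_power: "entry_form m N f \<Longrightarrow> entry_form m (r * N) (\<lambda>A. f A ^ r)"
  by (induction r) (auto intro: entry_form.unit entry_form_mult)

lemma entry_form_det: "entry_form m m det"
proof -
  have "entry_form m m (\<lambda>A. \<Sum>p | p permutes {0..<m}. of_int (sign p) * (\<Prod>i = 0..<m. A $$ (i, p i)))"
  proof (intro entry_form_sum entry_form.scale)
    fix p assume "p \<in> {p. p permutes {0..<m}}"
    then have p: "p permutes {0..<m}" by simp
    have "p i < m" if "i < m" for i using permutes_in_image[OF p, of i] that by simp
    then show "entry_form m m (\<lambda>A. \<Prod>i = 0..<m. A $$ (i, p i))"
      using entry_form_prod[of "{0..<m}" m "\<lambda>i A. A $$ (i, p i)"] by (simp add: entry_form_entry[unfolded One_nat_def])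
  qed
  then show ?thesis by (rule entry_form.cong) (rule det_def')
qed

lemma det_quadrature_GL: "det_quadrature m k e T c g \<Longrightarrow> t \<in> T \<Longrightarrow> g t \<in> GL m"
  by (auto simp: det_quadrature_def)

lemma det_quadrature_carrier: "det_quadrature m k e T c g \<Longrightarrow> t \<in> T \<Longrightarrow> g t \<in> carrier_mat m m"
  using det_quadrature_GL by (fastforce simp: GL_iff)

text \<open>
  Multiplying out \<open>g\<^sub>t h\<close> contracts the second argument of the kernel with the entries of \<open>h\<close>, and
  each block sign in the kernel absorbs \<open>h\<close> at the price of \<open>det(h)\<^sup>k\<close>.
\<close>
lemma det_quadrature_word:
  assumes q: "det_quadrature m k e T c g" and h: "h \<in> carrier_mat m m"
    and \<alpha>: "\<And>j. j < k * m \<Longrightarrow> \<alpha> j < m" and \<gamma>: "\<And>j. j < k * m \<Longrightarrow> \<gamma> j < m"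
  shows "(\<Sum>t\<in>T. c t * (\<Prod>j<k * m. (g t * h) $$ (\<alpha> j, \<gamma> j)))
    = det h ^ k * (\<Sum>t\<in>T. c t * (\<Prod>j<k * m. g t $$ (\<alpha> j, \<gamma> j)))"
proof -
  let ?d = "k * m"
  let ?P = "{..<?d} \<rightarrow>\<^sub>E {..<m}"
  let ?bs = "\<lambda>\<sigma> \<alpha>. of_int (block_sign m k (\<lambda>b i. \<sigma> (e b i)) \<alpha>) :: complex"
  have e: "block_enum m k {..<?d} e" using q by (simp add: det_quadrature_def)
  have quad: "(\<Sum>t\<in>T. c t * (\<Prod>j<?d. g t $$ (\<alpha> j, \<beta> j))) = of_int (sign_kernel m k e \<alpha> \<beta>)"
    if "\<And>j. j < ?d \<Longrightarrow> \<beta> j < m" for \<beta>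
    using q \<alpha> that by (simp add: det_quadrature_def)
  have "(\<Sum>t\<in>T. c t * (\<Prod>j<?d. (g t * h) $$ (\<alpha> j, \<gamma> j)))
      = (\<Sum>t\<in>T. c t * (\<Prod>j<?d. \<Sum>x<m. g t $$ (\<alpha> j, x) * h $$ (x, \<gamma> j)))"
  proof (intro sum.cong refl arg_cong2[where f = "(*)"] prod.cong)
    fix t j assume t: "t \<in> T" and j: "j \<in> {..<?d}"
    have "g t \<in> carrier_mat m m" by (rule det_quadrature_carrier[OF q t])
    then show "(g t * h) $$ (\<alpha> j, \<gamma> j) = (\<Sum>x<m. g t $$ (\<alpha> j, x) * h $$ (x, \<gamma> j))"
      using h \<alpha>[of j] \<gamma>[of j] j by (simp add: scalar_prod_def atLeast0LessThan)
  qed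
  also have "\<dots> = (\<Sum>t\<in>T. c t * (\<Sum>\<beta>\<in>?P. \<Prod>j<?d. g t $$ (\<alpha> j, \<beta> j) * h $$ (\<beta> j, \<gamma> j)))"
    by (subst prod_sum_PiE) auto
  also have "\<dots> = (\<Sum>\<beta>\<in>?P. (\<Sum>t\<in>T. c t * (\<Prod>j<?d. g t $$ (\<alpha> j, \<beta> j))) * (\<Prod>j<?d. h $$ (\<beta> j, \<gamma> j)))"
    unfolding sum_distrib_left sum_distrib_right prod.distrib
    by (subst sum.swap) (simp add: mult_ac)
  also have "\<dots> = (\<Sum>\<beta>\<in>?P. of_int (sign_kernel m k e \<alpha> \<beta>) * (\<Prod>j<?d. h $$ (\<beta> j, \<gamma> j)))"
    by (intro sum.cong refl) (subst quad, auto simp: PiE_iff)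
  also have "\<dots> = (\<Sum>\<sigma> | \<sigma> permutes {..<?d}. ?bs \<sigma> \<alpha> * (\<Sum>\<beta>\<in>?P. ?bs \<sigma> \<beta> * (\<Prod>j<?d. h $$ (\<beta> j, \<gamma> j))))"
    unfolding sign_kernel_def of_int_sum sum_distrib_left sum_distrib_right
    by (subst sum.swap) (simp add: mult_ac)
  also have "\<dots> = (\<Sum>\<sigma> | \<sigma> permutes {..<?d}. ?bs \<sigma> \<alpha> * (det h ^ k * ?bs \<sigma> \<gamma>))"
  proof (intro sum.cong refl arg_cong2[where f = "(*)"])
    fix \<sigma> assume "\<sigma> \<in> {\<sigma>. \<sigma> permutes {..<?d}}"
    then have \<sigma>: "bij_betw \<sigma> {..<?d} {..<?d}" by (simp add: permutes_imp_bij)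
    show "(\<Sum>\<beta>\<in>?P. ?bs \<sigma> \<beta> * (\<Prod>j<?d. h $$ (\<beta> j, \<gamma> j))) = det h ^ k * ?bs \<sigma> \<gamma>"
      by (rule sum_block_sign_prod[OF h block_enum_comp[OF e \<sigma>]]) (use \<gamma> in auto)
  qed
  also have "\<dots> = det h ^ k * of_int (sign_kernel m k e \<alpha> \<gamma>)"
    by (simp add: sign_kernel_def sum_distrib_left mult_ac)
  also have "of_int (sign_kernel m k e \<alpha> \<gamma>) = (\<Sum>t\<in>T. c t * (\<Prod>j<?d. g t $$ (\<alpha> j, \<gamma> j)))"
    by (rule quad[OF \<gamma>, symmetric])
  finally show ?thesis .
qed

text \<open>
  By linearity the case of words suffices.  In the induction over the construction of the form, the
  entries that have been split off are collected in a word \<open>u\<close>.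
\<close>
lemma det_quadrature_relative_invariance:
  assumes q: "det_quadrature m k e T c g" and h: "h \<in> carrier_mat m m"
    and f: "entry_form m (k * m) f"
  shows "(\<Sum>t\<in>T. c t * f (g t * h)) = det h ^ k * (\<Sum>t\<in>T. c t * f (g t))"
proof -
  define w where "w u A = (\<Prod>j<length u. A $$ (u ! j))" for u :: "(nat \<times> nat) list" and A :: "complex mat"
  have w_Cons: "w (p # u) A = A $$ p * w u A" for p u A
    unfolding w_def by (simp add: prod.lessThan_Suc_shift del: prod.lessThan_Suc)
  have "\<forall>u. set u \<subseteq> {..<m} \<times> {..<m} \<longrightarrow> length u + N = k * m \<longrightarrow>
      (\<Sum>t\<in>T. c t * (w u (g t * h) * f (g t * h))) = det h ^ k * (\<Sum>t\<in>T. c t * (w u (g t) * f (g t)))"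
    if "entry_form m N f" for N f
    using that
  proof induction
    case unit
    show ?case
    proof (intro allI impI)
      fix u :: "(nat \<times> nat) list" assume u: "set u \<subseteq> {..<m} \<times> {..<m}" "length u + 0 = k * m"
      have "fst (u ! j) < m \<and> snd (u ! j) < m" if "j < k * m" for j
        using u that nth_mem[of j u] by fastforce
      then show "(\<Sum>t\<in>T. c t * (w u (g t * h) * 1)) = det h ^ k * (\<Sum>t\<in>T. c t * (w u (g t) * 1))"
        using det_quadrature_word[OF q h, of "\<lambda>j. fst (u ! j)" "\<lambda>j. snd (u ! j)"] u(2)
        by (simp add: w_def)
    qed
  next
    case (zero N)
    then show ?case by simp
  next
    case (entry N f a b)
    show ?case
    proof (intro allI impI)
      fix u assume u: "set u \<subseteq> {..<m} \<times> {..<m}" "length u + Suc N = k * m"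
      have "set ((a, b) # u) \<subseteq> {..<m} \<times> {..<m}" "length ((a, b) # u) + N = k * m"
        using u entry.hyps by auto
      from entry.IH[rule_format, OF this]
      show "(\<Sum>t\<in>T. c t * (w u (g t * h) * ((g t * h) $$ (a, b) * f (g t * h))))
        = det h ^ k * (\<Sum>t\<in>T. c t * (w u (g t) * (g t $$ (a, b) * f (g t))))"
        by (simp only: w_Cons mult_ac)
    qed
  next
    case (add N f f')
    then show ?case by (simp add: distrib_left sum.distrib)
  next
    case (scale N f x)
    have eq: "c t * (w u A * (x * f A)) = x * (c t * (w u A * f A))" for t u A by simp
    show ?case unfolding eq sum_distrib_left[symmetric] using scale.IH by simp
  next
    case (cong N f f')
    have eq: "f' (g t * h) = f (g t * h)" "f' (g t) = f (g t)" if "t \<in> T" for t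
      using cong.hyps(2) mult_carrier_mat[OF det_quadrature_carrier[OF q that] h]
        det_quadrature_carrier[OF q that] by blast+
    have 1: "(\<Sum>t\<in>T. c t * (w u (g t * h) * f' (g t * h))) = (\<Sum>t\<in>T. c t * (w u (g t * h) * f (g t * h)))"
      and 2: "(\<Sum>t\<in>T. c t * (w u (g t) * f' (g t))) = (\<Sum>t\<in>T. c t * (w u (g t) * f (g t)))" for u
      by (simp_all add: eq)
    show ?case unfolding 1 2 by (rule cong.IH)
  qed
  from this[OF f, rule_format, of "[]"] show ?thesis by (simp add: w_def)
qed

lemma exists_block_sign_1:
  assumes e: "block_enum m k D e"
  shows "\<exists>\<gamma>\<in>D \<rightarrow>\<^sub>E {..<m}. block_sign m k e \<gamma> = 1"
proof -
  let ?i = "\<lambda>j. snd (inv_into ({..<k} \<times> {..<m}) (\<lambda>(b, i). e b i) j)"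
  have bij: "bij_betw (\<lambda>(b, i). e b i) ({..<k} \<times> {..<m}) D" using e by (simp add: block_enum_def)
  have i: "?i (e b i) = i" if "b < k" "i < m" for b i
    using bij_betw_inv_into_left[OF bij, of "(b, i)"] that by simp
  have "?i j < m" if "j \<in> D" for j
    using bij_betwE[OF bij_betw_inv_into[OF bij], rule_format, OF that] by auto
  then have "restrict ?i D \<in> D \<rightarrow>\<^sub>E {..<m}" by auto
  moreover have "block_sign m k e (restrict ?i D) = (\<Prod>b<k. alt_sign m id)"
    unfolding block_sign_def
    by (intro prod.cong refl alt_sign_cong) (simp add: i block_enum_in[OF e])
  then have "block_sign m k e (restrict ?i D) = 1"
    by (simp add: alt_sign_permutes[OF permutes_id])
  ultimately show ?thesis by blast
qed

text \<open>
  Multiplied by the positive number \<open>\<Sum>\<^sub>\<gamma> s(\<gamma>)\<^sup>2\<close>, the sum becomes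
  \<open>\<Sum>\<^sub>\<sigma> (\<Sum>\<^sub>\<gamma> s(\<gamma>) s(\<gamma> \<circ> \<sigma>))\<^sup>2\<close>, in which the identity contributes a positive term.
\<close>
lemma det_quadrature_det_power:
  assumes q: "det_quadrature m k e T c g"
  shows "(\<Sum>t\<in>T. c t * det (g t) ^ k) \<noteq> 0"
proof
  assume 0: "(\<Sum>t\<in>T. c t * det (g t) ^ k) = 0"
  let ?d = "k * m"
  let ?P = "{..<?d} \<rightarrow>\<^sub>E {..<m}"
  let ?s = "\<lambda>\<sigma>. block_sign m k (\<lambda>b i. \<sigma> (e b i))"
  let ?bs = "block_sign m k e"
  have finP: "finite ?P" by (intro finite_PiE) auto
  have e: "block_enum m k {..<?d} e" using q by (simp add: det_quadrature_def)
  have "(\<Sum>\<gamma>\<in>?P. of_int (?bs \<gamma> * ?bs \<gamma>)) * (\<Sum>t\<in>T. c t * det (g t) ^ k)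
      = (\<Sum>\<gamma>\<in>?P. of_int (?bs \<gamma>) * (\<Sum>t\<in>T. c t * (det (g t) ^ k * of_int (?bs \<gamma>))))"
    by (simp add: sum_distrib_left sum_distrib_right mult_ac)
  also have "\<dots> = (\<Sum>\<gamma>\<in>?P. of_int (?bs \<gamma>) *
      (\<Sum>t\<in>T. c t * (\<Sum>\<beta>\<in>?P. of_int (?bs \<beta>) * (\<Prod>j<?d. g t $$ (\<beta> j, \<gamma> j)))))"
    by (intro sum.cong refl arg_cong2[where f = "(*)"] sum_block_sign_prod[symmetric]
        det_quadrature_carrier[OF q] e) (auto simp: PiE_iff)
  also have "\<dots> = (\<Sum>\<gamma>\<in>?P. of_int (?bs \<gamma>) *
      (\<Sum>\<beta>\<in>?P. of_int (?bs \<beta>) * (\<Sum>t\<in>T. c t * (\<Prod>j<?d. g t $$ (\<beta> j, \<gamma> j)))))"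
    unfolding sum_distrib_left by (subst sum.swap[of _ T]) (simp add: mult_ac)
  also have "\<dots> = (\<Sum>\<gamma>\<in>?P. of_int (?bs \<gamma>) * (\<Sum>\<beta>\<in>?P. of_int (?bs \<beta>) * of_int (sign_kernel m k e \<beta> \<gamma>)))"
  proof (intro sum.cong refl arg_cong2[where f = "(*)"])
    fix \<gamma> \<beta> assume "\<gamma> \<in> ?P" "\<beta> \<in> ?P"
    then have "\<forall>j<?d. \<beta> j < m \<and> \<gamma> j < m" by (auto simp: PiE_iff)
    then show "(\<Sum>t\<in>T. c t * (\<Prod>j<?d. g t $$ (\<beta> j, \<gamma> j))) = of_int (sign_kernel m k e \<beta> \<gamma>)"
      using q by (simp add: det_quadrature_def)
  qed
  also have "\<dots> = of_int (\<Sum>\<gamma>\<in>?P. ?bs \<gamma> * (\<Sum>\<beta>\<in>?P. ?bs \<beta> * sign_kernel m k e \<beta> \<gamma>))"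
    by simp
  finally have "(of_int (\<Sum>\<gamma>\<in>?P. ?bs \<gamma> * (\<Sum>\<beta>\<in>?P. ?bs \<beta> * sign_kernel m k e \<beta> \<gamma>)) :: complex) = 0"
    unfolding 0 by simp
  then have "(\<Sum>\<gamma>\<in>?P. ?bs \<gamma> * (\<Sum>\<beta>\<in>?P. ?bs \<beta> * sign_kernel m k e \<beta> \<gamma>)) = 0"
    unfolding of_int_eq_0_iff .
  moreover have "(\<Sum>\<gamma>\<in>?P. ?bs \<gamma> * (\<Sum>\<beta>\<in>?P. ?bs \<beta> * sign_kernel m k e \<beta> \<gamma>))
      = (\<Sum>\<sigma> | \<sigma> permutes {..<?d}. (\<Sum>\<gamma>\<in>?P. ?bs \<gamma> * ?s \<sigma> \<gamma>)\<^sup>2)"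
  proof -
    have "(\<Sum>\<gamma>\<in>?P. ?bs \<gamma> * (\<Sum>\<beta>\<in>?P. ?bs \<beta> * sign_kernel m k e \<beta> \<gamma>))
      = (\<Sum>\<gamma>\<in>?P. \<Sum>\<beta>\<in>?P. \<Sum>\<sigma> | \<sigma> permutes {..<?d}. (?bs \<gamma> * ?s \<sigma> \<gamma>) * (?bs \<beta> * ?s \<sigma> \<beta>))"
      by (simp add: sign_kernel_def sum_distrib_left mult_ac)
    also have "\<dots> = (\<Sum>\<gamma>\<in>?P. \<Sum>\<sigma> | \<sigma> permutes {..<?d}. \<Sum>\<beta>\<in>?P. (?bs \<gamma> * ?s \<sigma> \<gamma>) * (?bs \<beta> * ?s \<sigma> \<beta>))"
      by (intro sum.cong refl sum.swap)
    also have "\<dots> = (\<Sum>\<sigma> | \<sigma> permutes {..<?d}. \<Sum>\<gamma>\<in>?P. \<Sum>\<beta>\<in>?P. (?bs \<gamma> * ?s \<sigma> \<gamma>) * (?bs \<beta> * ?s \<sigma> \<beta>))"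
      by (rule sum.swap)
    finally show ?thesis by (simp add: power2_eq_square sum_product)
  qed
  ultimately have "(\<Sum>\<sigma> | \<sigma> permutes {..<?d}. (\<Sum>\<gamma>\<in>?P. ?bs \<gamma> * ?s \<sigma> \<gamma>)\<^sup>2) = 0" by simp
  then have "\<forall>\<sigma>\<in>{\<sigma>. \<sigma> permutes {..<?d}}. (\<Sum>\<gamma>\<in>?P. ?bs \<gamma> * ?s \<sigma> \<gamma>)\<^sup>2 = 0"
    by (subst (asm) sum_nonneg_eq_0_iff) (auto simp: finite_permutations)
  then have "(\<Sum>\<gamma>\<in>?P. ?bs \<gamma> * ?s id \<gamma>)\<^sup>2 = 0"
    using permutes_id[of "{..<?d}"] by blast
  then have "(\<Sum>\<gamma>\<in>?P. ?bs \<gamma> * ?bs \<gamma>) = 0" by simp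
  moreover obtain \<gamma> where "\<gamma> \<in> ?P" "?bs \<gamma> = 1" using exists_block_sign_1[OF e] by blast
  ultimately show False
    using sum_nonneg_eq_0_iff[OF finP, of "\<lambda>\<gamma>. ?bs \<gamma> * ?bs \<gamma>"] by auto
qed

lemma block_enum_standard: "block_enum m k {..<k * m} (\<lambda>b i. b * m + i)"
  unfolding block_enum_def
proof (rule bij_betwI)
  show "(\<lambda>(b, i). b * m + i) \<in> {..<k} \<times> {..<m} \<rightarrow> {..<k * m}"
  proof (clarsimp)
    fix b i assume "b < k" "i < m"
    then have "Suc b * m \<le> k * m" by (intro mult_le_mono) auto
    then show "b * m + i < k * m" using \<open>i < m\<close> by simp
  qed
  show "(\<lambda>j. (j div m, j mod m)) \<in> {..<k * m} \<rightarrow> {..<k} \<times> {..<m}"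
  proof
    fix j assume j: "j \<in> {..<k * m}"
    then have "0 < m" by (cases m) auto
    then show "(j div m, j mod m) \<in> {..<k} \<times> {..<m}"
      using j by (simp add: less_mult_imp_div_less)
  qed
qed auto

section \<open>Polynomial functions and the action on tensors\<close>

definition monomial_fun :: "nat \<Rightarrow> (nat \<times> nat \<times> nat \<Rightarrow> nat) \<Rightarrow> tensor3 \<Rightarrow> complex" where
  "monomial_fun m \<mu> v = (\<Prod>i\<in>cube m. v i ^ \<mu> i)"

definition monomial_degree :: "nat \<Rightarrow> (nat \<times> nat \<times> nat \<Rightarrow> nat) \<Rightarrow> nat" where
  "monomial_degree m \<mu> = (\<Sum>i\<in>cube m. \<mu> i)"

lemma finite_cube [simp]: "finite (cube m)"
  by (simp add: cube_def)

lemma polynomial_funE: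
  assumes "polynomial_fun m p"
  obtains M coef where "finite M" "p = (\<lambda>v. \<Sum>\<mu>\<in>M. coef \<mu> * monomial_fun m \<mu> v)"
  using assms unfolding polynomial_fun_def monomial_fun_def by blast

lemma polynomial_fun_monomial: "polynomial_fun m (\<lambda>v. c * monomial_fun m \<mu> v)"
  unfolding polynomial_fun_def monomial_fun_def
  by (intro exI[of _ "{\<mu>}"] exI[of _ "\<lambda>_. c"]) simp

lemma polynomial_fun_const: "polynomial_fun m (\<lambda>_. c)"
  using polynomial_fun_monomial[of m c "\<lambda>_. 0"] by (simp add: monomial_fun_def)

lemma polynomial_fun_coord:
  assumes "i \<in> cube m"
  shows "polynomial_fun m (\<lambda>v. v i)"
proof -
  have "monomial_fun m (\<lambda>i'. if i' = i then 1 else 0) v = v i" for v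
    using assms by (simp add: monomial_fun_def if_distrib[of "\<lambda>x. _ ^ x"] cong: if_cong)
  then show ?thesis
    using polynomial_fun_monomial[of m 1 "\<lambda>i'. if i' = i then 1 else 0"] by simp
qed

lemma polynomial_fun_add:
  assumes "polynomial_fun m p" "polynomial_fun m q"
  shows "polynomial_fun m (\<lambda>v. p v + q v)"
proof -
  obtain M c where M: "finite M" and p: "p = (\<lambda>v. \<Sum>\<mu>\<in>M. c \<mu> * monomial_fun m \<mu> v)"
    using assms(1) by (rule polynomial_funE)
  obtain N d where N: "finite N" and q: "q = (\<lambda>v. \<Sum>\<mu>\<in>N. d \<mu> * monomial_fun m \<mu> v)"
    using assms(2) by (rule polynomial_funE)
  let ?a = "\<lambda>\<mu>. (if \<mu> \<in> M then c \<mu> else 0) + (if \<mu> \<in> N then d \<mu> else 0)"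
  have "p v + q v = (\<Sum>\<mu>\<in>M \<union> N. ?a \<mu> * monomial_fun m \<mu> v)" for v
  proof -
    have "p v = (\<Sum>\<mu>\<in>M \<union> N. (if \<mu> \<in> M then c \<mu> else 0) * monomial_fun m \<mu> v)"
      unfolding p using M N by (intro sum.mono_neutral_cong_left) auto
    moreover have "q v = (\<Sum>\<mu>\<in>M \<union> N. (if \<mu> \<in> N then d \<mu> else 0) * monomial_fun m \<mu> v)"
      unfolding q using M N by (intro sum.mono_neutral_cong_left) auto
    ultimately show ?thesis by (simp add: distrib_right sum.distrib)
  qed
  then show ?thesis
    unfolding polynomial_fun_def using M N
    by (intro exI[of _ "M \<union> N"] exI[of _ ?a]) (auto simp: monomial_fun_def)
qed

lemma polynomial_fun_sum:
  "(\<And>x. x \<in> I \<Longrightarrow> polynomial_fun m (f x)) \<Longrightarrow> polynomial_fun m (\<lambda>v. \<Sum>x\<in>I. f x v)"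
  by (induction I rule: infinite_finite_induct)
    (auto intro: polynomial_fun_add simp: polynomial_fun_const)

lemma polynomial_fun_mult:
  assumes "polynomial_fun m p" "polynomial_fun m q"
  shows "polynomial_fun m (\<lambda>v. p v * q v)"
proof -
  obtain M c where M: "finite M" and p: "p = (\<lambda>v. \<Sum>\<mu>\<in>M. c \<mu> * monomial_fun m \<mu> v)"
    using assms(1) by (rule polynomial_funE)
  obtain N d where N: "finite N" and q: "q = (\<lambda>v. \<Sum>\<mu>\<in>N. d \<mu> * monomial_fun m \<mu> v)"
    using assms(2) by (rule polynomial_funE)
  have "p v * q v = (\<Sum>\<mu>\<in>M. \<Sum>\<nu>\<in>N. (c \<mu> * d \<nu>) * monomial_fun m (\<lambda>i. \<mu> i + \<nu> i) v)" for v
    unfolding p q sum_product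
    by (intro sum.cong refl) (simp add: monomial_fun_def power_add prod.distrib)
  then show ?thesis
    by (simp only:) (intro polynomial_fun_sum polynomial_fun_monomial)
qed

lemma polynomial_fun_prod:
  "(\<And>x. x \<in> I \<Longrightarrow> polynomial_fun m (f x)) \<Longrightarrow> polynomial_fun m (\<lambda>v. \<Prod>x\<in>I. f x v)"
  by (induction I rule: infinite_finite_induct)
    (auto intro: polynomial_fun_mult simp: polynomial_fun_const)

lemma polynomial_fun_power: "polynomial_fun m p \<Longrightarrow> polynomial_fun m (\<lambda>v. p v ^ n)"
  by (induction n) (auto intro: polynomial_fun_mult simp: polynomial_fun_const)

lemma polynomial_fun_compose:
  assumes "polynomial_fun m p" "\<And>i. i \<in> cube m \<Longrightarrow> polynomial_fun m (\<lambda>v. L v i)"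
  shows "polynomial_fun m (\<lambda>v. p (L v))"
proof -
  obtain M c where M: "finite M" and p: "p = (\<lambda>v. \<Sum>\<mu>\<in>M. c \<mu> * monomial_fun m \<mu> v)"
    using assms(1) by (rule polynomial_funE)
  show ?thesis
    unfolding p monomial_fun_def
    by (intro polynomial_fun_sum polynomial_fun_mult polynomial_fun_const polynomial_fun_prod
        polynomial_fun_power assms(2))
qed

lemma monomial_fun_tscale: "monomial_fun m \<mu> (tscale t v) = t ^ monomial_degree m \<mu> * monomial_fun m \<mu> v"
  by (simp add: monomial_fun_def monomial_degree_def tscale_def power_mult_distrib prod.distrib
      power_sum[symmetric])

text \<open>
  List the coordinates with their multiplicities; products over the factors of a monomial are what
  the multilinear identities for block signs apply to.
\<close>
lemma monomial_fun_word:
  "\<exists>I. (\<forall>j<monomial_degree m \<mu>. I j \<in> cube m) \<and>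
     (\<forall>v. monomial_fun m \<mu> v = (\<Prod>j<monomial_degree m \<mu>. v (I j)))"
proof -
  have "\<exists>xs. set xs \<subseteq> S \<and> length xs = (\<Sum>i\<in>S. \<mu> i) \<and>
      (\<forall>v :: tensor3. prod_list (map v xs) = (\<Prod>i\<in>S. v i ^ \<mu> i))" if "finite S" for S
    using that
  proof (induction S rule: finite_induct)
    case empty
    then show ?case by simp
  next
    case (insert i S)
    then obtain xs where "set xs \<subseteq> S" "length xs = (\<Sum>i\<in>S. \<mu> i)"
      "\<forall>v :: tensor3. prod_list (map v xs) = (\<Prod>i\<in>S. v i ^ \<mu> i)" by blast
    then show ?case
      using insert.hyps by (intro exI[of _ "replicate (\<mu> i) i @ xs"]) (auto simp: map_replicate_const)
  qed
  from this[OF finite_cube, of m] obtain xs where xs: "set xs \<subseteq> cube m"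
    "length xs = monomial_degree m \<mu>" "\<And>v. prod_list (map v xs) = monomial_fun m \<mu> v"
    unfolding monomial_degree_def monomial_fun_def by blast
  have "monomial_fun m \<mu> v = (\<Prod>j<monomial_degree m \<mu>. v (xs ! j))" for v
    unfolding xs(3)[symmetric] prod.list_conv_set_nth by (simp add: xs(2) atLeast0LessThan)
  moreover have "xs ! j \<in> cube m" if "j < monomial_degree m \<mu>" for j
    using xs(1,2) that nth_mem by force
  ultimately show ?thesis by (intro exI[of _ "\<lambda>j. xs ! j"]) blast
qed

lemma cube_iff [simp]: "(a, b, c) \<in> cube m \<longleftrightarrow> a < m \<and> b < m \<and> c < m"
  by (simp add: cube_def)

lemma sum_cube: "(\<Sum>i\<in>cube m. f i) = (\<Sum>a<m. \<Sum>b<m. \<Sum>c<m. f (a, b, c))"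
  by (simp add: cube_def sum.cartesian_product case_prod_unfold)

lemma act_entry:
  assumes "a < m" "b < m" "c < m"
  shows "act m (A, B, C) w (a, b, c)
    = (\<Sum>i<m. \<Sum>j<m. \<Sum>k<m. A $$ (a, i) * B $$ (b, j) * C $$ (c, k) * w (i, j, k))"
  using assms by (simp add: act_def sum_cube)

lemma act_outside: "i \<notin> cube m \<Longrightarrow> act m g w i = 0"
  by (cases g; cases i) (simp only: act_def case_prod_conv if_False)

lemma act_in_tensors: "act m g w \<in> tensors m"
  by (simp add: tensors_def act_outside)

lemma tensor_eqI:
  assumes "v \<in> tensors m" "w \<in> tensors m"
    "\<And>a b c. a < m \<Longrightarrow> b < m \<Longrightarrow> c < m \<Longrightarrow> v (a, b, c) = w (a, b, c)"
  shows "v = w"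
proof
  fix i show "v i = w i"
    using assms by (cases i) (cases "i \<in> cube m"; auto simp: tensors_def)
qed

lemma tscale_in_tensors: "v \<in> tensors m \<Longrightarrow> tscale t v \<in> tensors m"
  by (simp add: tensors_def tscale_def)

lemma act_tscale: "act m g (tscale t v) = tscale t (act m g v)"
proof (cases g)
  case (fields A B C)
  show ?thesis
    unfolding fields
    by (rule tensor_eqI[OF act_in_tensors tscale_in_tensors[OF act_in_tensors]])
      (simp add: act_entry tscale_def sum_distrib_left mult_ac)
qed

lemma act_smult:
  assumes "A \<in> carrier_mat m m" "B \<in> carrier_mat m m" "C \<in> carrier_mat m m"
  shows "act m (a \<cdot>\<^sub>m A, b \<cdot>\<^sub>m B, c \<cdot>\<^sub>m C) v = tscale (a * b * c) (act m (A, B, C) v)"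
  by (rule tensor_eqI[OF act_in_tensors tscale_in_tensors[OF act_in_tensors]])
    (use assms in \<open>simp add: act_entry tscale_def sum_distrib_left mult_ac\<close>)

lemma sum_product3:
  fixes f g h :: "'a \<Rightarrow> 'b :: semiring_0"
  shows "sum f I * sum g I * sum h I = (\<Sum>x\<in>I. \<Sum>y\<in>I. \<Sum>z\<in>I. f x * g y * h z)"
  by (simp only: mult.assoc sum_product[of g I h I], simp only: sum_distrib_right,
      simp only: sum_distrib_left)

lemma act_mult:
  assumes "A \<in> carrier_mat m m" "B \<in> carrier_mat m m" "C \<in> carrier_mat m m"
    "A' \<in> carrier_mat m m" "B' \<in> carrier_mat m m" "C' \<in> carrier_mat m m"
  shows "act m (A * A', B * B', C * C') v = act m (A, B, C) (act m (A', B', C') v)"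
proof (rule tensor_eqI[OF act_in_tensors act_in_tensors])
  fix a b c assume abc: "a < m" "b < m" "c < m"
  have "act m (A * A', B * B', C * C') v (a, b, c)
      = (\<Sum>i<m. \<Sum>j<m. \<Sum>k<m. (\<Sum>x<m. A $$ (a, x) * A' $$ (x, i)) * (\<Sum>y<m. B $$ (b, y) * B' $$ (y, j))
          * (\<Sum>z<m. C $$ (c, z) * C' $$ (z, k)) * v (i, j, k))"
    using assms abc by (simp add: act_entry scalar_prod_def atLeast0LessThan)
  also have "\<dots> = (\<Sum>(i, j, k)\<in>cube m. \<Sum>(x, y, z)\<in>cube m.
      A $$ (a, x) * B $$ (b, y) * C $$ (c, z) * (A' $$ (x, i) * B' $$ (y, j) * C' $$ (z, k) * v (i, j, k)))"
    unfolding sum_cube case_prod_conv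
    by (intro sum.cong refl) (simp only: sum_product3, simp add: sum_distrib_left sum_distrib_right mult_ac)
  also have "\<dots> = (\<Sum>(x, y, z)\<in>cube m. A $$ (a, x) * B $$ (b, y) * C $$ (c, z) *
      (\<Sum>(i, j, k)\<in>cube m. A' $$ (x, i) * B' $$ (y, j) * C' $$ (z, k) * v (i, j, k)))"
    unfolding case_prod_unfold sum_distrib_left by (rule sum.swap)
  also have "\<dots> = act m (A, B, C) (act m (A', B', C') v) (a, b, c)"
    using abc by (simp add: act_entry sum_cube)
  finally show "act m (A * A', B * B', C * C') v (a, b, c)
      = act m (A, B, C) (act m (A', B', C') v) (a, b, c)" .
qed

lemma act_one:
  assumes "w \<in> tensors m"
  shows "act m (1\<^sub>m m, 1\<^sub>m m, 1\<^sub>m m) w = w"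
proof (rule tensor_eqI[OF act_in_tensors assms])
  have pull: "(\<Sum>k<m. if P then f k else 0) = (if P then \<Sum>k<m. f k else 0)"
    for P and f :: "nat \<Rightarrow> complex" by simp
  show "act m (1\<^sub>m m, 1\<^sub>m m, 1\<^sub>m m) w (a, b, c) = w (a, b, c)" if "a < m" "b < m" "c < m" for a b c
    using that by (simp add: act_entry pull if_distrib[of "\<lambda>x. x * _"] cong: if_cong)
qed

lemma polynomial_fun_act:
  assumes "polynomial_fun m p"
  shows "polynomial_fun m (\<lambda>v. p (act m g v))"
proof (rule polynomial_fun_compose[OF assms])
  fix i assume i: "i \<in> cube m"
  obtain A B C where g: "g = (A, B, C)" by (cases g)
  obtain a b c where abc: "i = (a, b, c)" by (cases i)
  show "polynomial_fun m (\<lambda>v. act m g v i)"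
    using i unfolding g abc
    by (auto simp: act_entry intro!: polynomial_fun_sum polynomial_fun_mult polynomial_fun_const
        polynomial_fun_coord)
qed

lemma SL_subset_GL: "SL m \<subseteq> GL m"
  by (auto simp: SL_def GL_iff)

lemma SL3_subset_GL3: "SL3 m \<subseteq> GL3 m"
  using SL_subset_GL by (auto simp: SL3_def GL3_def)

lemma GL_mult: "A \<in> GL m \<Longrightarrow> B \<in> GL m \<Longrightarrow> A * B \<in> GL m"
  by (auto simp: GL_iff det_mult)

lemma one_GL: "1\<^sub>m m \<in> GL m" and one_SL: "1\<^sub>m m \<in> SL m"
  by (auto simp: GL_iff SL_def)

lemma exists_complex_root:
  fixes z :: complex
  assumes "m \<ge> 1"
  shows "\<exists>c. c ^ m = z"
proof
  show "rcis (root m (cmod z)) (Arg z / m) ^ m = z"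
    using assms by (simp add: DeMoivre2 real_root_pow_pos2 rcis_cmod_Arg)
qed

lemma exists_primitive_root_of_unity:
  assumes "m \<ge> 1"
  shows "\<exists>\<zeta> :: complex. \<forall>d. \<zeta> ^ d = 1 \<longleftrightarrow> m dvd d"
proof
  let ?\<zeta> = "cis (2 * pi / m)"
  show "\<forall>d. ?\<zeta> ^ d = 1 \<longleftrightarrow> m dvd d"
  proof
    fix d
    have "?\<zeta> ^ d = cis (2 * pi * (d / m))" by (simp add: DeMoivre mult_ac)
    also have "\<dots> = 1 \<longleftrightarrow> cos (2 * pi * (d / m)) = 1"
      by (auto simp: complex_eq_iff cos_one_sin_zero)
    also have "\<dots> \<longleftrightarrow> (\<exists>n :: int. real d / m = n)"
    proof -
      have "2 * pi * (d / m) = real_of_int n * 2 * pi \<longleftrightarrow> real d / m = n" for n :: int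
        using mult_cancel_left[of "2 * pi" "d / m" n] by (simp add: mult_ac)
      then show ?thesis by (simp only: cos_one_2pi_int)
    qed
    also have "\<dots> \<longleftrightarrow> m dvd d"
    proof
      assume "\<exists>n :: int. real d / m = n"
      then obtain n :: int where "real d = n * m" using assms by (auto simp: field_simps)
      then have "int d = n * int m" by (metis of_int_eq_iff of_int_mult of_int_of_nat_eq)
      then have "int m dvd int d" by simp
      then show "m dvd d" by simp
    next
      assume "m dvd d"
      then obtain n where "d = m * n" by (rule dvdE)
      then show "\<exists>n :: int. real d / m = n" using assms by (intro exI[of _ "int n"]) simp
    qed
    finally show "?\<zeta> ^ d = 1 \<longleftrightarrow> m dvd d" .
  qed
qed

lemma SL_normalize:
  assumes "A \<in> GL m" "c ^ m = det A"
  shows "(1 / c) \<cdot>\<^sub>m A \<in> SL m \<and> c \<cdot>\<^sub>m ((1 / c) \<cdot>\<^sub>m A) = A"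
proof -
  have A: "A \<in> carrier_mat m m" "det A \<noteq> 0" using assms(1) by (auto simp: GL_iff)
  show ?thesis
  proof (cases "m = 0")
    case True
    then have "det A = 1" using assms(2) by simp
    then show ?thesis using A True by (auto simp: SL_def intro!: eq_matI)
  next
    case False
    then have "c \<noteq> 0" using assms(2) A(2) by (auto simp: power_0_left)
    then show ?thesis
      using A assms(2) by (auto simp: SL_def power_one_over intro!: eq_matI)
  qed
qed

text \<open>
  The scalar \<open>c\<close> may be any \<open>m\<close>-th root of \<open>\<chi>(g)\<close>: two of the three determinants are normalized by
  arbitrary roots, and the third by the quotient.  The freedom to change \<open>c\<close> by an \<open>m\<close>-th root of
  unity is used to discard the degrees that \<open>m\<close> does not divide.
\<close>
lemma GL3_eq_scalar_SL3:
  assumes m: "m \<ge> 1" and g: "g \<in> GL3 m" and c: "c ^ m = chi g"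
  shows "\<exists>g'\<in>SL3 m. \<forall>v. act m g v = tscale c (act m g' v)"
proof -
  obtain A B C where g_eq: "g = (A, B, C)" by (cases g)
  have G: "A \<in> GL m" "B \<in> GL m" "C \<in> GL m" using g by (auto simp: g_eq GL3_def)
  obtain a b where a: "a ^ m = det A" and b: "b ^ m = det B"
    using exists_complex_root[OF m] by metis
  have nz: "a \<noteq> 0" "b \<noteq> 0" using a b G m by (auto simp: GL_iff power_0_left)
  have "(c / (a * b)) ^ m = det C"
    using c a b G by (simp add: g_eq chi_def power_divide power_mult_distrib GL_iff)
  note n = SL_normalize[OF G(1) a] SL_normalize[OF G(2) b] SL_normalize[OF G(3) this]
  define A' B' C' where "A' = (1 / a) \<cdot>\<^sub>m A" and "B' = (1 / b) \<cdot>\<^sub>m B"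
    and "C' = (1 / (c / (a * b))) \<cdot>\<^sub>m C"
  note n = n[folded A'_def B'_def C'_def]
  have S: "(A', B', C') \<in> SL3 m" using n by (simp add: SL3_def)
  have "act m g v = tscale c (act m (A', B', C') v)" for v
  proof -
    have "act m (a \<cdot>\<^sub>m A', b \<cdot>\<^sub>m B', (c / (a * b)) \<cdot>\<^sub>m C') v
        = tscale (a * b * (c / (a * b))) (act m (A', B', C') v)"
      by (rule act_smult) (use n in \<open>auto simp: SL_def\<close>)
    then show ?thesis using n nz by (simp add: g_eq)
  qed
  then show ?thesis using S by blast
qed

lemma chi_nonzero: "g \<in> GL3 m \<Longrightarrow> chi g \<noteq> 0"
  by (auto simp: GL3_def chi_def GL_iff)

section \<open>Averaging polynomials to relative invariants\<close>

text \<open>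
  The average of \<open>f\<close> over \<open>GL\<^sub>m\<^sup>3\<close>.  For \<open>f\<close> of degree \<open>k m\<close> and \<open>r = K - k\<close> the twist \<open>\<chi>\<^sup>r\<close> raises
  the degree in the entries of each factor to \<open>K m\<close>, so that one and the same quadrature treats the
  components of different degrees of a polynomial.
\<close>
definition quad_average ::
  "nat \<Rightarrow> 't set \<Rightarrow> ('t \<Rightarrow> complex) \<Rightarrow> ('t \<Rightarrow> complex mat) \<Rightarrow> nat \<Rightarrow> (tensor3 \<Rightarrow> complex) \<Rightarrow> tensor3 \<Rightarrow> complex" where
  "quad_average m T c g r f v = (\<Sum>s\<in>T. c s * (\<Sum>t\<in>T. c t * (\<Sum>u\<in>T. c u *
     (chi (g s, g t, g u) ^ r * f (act m (g s, g t, g u) v)))))"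

lemma polynomial_fun_quad_average:
  "polynomial_fun m f \<Longrightarrow> polynomial_fun m (quad_average m T c g r f)"
  unfolding quad_average_def
  by (intro polynomial_fun_sum polynomial_fun_mult polynomial_fun_const polynomial_fun_act)

lemma quad_average_tscale:
  assumes "\<And>v. f (tscale x v) = x ^ d * f v"
  shows "quad_average m T c g r f (tscale x v) = x ^ d * quad_average m T c g r f v"
  by (simp add: quad_average_def act_tscale assms sum_distrib_left mult_ac)

lemma entry_form_act:
  assumes "i \<in> cube m"
  shows "entry_form m 1 (\<lambda>A. act m (A, B, C) v i)"
    and "entry_form m 1 (\<lambda>B. act m (A, B, C) v i)"
    and "entry_form m 1 (\<lambda>C. act m (A, B, C) v i)"
proof -
  obtain a b c where i: "i = (a, b, c)" by (cases i)
  with assms have lt: "a < m" "b < m" "c < m" by auto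
  note form = entry_form_sum entry_form.scale entry_form_entry lt
  have "(\<lambda>A. act m (A, B, C) v i)
      = (\<lambda>A. \<Sum>x<m. \<Sum>y<m. \<Sum>z<m. (B $$ (b, y) * C $$ (c, z) * v (x, y, z)) * A $$ (a, x))"
    using lt by (simp add: i act_entry mult_ac)
  then show "entry_form m 1 (\<lambda>A. act m (A, B, C) v i)" by (simp only:) (intro form; simp)
  have "(\<lambda>B. act m (A, B, C) v i)
      = (\<lambda>B. \<Sum>x<m. \<Sum>y<m. \<Sum>z<m. (A $$ (a, x) * C $$ (c, z) * v (x, y, z)) * B $$ (b, y))"
    using lt by (simp add: i act_entry mult_ac)
  then show "entry_form m 1 (\<lambda>B. act m (A, B, C) v i)" by (simp only:) (intro form; simp)
  have "(\<lambda>C. act m (A, B, C) v i)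
      = (\<lambda>C. \<Sum>x<m. \<Sum>y<m. \<Sum>z<m. (A $$ (a, x) * B $$ (b, y) * v (x, y, z)) * C $$ (c, z))"
    using lt by (simp add: i act_entry mult_ac)
  then show "entry_form m 1 (\<lambda>C. act m (A, B, C) v i)" by (simp only:) (intro form; simp)
qed

text \<open>
  The invariance of the quadrature is applied to one factor of \<open>GL\<^sub>m\<^sup>3\<close> at a time, starting with the
  innermost sum.  It produces \<open>\<chi>(h)\<^sup>K\<close>, of which \<open>\<chi>(h)\<^sup>r\<close> is due to the twist.
\<close>
lemma quad_average_relative_invariance:
  assumes q: "det_quadrature m K e T c g" and h: "h \<in> GL3 m" and K: "r + k = K"
    and I: "\<And>j. j < k * m \<Longrightarrow> I j \<in> cube m" and f: "f = (\<lambda>v. \<Prod>j<k * m. v (I j))"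
  shows "quad_average m T c g r f (act m h v) = chi h ^ k * quad_average m T c g r f v"
proof -
  obtain X Y Z where h_eq: "h = (X, Y, Z)" by (cases h)
  have car: "X \<in> carrier_mat m m" "Y \<in> carrier_mat m m" "Z \<in> carrier_mat m m"
    using h by (auto simp: h_eq GL3_def GL_iff)
  define \<Phi> where "\<Phi> A B C = chi (A, B, C) ^ r * f (act m (A, B, C) v)" for A B C
  have deg: "r * m + k * m = K * m" using K by (simp add: distrib_right[symmetric])
  have prod_form: "entry_form m (k * m) (\<lambda>A. \<Prod>j<k * m. L A (I j))"
    if "\<And>i. i \<in> cube m \<Longrightarrow> entry_form m 1 (\<lambda>A. L A i)" for L
    using entry_form_prod[of "{..<k * m}" m "\<lambda>j A. L A (I j)"] that I by simp
  note form = entry_form_mult[OF entry_form_power[OF entry_form_det, where r = r] prod_form, unfolded deg]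
  have \<Phi>1: "entry_form m (K * m) (\<lambda>A. \<Phi> A B C)" for B C
  proof -
    have "(\<lambda>A. \<Phi> A B C) = (\<lambda>A. (det B * det C) ^ r * (det A ^ r * (\<Prod>j<k * m. act m (A, B, C) v (I j))))"
      by (simp add: \<Phi>_def chi_def f power_mult_distrib mult_ac)
    then show ?thesis by (simp only:) (intro entry_form.scale form entry_form_act)
  qed
  have \<Phi>2: "entry_form m (K * m) (\<lambda>B. \<Phi> A B C)" for A C
  proof -
    have "(\<lambda>B. \<Phi> A B C) = (\<lambda>B. (det A * det C) ^ r * (det B ^ r * (\<Prod>j<k * m. act m (A, B, C) v (I j))))"
      by (simp add: \<Phi>_def chi_def f power_mult_distrib mult_ac)
    then show ?thesis by (simp only:) (intro entry_form.scale form entry_form_act)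
  qed
  have \<Phi>3: "entry_form m (K * m) (\<lambda>C. \<Phi> A B C)" for A B
  proof -
    have "(\<lambda>C. \<Phi> A B C) = (\<lambda>C. (det A * det B) ^ r * (det C ^ r * (\<Prod>j<k * m. act m (A, B, C) v (I j))))"
      by (simp add: \<Phi>_def chi_def f power_mult_distrib mult_ac)
    then show ?thesis by (simp only:) (intro entry_form.scale form entry_form_act)
  qed
  have "chi h ^ r * quad_average m T c g r f (act m h v)
      = (\<Sum>s\<in>T. c s * (\<Sum>t\<in>T. c t * (\<Sum>u\<in>T. c u * \<Phi> (g s * X) (g t * Y) (g u * Z))))"
  proof -
    have "\<Phi> (g s * X) (g t * Y) (g u * Z)
        = chi h ^ r * (chi (g s, g t, g u) ^ r * f (act m (g s, g t, g u) (act m h v)))"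
      if "s \<in> T" "t \<in> T" "u \<in> T" for s t u
      using det_quadrature_carrier[OF q that(1)] det_quadrature_carrier[OF q that(2)]
        det_quadrature_carrier[OF q that(3)] car
      by (simp add: \<Phi>_def chi_def act_mult h_eq det_mult[of _ m] power_mult_distrib mult_ac)
    then show ?thesis
      by (simp add: quad_average_def sum_distrib_left mult_ac)
  qed
  also have "\<dots> = (\<Sum>s\<in>T. c s * (\<Sum>t\<in>T. c t * (det Z ^ K * (\<Sum>u\<in>T. c u * \<Phi> (g s * X) (g t * Y) (g u)))))"
    by (simp only: det_quadrature_relative_invariance[OF q car(3) \<Phi>3])
  also have "\<dots> = det Z ^ K * (\<Sum>s\<in>T. c s * (\<Sum>t\<in>T. c t * (\<Sum>u\<in>T. c u * \<Phi> (g s * X) (g t * Y) (g u))))"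
    by (simp add: sum_distrib_left mult_ac)
  also have "\<dots> = det Z ^ K * (\<Sum>s\<in>T. c s * (det Y ^ K *
      (\<Sum>t\<in>T. c t * (\<Sum>u\<in>T. c u * \<Phi> (g s * X) (g t) (g u)))))"
  proof -
    have "entry_form m (K * m) (\<lambda>B. \<Sum>u\<in>T. c u * \<Phi> A B (g u))" for A
      by (intro entry_form_sum entry_form.scale \<Phi>2)
    then show ?thesis by (subst det_quadrature_relative_invariance[OF q car(2)]) auto
  qed
  also have "\<dots> = det Z ^ K * det Y ^ K *
      (\<Sum>s\<in>T. c s * (\<Sum>t\<in>T. c t * (\<Sum>u\<in>T. c u * \<Phi> (g s * X) (g t) (g u))))"
    by (simp add: sum_distrib_left mult_ac)
  also have "\<dots> = det Z ^ K * det Y ^ K * (det X ^ K *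
      (\<Sum>s\<in>T. c s * (\<Sum>t\<in>T. c t * (\<Sum>u\<in>T. c u * \<Phi> (g s) (g t) (g u)))))"
  proof -
    have "entry_form m (K * m) (\<lambda>A. \<Sum>t\<in>T. c t * (\<Sum>u\<in>T. c u * \<Phi> A (g t) (g u)))"
      by (intro entry_form_sum entry_form.scale \<Phi>1)
    then show ?thesis by (subst det_quadrature_relative_invariance[OF q car(1)]) auto
  qed
  also have "\<dots> = chi h ^ K * quad_average m T c g r f v"
    by (simp add: quad_average_def \<Phi>_def h_eq chi_def power_mult_distrib mult_ac)
  also have "\<dots> = chi h ^ r * (chi h ^ k * quad_average m T c g r f v)"
    using K by (simp add: power_add[symmetric] mult.assoc[symmetric])
  finally show ?thesis using chi_nonzero[OF h] by simp
qed

lemma weighted_sum_swap: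
  fixes c :: "'t \<Rightarrow> complex"
  shows "(\<Sum>u\<in>T. c u * (\<Sum>x\<in>Q. f x * C u x)) = (\<Sum>x\<in>Q. f x * (\<Sum>u\<in>T. c u * C u x))"
  unfolding sum_distrib_left by (subst sum.swap) (simp add: mult_ac)

lemma sum_powers_of_root_of_unity:
  fixes \<zeta> :: complex
  assumes "\<And>d. \<zeta> ^ d = 1 \<longleftrightarrow> m dvd d"
  shows "(\<Sum>j<m. (\<zeta> ^ d) ^ j) = (if m dvd d then of_nat m else 0)"
proof -
  have "(\<zeta> ^ d) ^ m = 1" by (simp add: power_mult[symmetric] assms)
  then show ?thesis by (simp add: sum_gp_strict assms)
qed

lemma sum_weights_chi_power:
  "(\<Sum>s\<in>T. c s * (\<Sum>t\<in>T. c t * (\<Sum>u\<in>T. c u * (chi (g s, g t, g u) ^ K * z))))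
    = (\<Sum>t\<in>T. c t * det (g t) ^ K) ^ 3 * z" (is "_ = ?D ^ 3 * z")
proof -
  have one: "(\<Sum>t\<in>T. c t * (x * det (g t) ^ K * y)) = x * ?D * y" for x y
    unfolding sum_distrib_left sum_distrib_right by (simp add: mult_ac)
  have "(\<Sum>u\<in>T. c u * (chi (g s, g t, g u) ^ K * z)) = det (g s) ^ K * det (g t) ^ K * (?D * z)" for s t
    using one[of "det (g s) ^ K * det (g t) ^ K" z] by (simp add: chi_def power_mult_distrib mult_ac)
  then have "(\<Sum>t\<in>T. c t * (\<Sum>u\<in>T. c u * (chi (g s, g t, g u) ^ K * z)))
      = 1 * det (g s) ^ K * (?D * (?D * z))" for s
    using one[of "det (g s) ^ K" "?D * z"] by (simp add: mult_ac)
  then show ?thesis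
    by (simp only: one) (simp add: power3_eq_cube)
qed

text \<open>
  A polynomial \<open>p = \<Sum>\<^sub>\<mu> p\<^sub>\<mu>\<close> that is constant on \<open>SL\<^sub>m\<^sup>3 w\<close> satisfies
  \<open>\<chi>(h)\<^sup>K p(w) = \<Sum>\<^sub>\<mu> \<chi>(h)\<^sup>K\<^sup>-\<^sup>k\<^sup>(\<^sup>\<mu>\<^sup>) p\<^sub>\<mu>(h w)\<close> for all \<open>h \<in> GL\<^sub>m\<^sup>3\<close>, where \<open>\<mu>\<close> ranges over the
  monomials whose degree \<open>k(\<mu>) m\<close> is a multiple of \<open>m\<close>: write \<open>h\<close> as a scalar \<open>c\<close> times an element
  of \<open>SL\<^sub>m\<^sup>3\<close> and sum over the \<open>m\<close> choices of \<open>c\<close>.  Averaging this identity leaves a nonzero number on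
  the left, so some monomial has a nonzero average at \<open>w\<close>.
\<close>
lemma exists_nonzero_average:
  assumes m: "m \<ge> 1" and q: "det_quadrature m K e T c g" and M: "finite M"
    and inv: "\<And>h. h \<in> SL3 m \<Longrightarrow>
      (\<Sum>\<mu>\<in>M. coef \<mu> * monomial_fun m \<mu> (act m h w)) = (\<Sum>\<mu>\<in>M. coef \<mu> * monomial_fun m \<mu> w)"
    and nz: "(\<Sum>\<mu>\<in>M. coef \<mu> * monomial_fun m \<mu> w) \<noteq> 0"
    and deg: "\<And>\<mu>. \<mu> \<in> M \<Longrightarrow> m dvd monomial_degree m \<mu> \<Longrightarrow> monomial_degree m \<mu> \<le> K * m"
  shows "\<exists>\<mu>\<in>M. coef \<mu> \<noteq> 0 \<and> m dvd monomial_degree m \<mu> \<and>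
    quad_average m T c g (K - monomial_degree m \<mu> div m) (monomial_fun m \<mu>) w \<noteq> 0"
proof -
  let ?p = "\<lambda>v. \<Sum>\<mu>\<in>M. coef \<mu> * monomial_fun m \<mu> v"
  let ?deg = "monomial_degree m"
  define N where "N = {\<mu> \<in> M. m dvd ?deg \<mu>}"
  obtain \<zeta> :: complex where \<zeta>: "\<And>d. \<zeta> ^ d = 1 \<longleftrightarrow> m dvd d"
    using exists_primitive_root_of_unity[OF m] by blast
  have GL_identity: "chi h ^ K * ?p w
      = (\<Sum>\<mu>\<in>N. coef \<mu> * (chi h ^ (K - ?deg \<mu> div m) * monomial_fun m \<mu> (act m h w)))"
    if h: "h \<in> GL3 m" for h
  proof -
    obtain y where y: "y ^ m = 1 / chi h" using exists_complex_root[OF m] by blast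
    have chi: "chi h \<noteq> 0" by (rule chi_nonzero[OF h])
    (* Every m-th root x of 1 / chi h gives the same value; y is one of them, and the others are its
       multiples by powers of \<zeta>. *)
    have scaled: "?p w = (\<Sum>\<mu>\<in>M. coef \<mu> * ((x ^ ?deg \<mu>) * monomial_fun m \<mu> (act m h w)))"
      if x: "x ^ m = 1 / chi h" for x
    proof -
      have x0: "x \<noteq> 0" using x chi m by (auto simp: power_0_left)
      have "(1 / x) ^ m = chi h" using x by (simp add: power_one_over)
      then obtain h' where h': "h' \<in> SL3 m" "\<And>v. act m h v = tscale (1 / x) (act m h' v)"
        using GL3_eq_scalar_SL3[OF m h] by blast
      have "act m h' w = tscale x (act m h w)"
        using x0 by (simp add: h'(2) tscale_def)
      then have "?p (act m h' w) = (\<Sum>\<mu>\<in>M. coef \<mu> * ((x ^ ?deg \<mu>) * monomial_fun m \<mu> (act m h w)))"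
        by (simp add: monomial_fun_tscale)
      then show ?thesis using inv[OF h'(1)] by simp
    qed
    have "of_nat m * ?p w = (\<Sum>j<m. ?p w)" by simp
    also have "\<dots> = (\<Sum>j<m. \<Sum>\<mu>\<in>M. coef \<mu> * (((y * \<zeta> ^ j) ^ ?deg \<mu>) * monomial_fun m \<mu> (act m h w)))"
    proof (rule sum.cong[OF refl], rule scaled)
      fix j
      have "(\<zeta> ^ j) ^ m = 1" by (simp add: power_mult[symmetric] \<zeta>)
      then show "(y * \<zeta> ^ j) ^ m = 1 / chi h" by (simp add: power_mult_distrib y)
    qed
    also have "\<dots> = (\<Sum>\<mu>\<in>M. (\<Sum>j<m. (\<zeta> ^ ?deg \<mu>) ^ j) *
        (coef \<mu> * (y ^ ?deg \<mu> * monomial_fun m \<mu> (act m h w))))"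
      by (subst sum.swap)
        (simp add: sum_distrib_left sum_distrib_right power_mult_distrib power_mult[symmetric] mult_ac)
    also have "\<dots> = (\<Sum>\<mu>\<in>M. if m dvd ?deg \<mu>
        then of_nat m * (coef \<mu> * (y ^ ?deg \<mu> * monomial_fun m \<mu> (act m h w))) else 0)"
      by (intro sum.cong refl) (simp add: sum_powers_of_root_of_unity[OF \<zeta>])
    also have "\<dots> = of_nat m * (\<Sum>\<mu>\<in>N. coef \<mu> * (y ^ ?deg \<mu> * monomial_fun m \<mu> (act m h w)))"
      unfolding N_def sum_distrib_left using M by (simp add: sum.inter_filter)
    finally have "?p w = (\<Sum>\<mu>\<in>N. coef \<mu> * (y ^ ?deg \<mu> * monomial_fun m \<mu> (act m h w)))"
      using m by simp
    then have "chi h ^ K * ?p w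
        = (\<Sum>\<mu>\<in>N. coef \<mu> * (chi h ^ K * y ^ ?deg \<mu> * monomial_fun m \<mu> (act m h w)))"
      by (simp add: sum_distrib_left mult_ac)
    also have "\<dots> = (\<Sum>\<mu>\<in>N. coef \<mu> * (chi h ^ (K - ?deg \<mu> div m) * monomial_fun m \<mu> (act m h w)))"
    proof (intro sum.cong refl)
      fix \<mu> assume "\<mu> \<in> N"
      then have \<mu>: "\<mu> \<in> M" "m dvd ?deg \<mu>" by (auto simp: N_def)
      then obtain l where l: "?deg \<mu> = m * l" by (auto elim: dvdE)
      have "l \<le> K" using deg[OF \<mu>] m by (simp add: l mult.commute)
      then have "chi h ^ K = chi h ^ (K - l) * chi h ^ l" by (simp add: power_add[symmetric])
      then have "chi h ^ K * y ^ ?deg \<mu> = chi h ^ (K - ?deg \<mu> div m)"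
        using m chi by (simp add: l power_mult y power_one_over)
      then show "coef \<mu> * (chi h ^ K * y ^ ?deg \<mu> * monomial_fun m \<mu> (act m h w))
        = coef \<mu> * (chi h ^ (K - ?deg \<mu> div m) * monomial_fun m \<mu> (act m h w))" by simp
    qed
    finally show ?thesis .
  qed
  have "(\<Sum>s\<in>T. c s * (\<Sum>t\<in>T. c t * (\<Sum>u\<in>T. c u * (chi (g s, g t, g u) ^ K * ?p w))))
      = (\<Sum>t\<in>T. c t * det (g t) ^ K) ^ 3 * ?p w"
    by (rule sum_weights_chi_power)
  moreover have "(\<Sum>t\<in>T. c t * det (g t) ^ K) \<noteq> 0" by (rule det_quadrature_det_power[OF q])
  moreover have "(\<Sum>s\<in>T. c s * (\<Sum>t\<in>T. c t * (\<Sum>u\<in>T. c u * (chi (g s, g t, g u) ^ K * ?p w))))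
      = (\<Sum>\<mu>\<in>N. coef \<mu> * quad_average m T c g (K - ?deg \<mu> div m) (monomial_fun m \<mu>) w)"
  proof -
    have "(\<Sum>s\<in>T. c s * (\<Sum>t\<in>T. c t * (\<Sum>u\<in>T. c u * (chi (g s, g t, g u) ^ K * ?p w))))
      = (\<Sum>s\<in>T. c s * (\<Sum>t\<in>T. c t * (\<Sum>u\<in>T. c u * (\<Sum>\<mu>\<in>N. coef \<mu> *
          (chi (g s, g t, g u) ^ (K - ?deg \<mu> div m) * monomial_fun m \<mu> (act m (g s, g t, g u) w))))))"
      by (intro sum.cong refl arg_cong2[where f = "(*)"] GL_identity)
        (simp add: GL3_def det_quadrature_GL[OF q])
    also have "\<dots> = (\<Sum>\<mu>\<in>N. coef \<mu> * quad_average m T c g (K - ?deg \<mu> div m) (monomial_fun m \<mu>) w)"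
      unfolding weighted_sum_swap[where c = c and T = T and f = coef and Q = N] quad_average_def ..
    finally show ?thesis .
  qed
  ultimately have "(\<Sum>\<mu>\<in>N. coef \<mu> * quad_average m T c g (K - ?deg \<mu> div m) (monomial_fun m \<mu>) w) \<noteq> 0"
    using nz by simp
  then obtain \<mu> where "\<mu> \<in> N" "coef \<mu> * quad_average m T c g (K - ?deg \<mu> div m) (monomial_fun m \<mu>) w \<noteq> 0"
    by (meson sum.not_neutral_contains_not_neutral)
  then show ?thesis unfolding N_def by auto
qed

definition relative_invariant :: "nat \<Rightarrow> nat \<Rightarrow> (tensor3 \<Rightarrow> complex) \<Rightarrow> bool" where
  "relative_invariant m k P \<longleftrightarrow> polynomial_fun m P \<and>
     (\<forall>t v. P (tscale t v) = t ^ (k * m) * P v) \<and>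
     (\<forall>h\<in>GL3 m. \<forall>v. P (act m h v) = chi h ^ k * P v)"

text \<open>
  The closed orbit \<open>SL\<^sub>m\<^sup>3 w\<close> misses \<open>0\<close>, so a defining polynomial \<open>p\<close> of the orbit has \<open>p(0) \<noteq> 0\<close>.
  Then \<open>p(0) - p\<close> has no constant term and equals \<open>p(0)\<close> on the orbit; averaging one of its
  monomials gives the invariant.
\<close>
lemma polystable_nonzero_invariant:
  assumes m: "m \<ge> 1" and w: "w \<in> tensors m" "w \<noteq> (\<lambda>_. 0)" and poly: "polystable m w"
  shows "\<exists>k\<ge>1. \<exists>P. relative_invariant m k P \<and> P w \<noteq> 0"
proof -
  have w_orbit: "w \<in> orbit m (SL3 m) w"
    unfolding orbit_def
    by (rule image_eqI[of _ _ "(1\<^sub>m m, 1\<^sub>m m, 1\<^sub>m m)"])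
      (simp_all add: act_one[OF w(1)] one_SL SL3_def)
  have "(\<lambda>_. 0) \<notin> orbit m (SL3 m) w"
  proof
    assume "(\<lambda>_. 0) \<in> orbit m (SL3 m) w"
    then obtain A B C where h: "A \<in> SL m" "B \<in> SL m" "C \<in> SL m" and 0: "act m (A, B, C) w = (\<lambda>_. 0)"
      by (auto simp: orbit_def SL3_def)
    have "\<exists>A'. A' \<in> carrier_mat m m \<and> A' * A = 1\<^sub>m m" if "A \<in> SL m" for A
    proof -
      have "A \<in> Units (ring_mat TYPE(complex) m ())"
        by (rule det_non_zero_imp_unit) (use that in \<open>auto simp: SL_def\<close>)
      then show ?thesis by (auto simp: Units_def ring_mat_def)
    qed
    then obtain A' B' C' where inv: "A' \<in> carrier_mat m m" "A' * A = 1\<^sub>m m" "B' \<in> carrier_mat m m"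
      "B' * B = 1\<^sub>m m" "C' \<in> carrier_mat m m" "C' * C = 1\<^sub>m m"
      using h by metis
    have "w = act m (A' * A, B' * B, C' * C) w" using act_one[OF w(1)] inv by simp
    also have "\<dots> = act m (A', B', C') (\<lambda>_. 0)"
      using act_mult[OF inv(1,3,5), of A B C w] h 0 by (simp add: SL_def)
    also have "\<dots> = tscale 0 (act m (A', B', C') (\<lambda>_. 0))"
      using act_tscale[of m _ 0 "\<lambda>_. 0"] by (simp add: tscale_def)
    finally show False using w(2) by (simp add: tscale_def)
  qed
  moreover have "(\<lambda>_. 0) \<in> tensors m" by (simp add: tensors_def)
  ultimately obtain p where p: "polynomial_fun m p" "p (\<lambda>_. 0) \<noteq> 0"
    and p_orbit: "\<And>v. v \<in> orbit m (SL3 m) w \<Longrightarrow> p v = 0"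
    using poly unfolding polystable_def zariski_closed_def by blast
  obtain M coef where M: "finite M" and q: "(\<lambda>v. p (\<lambda>_. 0) + (-1) * p v) = (\<lambda>v. \<Sum>\<mu>\<in>M. coef \<mu> * monomial_fun m \<mu> v)"
    by (rule polynomial_funE[OF polynomial_fun_add[OF polynomial_fun_const[of m "p (\<lambda>_. 0)"]
          polynomial_fun_mult[OF polynomial_fun_const[of m "-1"] p(1)]]])
  define M' where "M' = {\<mu> \<in> M. monomial_degree m \<mu> \<noteq> 0}"
  (* The monomials of degree 0 contribute the value of p 0 - p at 0, which is 0. *)
  have split: "p (\<lambda>_. 0) - p v = (\<Sum>\<mu>\<in>M'. coef \<mu> * monomial_fun m \<mu> v)" for v
  proof -
    let ?R = "\<Sum>\<mu>\<in>M - M'. coef \<mu>"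
    have eq: "p (\<lambda>_. 0) - p v = (\<Sum>\<mu>\<in>M'. coef \<mu> * monomial_fun m \<mu> v) + ?R" for v
    proof -
      have "p (\<lambda>_. 0) - p v = (\<Sum>\<mu>\<in>M. coef \<mu> * monomial_fun m \<mu> v)"
        using fun_cong[OF q, of v] by simp
      also have "\<dots> = (\<Sum>\<mu>\<in>M'. coef \<mu> * monomial_fun m \<mu> v) + (\<Sum>\<mu>\<in>M - M'. coef \<mu> * monomial_fun m \<mu> v)"
        using M by (subst sum.subset_diff[of M' M]) (auto simp: M'_def)
      also have "(\<Sum>\<mu>\<in>M - M'. coef \<mu> * monomial_fun m \<mu> v) = ?R"
        by (intro sum.cong refl) (auto simp: M'_def monomial_degree_def monomial_fun_def)
      finally show ?thesis .
    qed
    have "monomial_fun m \<mu> (\<lambda>_. 0) = 0" if "\<mu> \<in> M'" for \<mu>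
      using that by (auto simp: M'_def monomial_degree_def monomial_fun_def)
    then have "?R = 0" using eq[of "\<lambda>_. 0"] by simp
    then show ?thesis using eq by simp
  qed
  have M': "finite M'" using M by (simp add: M'_def)
  (* Any K such that K m bounds the degrees of all monomials would do. *)
  define K where "K = (\<Sum>\<mu>\<in>M'. monomial_degree m \<mu>)"
  obtain e T c g where quad: "det_quadrature m K e (T :: ((nat \<Rightarrow> nat) \<times> (nat \<Rightarrow> nat) \<times> nat set) set) c g"
    using exists_det_quadrature[OF block_enum_standard] by blast
  have const: "(\<Sum>\<mu>\<in>M'. coef \<mu> * monomial_fun m \<mu> v) = p (\<lambda>_. 0)" if "v \<in> orbit m (SL3 m) w" for v
    using split[of v] p_orbit[OF that] by simp
  have "\<exists>\<mu>\<in>M'. coef \<mu> \<noteq> 0 \<and> m dvd monomial_degree m \<mu> \<and>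
    quad_average m T c g (K - monomial_degree m \<mu> div m) (monomial_fun m \<mu>) w \<noteq> 0"
  proof (rule exists_nonzero_average[OF m quad M'])
    show "(\<Sum>\<mu>\<in>M'. coef \<mu> * monomial_fun m \<mu> (act m h w)) = (\<Sum>\<mu>\<in>M'. coef \<mu> * monomial_fun m \<mu> w)"
      if "h \<in> SL3 m" for h
      using const[of "act m h w"] const[OF w_orbit] that by (simp add: orbit_def)
    show "(\<Sum>\<mu>\<in>M'. coef \<mu> * monomial_fun m \<mu> w) \<noteq> 0" using const[OF w_orbit] p(2) by simp
    show "monomial_degree m \<mu> \<le> K * m" if "\<mu> \<in> M'" for \<mu>
    proof -
      have "monomial_degree m \<mu> * 1 \<le> K * m"
        unfolding K_def by (intro mult_mono member_le_sum that M' m) auto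
      then show ?thesis by simp
    qed
  qed
  then obtain \<mu> where \<mu>: "\<mu> \<in> M'" "m dvd monomial_degree m \<mu>"
    "quad_average m T c g (K - monomial_degree m \<mu> div m) (monomial_fun m \<mu>) w \<noteq> 0" by blast
  define k where "k = monomial_degree m \<mu> div m"
  have k: "monomial_degree m \<mu> = k * m" using \<mu>(2) by (simp add: k_def)
  have "k \<le> monomial_degree m \<mu>" using m by (simp add: k)
  also have "\<dots> \<le> K" using member_le_sum[OF \<mu>(1), of "monomial_degree m"] M' by (simp add: K_def)
  finally have kK: "(K - k) + k = K" by simp
  have "k \<ge> 1" using \<mu>(1) k by (cases k) (auto simp: M'_def)
  obtain I where I: "\<forall>j<k * m. I j \<in> cube m"
    and mono: "\<forall>v. monomial_fun m \<mu> v = (\<Prod>j<k * m. v (I j))"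
    using monomial_fun_word[of m \<mu>] unfolding k by (elim exE conjE)
  let ?P = "quad_average m T c g (K - k) (monomial_fun m \<mu>)"
  have "relative_invariant m k ?P"
    unfolding relative_invariant_def
  proof (intro conjI allI ballI)
    show "polynomial_fun m ?P"
      using polynomial_fun_quad_average[OF polynomial_fun_monomial[of m 1 \<mu>]] by simp
    show "?P (tscale t v) = t ^ (k * m) * ?P v" for t v
      by (rule quad_average_tscale) (simp add: monomial_fun_tscale k)
    show "?P (act m h v) = chi h ^ k * ?P v" if "h \<in> GL3 m" for h v
    proof (rule quad_average_relative_invariance[OF quad that kK])
      show "monomial_fun m \<mu> = (\<lambda>v. \<Prod>j<k * m. v (I j))" using mono by (intro ext) simp
    qed (use I in simp)
  qed
  moreover have "?P w \<noteq> 0" unfolding k_def by (rule \<mu>(3))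
  ultimately show ?thesis using \<open>k \<ge> 1\<close> by (intro exI[of _ k] exI[of _ ?P] conjI)
qed

section \<open>The invariants given by three block partitions\<close>

text \<open>
  One block partition for each of the three tensor factors.  The polynomial \<open>F\<^sub>n\<close> is the instance
  where \<open>D\<close> is the cube and the partitions are those into \<open>x\<close>-, \<open>y\<close>- and \<open>z\<close>-slices.
\<close>
definition block_form ::
  "nat \<Rightarrow> nat \<Rightarrow> 'a set \<Rightarrow> (nat \<Rightarrow> nat \<Rightarrow> 'a) \<Rightarrow> (nat \<Rightarrow> nat \<Rightarrow> 'a) \<Rightarrow> (nat \<Rightarrow> nat \<Rightarrow> 'a) \<Rightarrow> tensor3 \<Rightarrow> complex" where
  "block_form m k D e1 e2 e3 v =
     (\<Sum>\<alpha>\<in>D \<rightarrow>\<^sub>E {..<m}. \<Sum>\<beta>\<in>D \<rightarrow>\<^sub>E {..<m}. \<Sum>\<gamma>\<in>D \<rightarrow>\<^sub>E {..<m}.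
        of_int (block_sign m k e1 \<alpha> * block_sign m k e2 \<beta> * block_sign m k e3 \<gamma>)
          * (\<Prod>j\<in>D. v (\<alpha> j, \<beta> j, \<gamma> j)))"

lemma prod_act:
  assumes "finite D" and lt: "\<And>j. j \<in> D \<Longrightarrow> a j < m \<and> b j < m \<and> c j < m"
  shows "(\<Prod>j\<in>D. act m (A, B, C) v (a j, b j, c j))
    = (\<Sum>\<alpha>\<in>D \<rightarrow>\<^sub>E {..<m}. \<Sum>\<beta>\<in>D \<rightarrow>\<^sub>E {..<m}. \<Sum>\<gamma>\<in>D \<rightarrow>\<^sub>E {..<m}.
        (\<Prod>j\<in>D. A $$ (a j, \<alpha> j)) * (\<Prod>j\<in>D. B $$ (b j, \<beta> j)) * (\<Prod>j\<in>D. C $$ (c j, \<gamma> j))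
          * (\<Prod>j\<in>D. v (\<alpha> j, \<beta> j, \<gamma> j)))"
proof -
  have expand: "(\<Prod>j\<in>D. \<Sum>x<m. h j x) = (\<Sum>\<alpha>\<in>D \<rightarrow>\<^sub>E {..<m}. \<Prod>j\<in>D. h j (\<alpha> j))"
    for h :: "_ \<Rightarrow> nat \<Rightarrow> complex"
    by (rule prod_sum_PiE[OF assms(1)]) simp
  have "(\<Prod>j\<in>D. act m (A, B, C) v (a j, b j, c j))
      = (\<Prod>j\<in>D. \<Sum>x<m. \<Sum>y<m. \<Sum>z<m. A $$ (a j, x) * B $$ (b j, y) * C $$ (c j, z) * v (x, y, z))"
    by (intro prod.cong refl) (simp add: act_entry lt)
  then show ?thesis by (simp add: expand prod.distrib)
qed

lemma block_form_act:
  assumes car: "X \<in> carrier_mat m m" "Y \<in> carrier_mat m m" "Z \<in> carrier_mat m m"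
    and e: "block_enum m k D e1" "block_enum m k D e2" "block_enum m k D e3"
  shows "block_form m k D e1 e2 e3 (act m (X, Y, Z) v)
    = (det X * det Y * det Z) ^ k * block_form m k D e1 e2 e3 v"
proof -
  let ?P = "D \<rightarrow>\<^sub>E {..<m}"
  let ?Q = "?P \<times> ?P \<times> ?P"
  let ?s = "\<lambda>e \<alpha>. of_int (block_sign m k e \<alpha>) :: complex"
  let ?V = "\<lambda>x. \<Prod>j\<in>D. v (fst x j, fst (snd x) j, snd (snd x) j)"
  let ?w = "\<lambda>A \<alpha> \<alpha>'. \<Prod>j\<in>D. A $$ (\<alpha> j, \<alpha>' j)"
  have D: "finite D" by (rule block_enum_finite[OF e(1)])
  have nested: "(\<Sum>\<alpha>\<in>?P. \<Sum>\<beta>\<in>?P. \<Sum>\<gamma>\<in>?P. f \<alpha> \<beta> \<gamma>) = (\<Sum>x\<in>?Q. f (fst x) (fst (snd x)) (snd (snd x)))"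
    for f :: "_ \<Rightarrow> _ \<Rightarrow> _ \<Rightarrow> complex"
    by (simp add: sum.cartesian_product case_prod_unfold)
  have "block_form m k D e1 e2 e3 (act m (X, Y, Z) v)
      = (\<Sum>x\<in>?Q. ?s e1 (fst x) * ?s e2 (fst (snd x)) * ?s e3 (snd (snd x)) *
          (\<Sum>y\<in>?Q. ?w X (fst x) (fst y) * ?w Y (fst (snd x)) (fst (snd y))
             * ?w Z (snd (snd x)) (snd (snd y)) * ?V y))"
    unfolding block_form_def nested
  proof (rule sum.cong[OF refl])
    fix x assume x: "x \<in> ?Q"
    then have "fst x j < m \<and> fst (snd x) j < m \<and> snd (snd x) j < m" if "j \<in> D" for j
      using that by (auto simp: PiE_iff)
    from prod_act[OF D this, where A = X and B = Y and C = Z and v = v, unfolded nested]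
    show "of_int (block_sign m k e1 (fst x) * block_sign m k e2 (fst (snd x)) * block_sign m k e3 (snd (snd x)))
        * (\<Prod>j\<in>D. act m (X, Y, Z) v (fst x j, fst (snd x) j, snd (snd x) j))
      = ?s e1 (fst x) * ?s e2 (fst (snd x)) * ?s e3 (snd (snd x)) *
          (\<Sum>y\<in>?Q. ?w X (fst x) (fst y) * ?w Y (fst (snd x)) (fst (snd y))
             * ?w Z (snd (snd x)) (snd (snd y)) * ?V y)" by simp
  qed
  also have "\<dots> = (\<Sum>y\<in>?Q. (\<Sum>x\<in>?Q. (?s e1 (fst x) * ?w X (fst x) (fst y))
      * (?s e2 (fst (snd x)) * ?w Y (fst (snd x)) (fst (snd y)))
      * (?s e3 (snd (snd x)) * ?w Z (snd (snd x)) (snd (snd y)))) * ?V y)"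
    unfolding sum_distrib_left sum_distrib_right by (subst sum.swap) (simp add: mult_ac)
  also have "\<dots> = (\<Sum>y\<in>?Q. (\<Sum>\<alpha>\<in>?P. ?s e1 \<alpha> * ?w X \<alpha> (fst y)) * (\<Sum>\<alpha>\<in>?P. ?s e2 \<alpha> * ?w Y \<alpha> (fst (snd y)))
      * (\<Sum>\<alpha>\<in>?P. ?s e3 \<alpha> * ?w Z \<alpha> (snd (snd y))) * ?V y)"
    unfolding sum_product3 nested ..
  also have "\<dots> = (\<Sum>y\<in>?Q. (det X ^ k * ?s e1 (fst y)) * (det Y ^ k * ?s e2 (fst (snd y)))
      * (det Z ^ k * ?s e3 (snd (snd y))) * ?V y)"
  proof (rule sum.cong[OF refl])
    fix y assume y: "y \<in> ?Q"
    then have "\<And>j. j \<in> D \<Longrightarrow> fst y j < m" "\<And>j. j \<in> D \<Longrightarrow> fst (snd y) j < m"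
      "\<And>j. j \<in> D \<Longrightarrow> snd (snd y) j < m" by (auto simp: PiE_iff)
    then show "(\<Sum>\<alpha>\<in>?P. ?s e1 \<alpha> * ?w X \<alpha> (fst y)) * (\<Sum>\<alpha>\<in>?P. ?s e2 \<alpha> * ?w Y \<alpha> (fst (snd y)))
      * (\<Sum>\<alpha>\<in>?P. ?s e3 \<alpha> * ?w Z \<alpha> (snd (snd y))) * ?V y
      = (det X ^ k * ?s e1 (fst y)) * (det Y ^ k * ?s e2 (fst (snd y))) * (det Z ^ k * ?s e3 (snd (snd y))) * ?V y"
      using sum_block_sign_prod[OF car(1) e(1)] sum_block_sign_prod[OF car(2) e(2)]
        sum_block_sign_prod[OF car(3) e(3)] by simp
  qed
  also have "\<dots> = (det X * det Y * det Z) ^ k * block_form m k D e1 e2 e3 v"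
    unfolding block_form_def nested by (simp add: sum_distrib_left power_mult_distrib mult_ac)
  finally show ?thesis .
qed

text \<open>
  A weak form of the first fundamental theorem for \<open>SL\<^sub>m\<^sup>3\<close>: expanding a monomial at \<open>h w\<close> and summing
  over the nodes replaces the entries of each \<open>h\<^sub>i\<close> by the kernel, and the permutations in the three
  kernels turn the average into a combination of block forms.
\<close>
lemma quad_average_word_nonzero:
  assumes q: "det_quadrature m k e T c g" and I: "\<And>j. j < k * m \<Longrightarrow> I j \<in> cube m"
    and nz: "quad_average m T c g 0 (\<lambda>v. \<Prod>j<k * m. v (I j)) w \<noteq> 0"
  shows "\<exists>e1 e2 e3. block_enum m k {..<k * m} e1 \<and> block_enum m k {..<k * m} e2 \<and>
    block_enum m k {..<k * m} e3 \<and> block_form m k {..<k * m} e1 e2 e3 w \<noteq> 0"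
proof (rule ccontr)
  assume neg: "\<not> ?thesis"
  let ?D = "{..<k * m}"
  let ?P = "?D \<rightarrow>\<^sub>E {..<m}"
  let ?Q = "?P \<times> ?P \<times> ?P"
  let ?S = "{\<sigma>. \<sigma> permutes ?D}"
  let ?s = "\<lambda>\<sigma>. block_sign m k (\<lambda>b i. \<sigma> (e b i))"
  define a1 a2 a3 where "a1 j = fst (I j)" and "a2 j = fst (snd (I j))" and "a3 j = snd (snd (I j))" for j
  have lt: "a1 j < m" "a2 j < m" "a3 j < m" if "j < k * m" for j
    using I[OF that] by (auto simp: a1_def a2_def a3_def cube_def)
  define V where "V x = (\<Prod>j<k * m. w (fst x j, fst (snd x) j, snd (snd x) j))"
    for x :: "(nat \<Rightarrow> nat) \<times> (nat \<Rightarrow> nat) \<times> (nat \<Rightarrow> nat)"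
  define W where "W a t \<alpha> = (\<Prod>j<k * m. g t $$ (a j, \<alpha> j))" for a t \<alpha>
  have nested: "(\<Sum>\<alpha>\<in>A. \<Sum>\<beta>\<in>A. \<Sum>\<gamma>\<in>A. f \<alpha> \<beta> \<gamma>) = (\<Sum>x\<in>A \<times> A \<times> A. f (fst x) (fst (snd x)) (snd (snd x)))"
    for f :: "_ \<Rightarrow> _ \<Rightarrow> _ \<Rightarrow> complex" and A
    by (simp add: sum.cartesian_product case_prod_unfold)
  have e: "block_enum m k ?D e" using q by (simp add: det_quadrature_def)
  have kernel: "(\<Sum>t\<in>T. c t * W a t \<alpha>) = (\<Sum>\<sigma>\<in>?S. of_int (?s \<sigma> a) * of_int (?s \<sigma> \<alpha>))"
    if "\<alpha> \<in> ?P" "\<And>j. j < k * m \<Longrightarrow> a j < m" for a \<alpha>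
    using q that by (auto simp: det_quadrature_def W_def sign_kernel_def PiE_iff)
  define K1 K2 K3 where "K1 \<alpha> = (\<Sum>t\<in>T. c t * W a1 t \<alpha>)" and "K2 \<alpha> = (\<Sum>t\<in>T. c t * W a2 t \<alpha>)"
    and "K3 \<alpha> = (\<Sum>t\<in>T. c t * W a3 t \<alpha>)" for \<alpha>
  have K1: "K1 \<alpha> = (\<Sum>\<sigma>\<in>?S. of_int (?s \<sigma> a1) * of_int (?s \<sigma> \<alpha>))"
    and K2: "K2 \<alpha> = (\<Sum>\<sigma>\<in>?S. of_int (?s \<sigma> a2) * of_int (?s \<sigma> \<alpha>))"
    and K3: "K3 \<alpha> = (\<Sum>\<sigma>\<in>?S. of_int (?s \<sigma> a3) * of_int (?s \<sigma> \<alpha>))" if "\<alpha> \<in> ?P" for \<alpha>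
    unfolding K1_def K2_def K3_def by (rule kernel[OF that]; simp add: lt)+
  have "(\<Prod>j<k * m. act m (g s, g t, g u) w (I j))
      = (\<Sum>x\<in>?Q. V x * W a1 s (fst x) * W a2 t (fst (snd x)) * W a3 u (snd (snd x)))" for s t u
    using prod_act[of ?D a1 m a2 a3 "g s" "g t" "g u" w, unfolded nested] lt
    by (simp add: a1_def a2_def a3_def W_def V_def mult_ac)
  then have "quad_average m T c g 0 (\<lambda>v. \<Prod>j<k * m. v (I j)) w
      = (\<Sum>s\<in>T. c s * (\<Sum>t\<in>T. c t * (\<Sum>u\<in>T. c u *
          (\<Sum>x\<in>?Q. V x * W a1 s (fst x) * W a2 t (fst (snd x)) * W a3 u (snd (snd x))))))"
    by (simp add: quad_average_def)
  also have "\<dots> = (\<Sum>x\<in>?Q. V x * K3 (snd (snd x)) * K2 (fst (snd x)) * K1 (fst x))"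
  proof -
    have inner: "(\<Sum>u\<in>T. c u * (\<Sum>x\<in>?Q. V x * W a1 s (fst x) * W a2 t (fst (snd x)) * W a3 u (snd (snd x))))
        = (\<Sum>x\<in>?Q. V x * W a1 s (fst x) * K3 (snd (snd x)) * W a2 t (fst (snd x)))" for s t
      unfolding K3_def by (rule trans[OF weighted_sum_swap], intro sum.cong refl, simp only: mult_ac)
    have middle: "(\<Sum>t\<in>T. c t * (\<Sum>x\<in>?Q. V x * W a1 s (fst x) * K3 (snd (snd x)) * W a2 t (fst (snd x))))
        = (\<Sum>x\<in>?Q. V x * K3 (snd (snd x)) * K2 (fst (snd x)) * W a1 s (fst x))" for s
      unfolding K2_def by (rule trans[OF weighted_sum_swap], intro sum.cong refl, simp only: mult_ac)
    show ?thesis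
      unfolding inner middle unfolding K1_def by (rule weighted_sum_swap)
  qed
  also have "\<dots> = (\<Sum>x\<in>?Q. V x * ((\<Sum>\<sigma>\<in>?S. of_int (?s \<sigma> a1) * of_int (?s \<sigma> (fst x))) *
      (\<Sum>\<sigma>\<in>?S. of_int (?s \<sigma> a2) * of_int (?s \<sigma> (fst (snd x)))) *
      (\<Sum>\<sigma>\<in>?S. of_int (?s \<sigma> a3) * of_int (?s \<sigma> (snd (snd x))))))"
  proof (rule sum.cong[OF refl])
    fix x assume "x \<in> ?Q"
    then have x: "fst x \<in> ?P" "fst (snd x) \<in> ?P" "snd (snd x) \<in> ?P"
      by (simp_all only: mem_Times_iff)
    show "V x * K3 (snd (snd x)) * K2 (fst (snd x)) * K1 (fst x)
      = V x * ((\<Sum>\<sigma>\<in>?S. of_int (?s \<sigma> a1) * of_int (?s \<sigma> (fst x))) *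
      (\<Sum>\<sigma>\<in>?S. of_int (?s \<sigma> a2) * of_int (?s \<sigma> (fst (snd x)))) *
      (\<Sum>\<sigma>\<in>?S. of_int (?s \<sigma> a3) * of_int (?s \<sigma> (snd (snd x)))))"
      unfolding K1[OF x(1), symmetric] K2[OF x(2), symmetric] K3[OF x(3), symmetric] by simp
  qed
  also have "\<dots> = (\<Sum>x\<in>?Q. \<Sum>y\<in>?S \<times> ?S \<times> ?S. V x *
      ((of_int (?s (fst y) a1) * of_int (?s (fst y) (fst x))) *
       (of_int (?s (fst (snd y)) a2) * of_int (?s (fst (snd y)) (fst (snd x)))) *
       (of_int (?s (snd (snd y)) a3) * of_int (?s (snd (snd y)) (snd (snd x))))))"
    by (simp only: sum_product3 nested, simp only: sum_distrib_left)
  also have "\<dots> = (\<Sum>y\<in>?S \<times> ?S \<times> ?S. of_int (?s (fst y) a1 * ?s (fst (snd y)) a2 * ?s (snd (snd y)) a3) *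
      block_form m k ?D (\<lambda>b i. fst y (e b i)) (\<lambda>b i. fst (snd y) (e b i)) (\<lambda>b i. snd (snd y) (e b i)) w)"
    unfolding block_form_def nested sum_distrib_left V_def
    by (subst sum.swap) (simp add: mult_ac)
  also have "\<dots> = 0"
  proof (intro sum.neutral ballI)
    fix y assume y: "y \<in> ?S \<times> ?S \<times> ?S"
    have "block_enum m k ?D (\<lambda>b i. \<sigma> (e b i))" if "\<sigma> permutes ?D" for \<sigma>
      by (rule block_enum_comp[OF e permutes_imp_bij[OF that]])
    then have "block_form m k ?D (\<lambda>b i. fst y (e b i)) (\<lambda>b i. fst (snd y) (e b i)) (\<lambda>b i. snd (snd y) (e b i)) w = 0"
      using neg y unfolding mem_Times_iff mem_Collect_eq by blast
    then show "of_int (?s (fst y) a1 * ?s (fst (snd y)) a2 * ?s (snd (snd y)) a3) *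
      block_form m k ?D (\<lambda>b i. fst y (e b i)) (\<lambda>b i. fst (snd y) (e b i)) (\<lambda>b i. snd (snd y) (e b i)) w = 0"
      by simp
  qed
  finally show False using nz by simp
qed

text \<open>
  All monomials have the same degree \<open>d\<close>, so the quadrature for \<open>K = d div m\<close> needs no twist.
\<close>
lemma invariant_gives_block_form:
  assumes m: "m \<ge> 1" and M: "finite M" and deg: "\<And>\<mu>. \<mu> \<in> M \<Longrightarrow> monomial_degree m \<mu> = d"
    and inv: "\<And>h. h \<in> SL3 m \<Longrightarrow>
      (\<Sum>\<mu>\<in>M. coef \<mu> * monomial_fun m \<mu> (act m h w)) = (\<Sum>\<mu>\<in>M. coef \<mu> * monomial_fun m \<mu> w)"
    and nz: "(\<Sum>\<mu>\<in>M. coef \<mu> * monomial_fun m \<mu> w) \<noteq> 0"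
  obtains k e1 e2 e3 where "d = k * m" "block_enum m k {..<d} e1" "block_enum m k {..<d} e2"
    "block_enum m k {..<d} e3" "block_form m k {..<d} e1 e2 e3 w \<noteq> 0"
proof -
  define k where "k = d div m"
  obtain e T c g where quad: "det_quadrature m k e (T :: ((nat \<Rightarrow> nat) \<times> (nat \<Rightarrow> nat) \<times> nat set) set) c g"
    using exists_det_quadrature[OF block_enum_standard] by blast
  have "\<exists>\<mu>\<in>M. coef \<mu> \<noteq> 0 \<and> m dvd monomial_degree m \<mu> \<and>
    quad_average m T c g (k - monomial_degree m \<mu> div m) (monomial_fun m \<mu>) w \<noteq> 0"
    by (rule exists_nonzero_average[OF m quad M inv nz]) (simp_all add: deg k_def)
  then obtain \<mu> where \<mu>: "\<mu> \<in> M" "m dvd d" "quad_average m T c g 0 (monomial_fun m \<mu>) w \<noteq> 0"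
    by (auto simp: deg k_def)
  have d: "d = k * m" using \<mu>(2) by (simp add: k_def)
  obtain I where I: "\<forall>j<k * m. I j \<in> cube m"
    and mono: "\<forall>v. monomial_fun m \<mu> v = (\<Prod>j<k * m. v (I j))"
    using monomial_fun_word[of m \<mu>] unfolding deg[OF \<mu>(1)] d by (elim exE conjE)
  have "monomial_fun m \<mu> = (\<lambda>v. \<Prod>j<k * m. v (I j))" using mono by (intro ext) simp
  then obtain e1 e2 e3 where "block_enum m k {..<k * m} e1" "block_enum m k {..<k * m} e2"
    "block_enum m k {..<k * m} e3" "block_form m k {..<k * m} e1 e2 e3 w \<noteq> 0"
    using quad_average_word_nonzero[OF quad, of I w] I \<mu>(3) by auto
  then show ?thesis by (intro that[OF d]) (simp_all only: d)
qed

text \<open>The names of the points do not matter: substitute \<open>\<alpha> \<circ> \<pi>\<close> for \<open>\<alpha>\<close>.\<close>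
lemma block_form_transport:
  assumes \<pi>: "bij_betw \<pi> D D'" and e: "block_enum m k D e1" "block_enum m k D e2" "block_enum m k D e3"
  shows "block_form m k D e1 e2 e3 v
    = block_form m k D' (\<lambda>b i. \<pi> (e1 b i)) (\<lambda>b i. \<pi> (e2 b i)) (\<lambda>b i. \<pi> (e3 b i)) v"
proof -
  let ?r = "\<lambda>\<alpha>. \<lambda>j\<in>D. \<alpha> (\<pi> j)"
  have \<pi>_in: "\<pi> j \<in> D'" if "j \<in> D" for j using bij_betwE[OF \<pi>] that by blast
  have inv_in: "inv_into D \<pi> j \<in> D" "\<pi> (inv_into D \<pi> j) = j" if "j \<in> D'" for j
    using bij_betwE[OF bij_betw_inv_into[OF \<pi>]] bij_betw_inv_into_right[OF \<pi>] that by auto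
  have "bij_betw ?r (D' \<rightarrow>\<^sub>E {..<m}) (D \<rightarrow>\<^sub>E {..<m})"
  proof (rule bij_betw_byWitness[where f' = "\<lambda>\<alpha>. \<lambda>j\<in>D'. \<alpha> (inv_into D \<pi> j)"])
    show "\<forall>\<alpha>\<in>D' \<rightarrow>\<^sub>E {..<m}. (\<lambda>j\<in>D'. ?r \<alpha> (inv_into D \<pi> j)) = \<alpha>"
      using inv_in by (auto simp: PiE_iff extensional_def restrict_def)
    show "\<forall>\<alpha>\<in>D \<rightarrow>\<^sub>E {..<m}. (\<lambda>j\<in>D. (\<lambda>j\<in>D'. \<alpha> (inv_into D \<pi> j)) (\<pi> j)) = \<alpha>"
      using \<pi>_in bij_betw_inv_into_left[OF \<pi>] by (auto simp: PiE_iff extensional_def restrict_def)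
  qed (use \<pi>_in inv_in in \<open>auto simp: PiE_iff\<close>)
  note reindex = sum.reindex_bij_betw[OF this, symmetric]
  have sgn: "block_sign m k e (?r \<alpha>) = block_sign m k (\<lambda>b i. \<pi> (e b i)) \<alpha>" if "block_enum m k D e" for e \<alpha>
  proof -
    have "block_sign m k e (?r \<alpha>) = block_sign m k e (\<lambda>j. \<alpha> (\<pi> j))"
      by (rule block_sign_cong[OF that]) simp
    then show ?thesis by (simp add: block_sign_def)
  qed
  have pr: "(\<Prod>j\<in>D. v (?r \<alpha> j, ?r \<beta> j, ?r \<gamma> j)) = (\<Prod>j\<in>D'. v (\<alpha> j, \<beta> j, \<gamma> j))" for \<alpha> \<beta> \<gamma>
    using prod.reindex_bij_betw[OF \<pi>, of "\<lambda>j. v (\<alpha> j, \<beta> j, \<gamma> j)"] by simp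
  show ?thesis
    unfolding block_form_def
    by (subst (1 2 3) reindex) (simp only: sgn e pr)
qed

lemma block_sign_transpose:
  assumes e: "block_enum m k D e" and j: "j \<noteq> j'"
    and b: "b < k" "i < m" "i' < m" "e b i = j" "e b i' = j'"
  shows "block_sign m k (\<lambda>b' x. transpose j j' (e b' x)) \<alpha> = - block_sign m k e \<alpha>"
proof -
  have ne: "i \<noteq> i'" using j b by auto
  have inj: "e b' x = e b'' x' \<longleftrightarrow> b' = b'' \<and> x = x'"
    if "b' < k" "b'' < k" "x < m" "x' < m" for b' b'' x x'
  proof -
    have "inj_on (\<lambda>(b, i). e b i) ({..<k} \<times> {..<m})" using e by (simp add: block_enum_def bij_betw_def)
    then have "e b' x = e b'' x' \<Longrightarrow> (b', x) = (b'', x')"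
      by (rule inj_onD) (use that in auto)
    then show ?thesis by auto
  qed
  let ?e' = "\<lambda>b' x. transpose j j' (e b' x)"
  have other: "alt_sign m (\<lambda>x. \<alpha> (?e' b' x)) = alt_sign m (\<lambda>x. \<alpha> (e b' x))" if "b' \<in> {..<k} - {b}" for b'
    by (rule alt_sign_cong) (use that b(1-3) inj in \<open>auto simp: transpose_def b(4,5)[symmetric]\<close>)
  have perm: "transpose i i' permutes {..<m}"
    using b by (intro permutes_swap_id) auto
  have "alt_sign m (\<lambda>x. \<alpha> (?e' b x)) = alt_sign m (\<lambda>x. \<alpha> (e b (transpose i i' x)))"
    by (rule alt_sign_cong) (use b(1-3) inj in \<open>auto simp: transpose_def b(4,5)[symmetric]\<close>)
  also have "\<dots> = - alt_sign m (\<lambda>x. \<alpha> (e b x))"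
    using alt_sign_comp[OF perm, of "\<lambda>x. \<alpha> (e b x)"] ne by (simp add: sign_swap_id)
  finally have "alt_sign m (\<lambda>x. \<alpha> (?e' b x)) = - alt_sign m (\<lambda>x. \<alpha> (e b x))" .
  moreover have "block_sign m k e' \<alpha> = alt_sign m (\<lambda>x. \<alpha> (e' b x)) * (\<Prod>b'\<in>{..<k} - {b}. alt_sign m (\<lambda>x. \<alpha> (e' b' x)))"
    for e' unfolding block_sign_def using b by (subst prod.remove[of _ b]) auto
  ultimately show ?thesis using other by simp
qed

text \<open>
  Renaming the points by the transposition of \<open>j\<close> and \<open>j'\<close> preserves the form, but reverses each
  of the three signs.  Here it matters that the number of tensor factors is odd.
\<close>
lemma block_form_common_blocks:
  assumes e: "block_enum m k D e1" "block_enum m k D e2" "block_enum m k D e3"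
    and j: "j \<noteq> j'"
      "b1 < k" "i1 < m" "i1' < m" "e1 b1 i1 = j" "e1 b1 i1' = j'"
      "b2 < k" "i2 < m" "i2' < m" "e2 b2 i2 = j" "e2 b2 i2' = j'"
      "b3 < k" "i3 < m" "i3' < m" "e3 b3 i3 = j" "e3 b3 i3' = j'"
  shows "block_form m k D e1 e2 e3 v = 0"
proof -
  let ?\<tau> = "transpose j j'"
  have "j \<in> D" "j' \<in> D" using j block_enum_in[OF e(1)] by auto
  then have \<tau>: "bij_betw ?\<tau> D D" by (intro permutes_imp_bij permutes_swap_id)
  have s1: "block_sign m k (\<lambda>b x. ?\<tau> (e1 b x)) \<alpha> = - block_sign m k e1 \<alpha>" for \<alpha>
    by (rule block_sign_transpose[OF e(1) j(1) j(2-6)])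
  have s2: "block_sign m k (\<lambda>b x. ?\<tau> (e2 b x)) \<alpha> = - block_sign m k e2 \<alpha>" for \<alpha>
    by (rule block_sign_transpose[OF e(2) j(1) j(7-11)])
  have s3: "block_sign m k (\<lambda>b x. ?\<tau> (e3 b x)) \<alpha> = - block_sign m k e3 \<alpha>" for \<alpha>
    by (rule block_sign_transpose[OF e(3) j(1) j(12-16)])
  have "block_form m k D e1 e2 e3 v = - block_form m k D e1 e2 e3 v"
    using block_form_transport[OF \<tau> e, of v] unfolding block_form_def s1 s2 s3
    by (simp add: sum_negf)
  then show ?thesis by simp
qed

text \<open>
  The enumerations differ by a permutation of each block; \<open>\<epsilon>\<close> is the product of the signs.
\<close>
lemma block_sign_same_blocks:
  assumes e: "block_enum m k D e" and e': "block_enum m k D e'"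
    and same: "\<And>b. b < k \<Longrightarrow> e b ` {..<m} = e' b ` {..<m}"
  shows "\<exists>\<epsilon>\<noteq>0. \<forall>\<alpha>. block_sign m k e' \<alpha> = \<epsilon> * block_sign m k e \<alpha>"
proof -
  have inj: "inj_on (e b) {..<m}" if "b < k" "block_enum m k D e" for b and e :: "nat \<Rightarrow> nat \<Rightarrow> 'a"
  proof (rule inj_onI)
    fix x y assume xy: "x \<in> {..<m}" "y \<in> {..<m}" "e b x = e b y"
    have "inj_on (\<lambda>(b, i). e b i) ({..<k} \<times> {..<m})" using that(2) by (simp add: block_enum_def bij_betw_def)
    from inj_onD[OF this, of "(b, x)" "(b, y)"] xy that(1) show "x = y" by simp
  qed
  define \<rho> where "\<rho> b i = (if i < m then inv_into {..<m} (e b) (e' b i) else i)" for b i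
  have bij: "bij_betw (\<lambda>i. inv_into {..<m} (e b) (e' b i)) {..<m} {..<m}" if b: "b < k" for b
  proof -
    have "bij_betw (e' b) {..<m} (e b ` {..<m})"
      using inj[OF b e'] same[OF b] by (simp add: bij_betw_def)
    moreover have "bij_betw (inv_into {..<m} (e b)) (e b ` {..<m}) {..<m}"
      using inj[OF b e] by (simp add: bij_betw_inv_into bij_betw_imageI)
    ultimately show ?thesis using bij_betw_trans by (fastforce simp: comp_def)
  qed
  have perm: "\<rho> b permutes {..<m}" if "b < k" for b
    using extend_id_permutes[OF bij[OF that]] by (simp add: \<rho>_def[abs_def])
  have e'_eq: "e' b i = e b (\<rho> b i)" if "b < k" "i < m" for b i
  proof -
    have "e' b i \<in> e b ` {..<m}" using same that by blast
    then show ?thesis using that by (simp add: \<rho>_def f_inv_into_f)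
  qed
  have "block_sign m k e' \<alpha> = (\<Prod>b<k. sign (\<rho> b)) * block_sign m k e \<alpha>" for \<alpha>
    unfolding block_sign_def prod.distrib[symmetric]
  proof (rule prod.cong[OF refl])
    fix b assume b: "b \<in> {..<k}"
    have "alt_sign m (\<lambda>i. \<alpha> (e' b i)) = alt_sign m (\<lambda>i. \<alpha> (e b (\<rho> b i)))"
      by (rule alt_sign_cong) (use b e'_eq in simp)
    also have "\<dots> = sign (\<rho> b) * alt_sign m (\<lambda>i. \<alpha> (e b i))"
      using alt_sign_comp[OF perm, of b "\<lambda>i. \<alpha> (e b i)"] b by simp
    finally show "alt_sign m (\<lambda>i. \<alpha> (e' b i)) = sign (\<rho> b) * alt_sign m (\<lambda>i. \<alpha> (e b i))" .
  qed
  moreover have "(\<Prod>b<k. sign (\<rho> b)) \<noteq> 0" by simp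
  ultimately show ?thesis by blast
qed

definition block_of :: "nat \<Rightarrow> nat \<Rightarrow> (nat \<Rightarrow> nat \<Rightarrow> 'a) \<Rightarrow> 'a \<Rightarrow> nat" where
  "block_of m k e j = fst (inv_into ({..<k} \<times> {..<m}) (\<lambda>(b, i). e b i) j)"

lemma block_of:
  assumes "block_enum m k D e"
  shows "b < k \<Longrightarrow> i < m \<Longrightarrow> block_of m k e (e b i) = b"
    and "j \<in> D \<Longrightarrow> \<exists>i<m. block_of m k e j < k \<and> e (block_of m k e j) i = j"
proof -
  have bij: "bij_betw (\<lambda>(b, i). e b i) ({..<k} \<times> {..<m}) D" using assms by (simp add: block_enum_def)
  show "b < k \<Longrightarrow> i < m \<Longrightarrow> block_of m k e (e b i) = b"
    using bij_betw_inv_into_left[OF bij, of "(b, i)"] by (simp add: block_of_def)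
  assume j: "j \<in> D"
  then obtain b i where "b < k" "i < m" "e b i = j"
    using bij by (auto simp: bij_betw_def image_iff)
  moreover from this have "block_of m k e j = b"
    using bij_betw_inv_into_left[OF bij, of "(b, i)"] by (simp add: block_of_def)
  ultimately show "\<exists>i<m. block_of m k e j < k \<and> e (block_of m k e j) i = j"
    by (intro exI[of _ i]) simp
qed

definition block_triple ::
  "nat \<Rightarrow> nat \<Rightarrow> (nat \<Rightarrow> nat \<Rightarrow> 'a) \<Rightarrow> (nat \<Rightarrow> nat \<Rightarrow> 'a) \<Rightarrow> (nat \<Rightarrow> nat \<Rightarrow> 'a) \<Rightarrow> 'a \<Rightarrow> nat \<times> nat \<times> nat" where
  "block_triple m k e1 e2 e3 j = (block_of m k e1 j, block_of m k e2 j, block_of m k e3 j)"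

text \<open>Points with the same triple of blocks would make the form vanish.\<close>
lemma block_triple_inj:
  assumes e: "block_enum m k D e1" "block_enum m k D e2" "block_enum m k D e3"
    and nz: "block_form m k D e1 e2 e3 v \<noteq> 0"
  shows "inj_on (block_triple m k e1 e2 e3) D" "block_triple m k e1 e2 e3 ` D \<subseteq> cube k"
proof -
  show "inj_on (block_triple m k e1 e2 e3) D"
  proof (rule inj_onI, rule ccontr)
    fix j j' assume D: "j \<in> D" "j' \<in> D" and eq: "block_triple m k e1 e2 e3 j = block_triple m k e1 e2 e3 j'"
      and ne: "j \<noteq> j'"
    have "\<exists>b i i'. b < k \<and> i < m \<and> i' < m \<and> e b i = j \<and> e b i' = j'"
      if "block_enum m k D e" "block_of m k e j = block_of m k e j'" for e
      using block_of(2)[OF that(1) D(1)] block_of(2)[OF that(1) D(2)] that(2) by metis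
    then obtain b1 i1 i1' b2 i2 i2' b3 i3 i3' where
      "b1 < k" "i1 < m" "i1' < m" "e1 b1 i1 = j" "e1 b1 i1' = j'"
      "b2 < k" "i2 < m" "i2' < m" "e2 b2 i2 = j" "e2 b2 i2' = j'"
      "b3 < k" "i3 < m" "i3' < m" "e3 b3 i3 = j" "e3 b3 i3' = j'"
      using e eq unfolding block_triple_def by (metis prod.inject)
    from block_form_common_blocks[OF e ne this] nz show False by simp
  qed
  show "block_triple m k e1 e2 e3 ` D \<subseteq> cube k"
    using block_of(2)[OF e(1)] block_of(2)[OF e(2)] block_of(2)[OF e(3)]
    by (fastforce simp: block_triple_def)
qed

lemma card_cube: "card (cube k) = k * k ^ 2"
  by (simp add: cube_def card_cartesian_product power2_eq_square)

lemma block_form_nonzero_bound: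
  assumes e: "block_enum m k D e1" "block_enum m k D e2" "block_enum m k D e3"
    and nz: "block_form m k D e1 e2 e3 v \<noteq> 0" and k: "k \<ge> 1"
  shows "m \<le> k ^ 2"
proof -
  have "card D \<le> card (cube k)"
    by (rule card_inj_on_le[OF block_triple_inj[OF e nz]]) simp
  then show ?thesis using k by (simp add: block_enum_card[OF e(1)] card_cube)
qed

section \<open>The invariant \<open>F\<^sub>n\<close> as a block form\<close>

text \<open>
  The rank strictly increases along the order and is smaller than the size of the set.
\<close>
lemma rank_bij:
  assumes r: "linear_order_on (cube n) r" and S: "S \<subseteq> cube n"
  shows "bij_betw (rank r S) S {..<card S}"
proof -
  have fin: "finite S" using S finite_cube finite_subset by blast
  have trans: "trans r" and antisym: "antisym r" and total: "total_on (cube n) r"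
    using r by (auto simp: order_on_defs)
  have less: "rank r S p < rank r S q" if "p \<in> S" "q \<in> S" "(p, q) \<in> r" "p \<noteq> q" for p q
    unfolding rank_def
  proof (rule psubset_card_mono)
    show "{x \<in> S. (x, p) \<in> r \<and> x \<noteq> p} \<subset> {x \<in> S. (x, q) \<in> r \<and> x \<noteq> q}"
    proof
      show "{x \<in> S. (x, p) \<in> r \<and> x \<noteq> p} \<subseteq> {x \<in> S. (x, q) \<in> r \<and> x \<noteq> q}"
        using that trans antisym by (auto dest: transD antisymD)
      show "{x \<in> S. (x, p) \<in> r \<and> x \<noteq> p} \<noteq> {x \<in> S. (x, q) \<in> r \<and> x \<noteq> q}"
        using that by blast
    qed
  qed (use fin in simp)
  have "inj_on (rank r S) S"
  proof (rule inj_onI, rule ccontr)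
    fix p q assume pq: "p \<in> S" "q \<in> S" "rank r S p = rank r S q" "p \<noteq> q"
    then have "(p, q) \<in> r \<or> (q, p) \<in> r" using total S by (auto simp: total_on_def)
    then show False using less[of p q] less[of q p] pq by auto
  qed
  moreover have "rank r S ` S \<subseteq> {..<card S}"
  proof (rule image_subsetI)
    fix p assume "p \<in> S"
    then have "{q \<in> S. (q, p) \<in> r \<and> q \<noteq> p} \<subset> S" by blast
    then show "rank r S p \<in> {..<card S}" using fin by (simp add: rank_def psubset_card_mono)
  qed
  ultimately show ?thesis
    by (simp add: bij_betw_def card_image card_subset_eq)
qed

definition slice :: "nat \<Rightarrow> (nat \<times> nat \<times> nat \<Rightarrow> nat) \<Rightarrow> nat \<Rightarrow> (nat \<times> nat \<times> nat) set" where
  "slice n pr i = {p \<in> cube n. pr p = i}"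

definition slice_enum ::
  "(nat \<times> nat \<times> nat) rel \<Rightarrow> nat \<Rightarrow> (nat \<times> nat \<times> nat \<Rightarrow> nat) \<Rightarrow> nat \<Rightarrow> nat \<Rightarrow> nat \<times> nat \<times> nat" where
  "slice_enum r n pr b i = inv_into (slice n pr b) (rank r (slice n pr b)) i"

text \<open>
  The three projections enter only through this property, so \<open>x\<close>-, \<open>y\<close>- and \<open>z\<close>-slices are treated
  together.
\<close>
definition coordinate :: "nat \<Rightarrow> (nat \<times> nat \<times> nat \<Rightarrow> nat) \<Rightarrow> bool" where
  "coordinate n pr \<longleftrightarrow> (\<forall>p\<in>cube n. pr p < n) \<and> (\<forall>i<n. card (slice n pr i) = n ^ 2)"

lemma coordinates: "coordinate n fst" "coordinate n (fst \<circ> snd)" "coordinate n (snd \<circ> snd)"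
proof -
  have "slice n fst i = {i} \<times> {..<n} \<times> {..<n}" if "i < n" for i
    using that by (auto simp: slice_def)
  then show "coordinate n fst"
    by (auto simp: coordinate_def card_cartesian_product power2_eq_square)
  have "slice n (fst \<circ> snd) i = {..<n} \<times> {i} \<times> {..<n}" if "i < n" for i
    using that by (auto simp: slice_def)
  then show "coordinate n (fst \<circ> snd)"
    by (auto simp: coordinate_def card_cartesian_product power2_eq_square)
  have "slice n (snd \<circ> snd) i = {..<n} \<times> {..<n} \<times> {i}" if "i < n" for i
    using that by (auto simp: slice_def)
  then show "coordinate n (snd \<circ> snd)"
    by (auto simp: coordinate_def card_cartesian_product power2_eq_square)
qed

lemma slice_enum_bij:
  assumes "linear_order_on (cube n) r" "coordinate n pr" "b < n"
  shows "bij_betw (slice_enum r n pr b) {..<n ^ 2} (slice n pr b)"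
proof -
  have "card (slice n pr b) = n ^ 2" using assms(2,3) by (simp add: coordinate_def)
  then have "bij_betw (rank r (slice n pr b)) (slice n pr b) {..<n ^ 2}"
    using rank_bij[OF assms(1), of "slice n pr b"] by (simp add: slice_def)
  then show ?thesis
    unfolding slice_enum_def[abs_def] by (rule bij_betw_inv_into)
qed

lemma slice_enum_block_enum:
  assumes r: "linear_order_on (cube n) r" and pr: "coordinate n pr"
  shows "block_enum (n ^ 2) n (cube n) (slice_enum r n pr)"
  unfolding block_enum_def bij_betw_def
proof
  note bij = slice_enum_bij[OF r pr]
  show "inj_on (\<lambda>(b, i). slice_enum r n pr b i) ({..<n} \<times> {..<n ^ 2})"
  proof (rule inj_onI, clarify)
    fix b i b' i' assume *: "b < n" "i < n ^ 2" "b' < n" "i' < n ^ 2"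
      "slice_enum r n pr b i = slice_enum r n pr b' i'"
    have "slice_enum r n pr b i \<in> slice n pr b" "slice_enum r n pr b' i' \<in> slice n pr b'"
      using bij_betwE[OF bij] * by blast+
    then have "b = b'" using * by (simp add: slice_def)
    then show "b = b' \<and> i = i'" using bij_betw_imp_inj_on[OF bij[OF *(1)]] * by (auto dest: inj_onD)
  qed
  show "(\<lambda>(b, i). slice_enum r n pr b i) ` ({..<n} \<times> {..<n ^ 2}) = cube n"
  proof
    show "(\<lambda>(b, i). slice_enum r n pr b i) ` ({..<n} \<times> {..<n ^ 2}) \<subseteq> cube n"
      using bij_betwE[OF bij] by (fastforce simp: slice_def)
    show "cube n \<subseteq> (\<lambda>(b, i). slice_enum r n pr b i) ` ({..<n} \<times> {..<n ^ 2})"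
    proof
      fix p assume p: "p \<in> cube n"
      then have b: "pr p < n" using pr by (simp add: coordinate_def)
      then have "p \<in> slice_enum r n pr (pr p) ` {..<n ^ 2}"
        using bij_betw_imp_surj_on[OF bij[OF b]] p by (simp add: slice_def)
      then obtain i where "i < n ^ 2" "p = slice_enum r n pr (pr p) i" by auto
      then show "p \<in> (\<lambda>(b, i). slice_enum r n pr b i) ` ({..<n} \<times> {..<n ^ 2})"
        using b by (intro image_eqI[of _ _ "(pr p, i)"]) simp_all
    qed
  qed
qed

lemma prod_slice_sign:
  assumes r: "linear_order_on (cube n) r" and pr: "coordinate n pr"
  shows "(\<Prod>i<n. slice_sign r n (slice n pr i) \<alpha>) = block_sign (n ^ 2) n (slice_enum r n pr) \<alpha>"
  unfolding block_sign_def
proof (rule prod.cong[OF refl])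
  fix i assume "i \<in> {..<n}"
  then have bij: "bij_betw (slice_enum r n pr i) {..<n ^ 2} (slice n pr i)"
    using slice_enum_bij[OF r pr] by simp
  show "slice_sign r n (slice n pr i) \<alpha> = alt_sign (n ^ 2) (\<lambda>j. \<alpha> (slice_enum r n pr i j))"
    using bij_betw_comp_iff[OF bij, of \<alpha> "{..<n ^ 2}"]
    by (simp add: slice_sign_def alt_sign_def comp_def slice_enum_def cong: if_cong)
qed

lemma F_eq_block_form:
  assumes r: "linear_order_on (cube n) r"
  shows "F r n = block_form (n ^ 2) n (cube n) (slice_enum r n fst) (slice_enum r n (fst \<circ> snd))
    (slice_enum r n (snd \<circ> snd))"
proof -
  have "{(x, y, z) \<in> cube n. x = i} = slice n fst i" "{(x, y, z) \<in> cube n. y = i} = slice n (fst \<circ> snd) i"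
    "{(x, y, z) \<in> cube n. z = i} = slice n (snd \<circ> snd) i" for i
    by (auto simp: slice_def)
  then show ?thesis
    by (intro ext) (simp add: F_def block_form_def sgn_x_def sgn_y_def sgn_z_def
        prod_slice_sign[OF r coordinates(1)] prod_slice_sign[OF r coordinates(2)]
        prod_slice_sign[OF r coordinates(3)])
qed

lemma F_relative_invariant:
  assumes r: "linear_order_on (cube n) r"
  shows "relative_invariant (n ^ 2) n (F r n)"
  unfolding relative_invariant_def
proof (intro conjI allI ballI)
  show "polynomial_fun (n ^ 2) (F r n)"
    unfolding F_def[abs_def]
    by (intro polynomial_fun_sum polynomial_fun_mult polynomial_fun_const polynomial_fun_prod
        polynomial_fun_coord) (auto simp: PiE_iff)
  show "F r n (tscale t v) = t ^ (n * n ^ 2) * F r n v" for t v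
    by (simp add: F_def tscale_def prod.distrib card_cube sum_distrib_left mult_ac)
  show "F r n (act (n ^ 2) h v) = chi h ^ n * F r n v" if h: "h \<in> GL3 (n ^ 2)" for h v
  proof -
    obtain X Y Z where "h = (X, Y, Z)" by (cases h)
    then show ?thesis
      using h block_form_act[of X "n ^ 2" Y Z n "cube n"] slice_enum_block_enum[OF r] coordinates
      by (simp add: F_eq_block_form[OF r] chi_def GL3_def GL_iff)
  qed
qed

text \<open>
  By counting, the injection of the points into the cube given by their triples of blocks is a
  bijection.  It carries the blocks of the three partitions to slices, so the form becomes \<open>F\<^sub>n\<close>
  up to the sign by which the enumerations of the slices differ.
\<close>
lemma block_form_nonzero_imp_F_nonzero:
  assumes n: "n \<ge> 1" and r: "linear_order_on (cube n) r"
    and e: "block_enum (n ^ 2) n D e1" "block_enum (n ^ 2) n D e2" "block_enum (n ^ 2) n D e3"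
    and nz: "block_form (n ^ 2) n D e1 e2 e3 v \<noteq> 0"
  shows "F r n v \<noteq> 0"
proof -
  let ?m = "n ^ 2"
  let ?\<pi> = "block_triple ?m n e1 e2 e3"
  note inj = block_triple_inj[OF e nz]
  have "card (?\<pi> ` D) = card (cube n)"
    by (simp add: card_image[OF inj(1)] block_enum_card[OF e(1)] card_cube)
  then have \<pi>: "bij_betw ?\<pi> D (cube n)"
    using inj card_subset_eq[OF finite_cube inj(2)] by (simp add: bij_betw_def)
  have same: "\<exists>\<epsilon>\<noteq>0. \<forall>\<alpha>. block_sign ?m n (\<lambda>b i. ?\<pi> (e b i)) \<alpha> = \<epsilon> * block_sign ?m n (slice_enum r n pr) \<alpha>"
    if pr: "coordinate n pr" and e: "block_enum ?m n D e" and blk: "\<And>j. j \<in> D \<Longrightarrow> pr (?\<pi> j) = block_of ?m n e j"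
    for pr e
  proof (rule block_sign_same_blocks[OF slice_enum_block_enum[OF r pr] block_enum_comp[OF e \<pi>]])
    fix b assume b: "b < n"
    have "(\<lambda>i. ?\<pi> (e b i)) ` {..<?m} \<subseteq> slice n pr b"
      using b blk block_of(1)[OF e] block_enum_in[OF e] bij_betwE[OF \<pi>] by (auto simp: slice_def)
    moreover have "card ((\<lambda>i. ?\<pi> (e b i)) ` {..<?m}) = card (slice n pr b)"
    proof -
      have "inj_on (\<lambda>(b, i). ?\<pi> (e b i)) ({..<n} \<times> {..<?m})"
        using block_enum_comp[OF e \<pi>] by (simp add: block_enum_def bij_betw_def)
      from inj_onD[OF this] have "inj_on (\<lambda>i. ?\<pi> (e b i)) {..<?m}"
        using b by (intro inj_onI) fastforce
      then show ?thesis using pr b by (simp add: card_image coordinate_def)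
    qed
    moreover have "finite (slice n pr b)" by (simp add: slice_def)
    ultimately have "(\<lambda>i. ?\<pi> (e b i)) ` {..<?m} = slice n pr b" by (simp add: card_subset_eq)
    then show "slice_enum r n pr b ` {..<?m} = (\<lambda>i. ?\<pi> (e b i)) ` {..<?m}"
      using bij_betw_imp_surj_on[OF slice_enum_bij[OF r pr b]] by simp
  qed
  obtain \<epsilon>1 where \<epsilon>1: "\<And>\<alpha>. block_sign ?m n (\<lambda>b i. ?\<pi> (e1 b i)) \<alpha> = \<epsilon>1 * block_sign ?m n (slice_enum r n fst) \<alpha>"
    using same[OF coordinates(1) e(1)] by (auto simp: block_triple_def)
  obtain \<epsilon>2 where \<epsilon>2: "\<And>\<alpha>. block_sign ?m n (\<lambda>b i. ?\<pi> (e2 b i)) \<alpha> = \<epsilon>2 * block_sign ?m n (slice_enum r n (fst \<circ> snd)) \<alpha>"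
    using same[OF coordinates(2) e(2)] by (auto simp: block_triple_def)
  obtain \<epsilon>3 where \<epsilon>3: "\<And>\<alpha>. block_sign ?m n (\<lambda>b i. ?\<pi> (e3 b i)) \<alpha> = \<epsilon>3 * block_sign ?m n (slice_enum r n (snd \<circ> snd)) \<alpha>"
    using same[OF coordinates(3) e(3)] by (auto simp: block_triple_def)
  have "block_form ?m n D e1 e2 e3 v = of_int (\<epsilon>1 * \<epsilon>2 * \<epsilon>3) * F r n v"
    unfolding block_form_transport[OF \<pi> e] F_eq_block_form[OF r]
    unfolding block_form_def \<epsilon>1 \<epsilon>2 \<epsilon>3 by (simp add: sum_distrib_left mult_ac)
  then show ?thesis using nz by auto
qed

section \<open>Invariant regular functions on the orbit closure\<close>

lemma orbit_subset_closure: "orbit m (GL3 m) w \<subseteq> orbit_closure m w"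
  unfolding orbit_closure_def zariski_closure_def by (rule hull_subset)

text \<open>
  This and the next lemma describe membership in the orbit closure by sets of polynomials that vanish
  on the orbit.  To see that the closure is preserved by a polynomial map, compose such a set with
  the map.
\<close>
lemma orbit_closure_induct:
  assumes v: "v \<in> orbit_closure m w" and P: "\<And>p. p \<in> P \<Longrightarrow> polynomial_fun m p"
    and orb: "\<And>h p. h \<in> GL3 m \<Longrightarrow> p \<in> P \<Longrightarrow> p (act m h w) = 0"
  shows "v \<in> tensors m \<and> (\<forall>p\<in>P. p v = 0)"
proof -
  let ?Z = "{v \<in> tensors m. \<forall>p\<in>P. p v = 0}"
  have "zariski_closed m ?Z" unfolding zariski_closed_def using P by blast
  moreover have "orbit m (GL3 m) w \<subseteq> ?Z" using orb by (auto simp: orbit_def act_in_tensors)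
  ultimately have "orbit_closure m w \<subseteq> ?Z"
    unfolding orbit_closure_def zariski_closure_def by (intro hull_minimal)
  then show ?thesis using v by blast
qed

lemma orbit_closure_memI:
  assumes "\<And>P. (\<And>p. p \<in> P \<Longrightarrow> polynomial_fun m p) \<Longrightarrow>
      (\<And>h p. h \<in> GL3 m \<Longrightarrow> p \<in> P \<Longrightarrow> p (act m h w) = 0) \<Longrightarrow> v \<in> tensors m \<and> (\<forall>p\<in>P. p v = 0)"
  shows "v \<in> orbit_closure m w"
  unfolding orbit_closure_def zariski_closure_def hull_def
proof (rule InterI, clarify)
  fix Z assume "zariski_closed m Z" and sub: "orbit m (GL3 m) w \<subseteq> Z"
  then obtain P where P: "\<forall>p\<in>P. polynomial_fun m p" and Z: "Z = {v \<in> tensors m. \<forall>p\<in>P. p v = 0}"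
    by (auto simp: zariski_closed_def)
  have "v \<in> tensors m \<and> (\<forall>p\<in>P. p v = 0)"
    by (rule assms) (use P Z sub in \<open>auto simp: orbit_def\<close>)
  then show "v \<in> Z" using Z by simp
qed

lemma polynomial_vanishes_on_closure:
  assumes "polynomial_fun m p" "\<And>h. h \<in> GL3 m \<Longrightarrow> p (act m h w) = 0" "v \<in> orbit_closure m w"
  shows "p v = 0"
  using orbit_closure_induct[of v m w "{p}"] assms by simp

lemma GL3_act_act:
  assumes "g \<in> GL3 m" "h \<in> GL3 m"
  shows "\<exists>gh\<in>GL3 m. \<forall>v. act m g (act m h v) = act m gh v"
proof -
  obtain A B C A' B' C' where gh: "g = (A, B, C)" "h = (A', B', C')" by (metis prod_cases3)
  then have "(A * A', B * B', C * C') \<in> GL3 m" using assms by (auto simp: GL3_def GL_mult)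
  moreover have "act m g (act m h v) = act m (A * A', B * B', C * C') v" for v
    using assms unfolding gh by (subst act_mult) (auto simp: GL3_def GL_iff)
  ultimately show ?thesis by blast
qed

lemma orbit_closure_act:
  assumes v: "v \<in> orbit_closure m w" and g: "g \<in> GL3 m"
  shows "act m g v \<in> orbit_closure m w"
proof (rule orbit_closure_memI)
  fix P assume P: "\<And>p. p \<in> P \<Longrightarrow> polynomial_fun m p"
    "\<And>h p. h \<in> GL3 m \<Longrightarrow> p \<in> P \<Longrightarrow> p (act m h w) = 0"
  have "v \<in> tensors m \<and> (\<forall>p\<in>(\<lambda>p v. p (act m g v)) ` P. p v = 0)"
  proof (rule orbit_closure_induct[OF v])
    show "polynomial_fun m p" if "p \<in> (\<lambda>p v. p (act m g v)) ` P" for p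
      using that P(1) by (auto intro: polynomial_fun_act)
    show "p (act m h w) = 0" if "h \<in> GL3 m" "p \<in> (\<lambda>p v. p (act m g v)) ` P" for h p
      using that P(2) GL3_act_act[OF g that(1)] by auto
  qed
  then show "act m g v \<in> tensors m \<and> (\<forall>p\<in>P. p (act m g v) = 0)" by (simp add: act_in_tensors)
qed

lemma poly_along_line:
  fixes coef :: "(nat \<times> nat \<times> nat \<Rightarrow> nat) \<Rightarrow> complex"
  shows "(\<Sum>\<mu>\<in>M. coef \<mu> * monomial_fun m \<mu> (tscale t v))
    = poly (\<Sum>\<mu>\<in>M. monom (coef \<mu> * monomial_fun m \<mu> v) (monomial_degree m \<mu>)) t"
  by (simp add: monomial_fun_tscale poly_sum poly_monom mult_ac)

text \<open>
  The orbit contains only the nonzero multiples of its elements; that the closure contains \<open>0\<close>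
  follows because a polynomial in \<open>t\<close> that vanishes for \<open>t \<noteq> 0\<close> is zero.
\<close>
lemma polynomial_vanishes_at_0:
  assumes "polynomial_fun m p" "\<And>t. t \<noteq> 0 \<Longrightarrow> p (tscale t v) = 0"
  shows "p (tscale 0 v) = 0"
proof -
  obtain M coef where p: "p = (\<lambda>v. \<Sum>\<mu>\<in>M. coef \<mu> * monomial_fun m \<mu> v)"
    using assms(1) by (rule polynomial_funE)
  let ?Q = "\<Sum>\<mu>\<in>M. monom (coef \<mu> * monomial_fun m \<mu> v) (monomial_degree m \<mu>)"
  have Q: "p (tscale t v) = poly ?Q t" for t unfolding p by (rule poly_along_line)
  (* The polynomial t Q(t) vanishes at t = 0 as well. *)
  have "poly (pCons 0 ?Q) t = 0" for t using assms(2)[of t] Q[of t] by (cases "t = 0") auto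
  then have "pCons 0 ?Q = 0" unfolding poly_all_0_iff_0[symmetric] by blast
  then have "?Q = 0" by simp
  then show ?thesis by (simp add: Q)
qed

lemma scalar_orbit:
  assumes "h \<in> GL3 m" "t \<noteq> 0"
  shows "\<exists>h'\<in>GL3 m. \<forall>v. tscale t (act m h v) = act m h' v"
proof -
  obtain A B C where h: "h = (A, B, C)" by (cases h)
  have car: "A \<in> carrier_mat m m" "B \<in> carrier_mat m m" "C \<in> carrier_mat m m"
    using assms(1) by (auto simp: h GL3_def GL_iff)
  have "tscale t (act m h v) = act m (t \<cdot>\<^sub>m A, 1 \<cdot>\<^sub>m B, 1 \<cdot>\<^sub>m C) v" for v
    unfolding h act_smult[OF car] by simp
  moreover have "(t \<cdot>\<^sub>m A, 1 \<cdot>\<^sub>m B, 1 \<cdot>\<^sub>m C) \<in> GL3 m"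
    using assms by (auto simp: h GL3_def GL_iff)
  ultimately show ?thesis by blast
qed

lemma orbit_closure_tscale:
  assumes v: "v \<in> orbit_closure m w"
  shows "tscale t v \<in> orbit_closure m w"
proof (rule orbit_closure_memI)
  fix P assume P: "\<And>p. p \<in> P \<Longrightarrow> polynomial_fun m p"
    "\<And>h p. h \<in> GL3 m \<Longrightarrow> p \<in> P \<Longrightarrow> p (act m h w) = 0"
  have "v \<in> tensors m \<and> (\<forall>p\<in>(\<lambda>p v. p (tscale t v)) ` P. p v = 0)"
  proof (rule orbit_closure_induct[OF v])
    show "polynomial_fun m p" if p: "p \<in> (\<lambda>p v. p (tscale t v)) ` P" for p
    proof -
      from p obtain p' where p': "p' \<in> P" "p = (\<lambda>v. p' (tscale t v))" by blast
      show ?thesis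
        unfolding p'(2) by (rule polynomial_fun_compose[OF P(1)[OF p'(1)]])
          (auto simp: tscale_def intro: polynomial_fun_mult polynomial_fun_const polynomial_fun_coord)
    qed
    show "p (act m h w) = 0" if h: "h \<in> GL3 m" and p: "p \<in> (\<lambda>p v. p (tscale t v)) ` P" for h p
    proof -
      from p obtain p' where p': "p' \<in> P" "p = (\<lambda>v. p' (tscale t v))" by blast
      have nz: "p' (tscale s (act m h w)) = 0" if "s \<noteq> 0" for s
        using scalar_orbit[OF h that] P(2)[OF _ p'(1)] by auto
      then have "p' (tscale 0 (act m h w)) = 0"
        by (rule polynomial_vanishes_at_0[OF P(1)[OF p'(1)]])
      then show ?thesis using nz p'(2) by (cases "t = 0") auto
    qed
  qed
  then show "tscale t v \<in> tensors m \<and> (\<forall>p\<in>P. p (tscale t v) = 0)" by (simp add: tscale_in_tensors)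
qed

lemma invariants_polynomial:
  assumes "f \<in> invariants m w d"
  obtains p where "polynomial_fun m p" "\<And>v. v \<in> orbit_closure m w \<Longrightarrow> f v = p v"
  using assms unfolding invariants_def regular_funs_def by blast

lemma invariants_GL3:
  assumes m: "m \<ge> 1" and f: "f \<in> invariants m w d" and h: "h \<in> GL3 m" and c: "c ^ m = chi h"
    and v: "v \<in> orbit_closure m w"
  shows "f (act m h v) = c ^ d * f v"
proof -
  obtain h' where h': "h' \<in> SL3 m" "act m h v = tscale c (act m h' v)"
    using GL3_eq_scalar_SL3[OF m h c] by blast
  have "act m h' v \<in> orbit_closure m w"
    using orbit_closure_act[OF v] h'(1) SL3_subset_GL3 by blast
  then show ?thesis using f h' v by (simp add: invariants_def)
qed

text \<open>
  \<open>GL\<^sub>m\<^sup>3\<close> is generated by \<open>SL\<^sub>m\<^sup>3\<close> and scalars, so homogeneity and invariance determine the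
  function on the orbit, which is dense in its closure.
\<close>
lemma invariants_determined:
  assumes m: "m \<ge> 1" and w: "w \<in> orbit_closure m w"
    and f: "f \<in> invariants m w d" and f': "f' \<in> invariants m w d" and eq: "f w = f' w"
  shows "f = f'"
proof -
  obtain p where p: "polynomial_fun m p" "\<And>v. v \<in> orbit_closure m w \<Longrightarrow> f v = p v"
    using f by (rule invariants_polynomial) blast
  obtain p' where p': "polynomial_fun m p'" "\<And>v. v \<in> orbit_closure m w \<Longrightarrow> f' v = p' v"
    using f' by (rule invariants_polynomial) blast
  have "f v = f' v" if v: "v \<in> orbit_closure m w" for v
  proof -
    have "polynomial_fun m (\<lambda>v. p v + (- 1) * p' v)"
      by (intro polynomial_fun_add polynomial_fun_mult polynomial_fun_const p p')
    moreover have "p (act m h w) + (- 1) * p' (act m h w) = 0" if h: "h \<in> GL3 m" for h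
    proof -
      obtain c where "c ^ m = chi h" using exists_complex_root[OF m] by blast
      then have "f (act m h w) = f' (act m h w)"
        using invariants_GL3[OF m f h _ w] invariants_GL3[OF m f' h _ w] eq by simp
      then show ?thesis using p(2) p'(2) orbit_closure_act[OF w h] by simp
    qed
    ultimately have "p v + (- 1) * p' v = 0" by (rule polynomial_vanishes_on_closure[OF _ _ v])
    then show ?thesis using p(2) p'(2) v by simp
  qed
  moreover have "f \<in> extensional (orbit_closure m w)" "f' \<in> extensional (orbit_closure m w)"
    using f f' by (auto simp: invariants_def regular_funs_def)
  ultimately show ?thesis by (intro extensionalityI)
qed

lemma relative_invariant_restrict:
  assumes P: "relative_invariant m k P"
  shows "restrict P (orbit_closure m w) \<in> invariants m w (k * m)"
  unfolding invariants_def regular_funs_def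
proof (intro CollectI conjI allI ballI)
  let ?X = "orbit_closure m w"
  show "restrict P ?X \<in> extensional ?X" by simp
  show "\<exists>p. polynomial_fun m p \<and> (\<forall>v\<in>?X. restrict P ?X v = p v)"
    using P by (auto simp: relative_invariant_def)
  show "restrict P ?X (tscale t v) = t ^ (k * m) * restrict P ?X v" if "v \<in> ?X" for t v
    using that P by (simp add: orbit_closure_tscale relative_invariant_def)
  show "restrict P ?X (act m g v) = restrict P ?X v" if g: "g \<in> SL3 m" and "v \<in> ?X" for g v
  proof -
    have "g \<in> GL3 m" using g SL3_subset_GL3 by blast
    moreover have "chi g = 1" using g by (auto simp: SL3_def SL_def chi_def)
    ultimately show ?thesis using that P by (simp add: orbit_closure_act relative_invariant_def)
  qed
qed

text \<open>
  A polynomial that represents an invariant of degree \<open>d\<close> need not be homogeneous itself.  On the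
  closure, a cone, comparing coefficients along lines through \<open>0\<close> shows that its homogeneous part of
  degree \<open>d\<close> represents the same function.
\<close>
lemma invariants_block_form:
  assumes m: "m \<ge> 1" and w: "w \<in> orbit_closure m w" and f: "f \<in> invariants m w d" and nz: "f w \<noteq> 0"
  obtains k e1 e2 e3 where "d = k * m" "block_enum m k {..<d} e1" "block_enum m k {..<d} e2"
    "block_enum m k {..<d} e3" "block_form m k {..<d} e1 e2 e3 w \<noteq> 0"
proof -
  let ?X = "orbit_closure m w"
  obtain p where p: "polynomial_fun m p" "\<And>v. v \<in> ?X \<Longrightarrow> f v = p v"
    using f by (rule invariants_polynomial) blast
  obtain M coef where M: "finite M" and p_eq: "p = (\<lambda>v. \<Sum>\<mu>\<in>M. coef \<mu> * monomial_fun m \<mu> v)"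
    using p(1) by (rule polynomial_funE)
  define M' where "M' = {\<mu> \<in> M. monomial_degree m \<mu> = d}"
  have part: "(\<Sum>\<mu>\<in>M'. coef \<mu> * monomial_fun m \<mu> v) = f v" if v: "v \<in> ?X" for v
  proof -
    let ?Q = "\<Sum>\<mu>\<in>M. monom (coef \<mu> * monomial_fun m \<mu> v) (monomial_degree m \<mu>)"
    have "poly ?Q t = poly (monom (f v) d) t" for t
    proof -
      have "poly ?Q t = p (tscale t v)" unfolding p_eq by (rule poly_along_line[symmetric])
      also have "\<dots> = f (tscale t v)" by (rule p(2)[symmetric, OF orbit_closure_tscale[OF v]])
      also have "\<dots> = t ^ d * f v" using f v by (simp add: invariants_def)
      finally show ?thesis by (simp add: poly_monom)
    qed
    then have "?Q = monom (f v) d" by (intro poly_eq_poly_eq_iff[THEN iffD1] ext)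
    then have "coeff ?Q d = f v" by simp
    moreover have "coeff ?Q d = (\<Sum>\<mu>\<in>M. if monomial_degree m \<mu> = d then coef \<mu> * monomial_fun m \<mu> v else 0)"
      by (simp add: coeff_sum)
    ultimately show ?thesis unfolding M'_def using M by (simp add: sum.inter_filter)
  qed
  show ?thesis
  proof (rule invariant_gives_block_form[OF m, of M' d coef w])
    show "finite M'" using M by (simp add: M'_def)
    show "monomial_degree m \<mu> = d" if "\<mu> \<in> M'" for \<mu> using that by (simp add: M'_def)
    show "(\<Sum>\<mu>\<in>M'. coef \<mu> * monomial_fun m \<mu> (act m h w)) = (\<Sum>\<mu>\<in>M'. coef \<mu> * monomial_fun m \<mu> w)"
      if h: "h \<in> SL3 m" for h
    proof -
      have "act m h w \<in> ?X" using orbit_closure_act[OF w] h SL3_subset_GL3 by blast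
      then show ?thesis using part w f h by (simp add: invariants_def)
    qed
    show "(\<Sum>\<mu>\<in>M'. coef \<mu> * monomial_fun m \<mu> w) \<noteq> 0" using part[OF w] nz by simp
  qed (rule that)
qed

text \<open>
  The invariant forces \<open>\<chi>(h)\<^sup>k = 1\<close> on the stabilizer.  The claim is that \<open>\<chi>(stab(w))\<close> is finite,
  as the cardinality of an infinite set is \<open>0\<close>.
\<close>
lemma stabilizer_period_pos:
  assumes P: "relative_invariant m k P" "P w \<noteq> 0" and k: "k \<ge> 1" and w: "w \<in> tensors m"
  shows "stabilizer_period m w > 0"
proof -
  have "chi ` stabilizer m w \<subseteq> {z. z ^ k = 1}"
  proof clarify
    fix h assume "h \<in> stabilizer m w"
    then have h: "h \<in> GL3 m" "act m h w = w" by (auto simp: stabilizer_def)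
    then have "P w = chi h ^ k * P w" using P(1) unfolding relative_invariant_def by metis
    then show "chi h ^ k = 1" using P(2) by simp
  qed
  then have "finite (chi ` stabilizer m w)"
    using finite_roots_unity[OF k] finite_subset by blast
  moreover have "(1\<^sub>m m, 1\<^sub>m m, 1\<^sub>m m) \<in> stabilizer m w"
    by (simp add: stabilizer_def GL3_def one_GL act_one[OF w])
  ultimately show ?thesis unfolding stabilizer_period_def by (auto simp: card_gt_0_iff)
qed

theorem theorem5p11:
  fixes m :: nat and w :: tensor3
  assumes "m \<ge> 1"
    and "w \<in> tensors m"
    and "w \<noteq> (\<lambda>_. 0)"
    and "polystable m w"
  shows "(m > 2 \<longrightarrow> sqrt (real m) / real (stabilizer_period m w) \<le> minimal_exponent m w) \<and>
    (\<forall>n r. m = n^2 \<and> linear_order_on (cube n) r \<longrightarrow>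
       (sqrt (real m) / real (stabilizer_period m w) = minimal_exponent m w \<longleftrightarrow> F r n w \<noteq> 0) \<and>
       (F r n w \<noteq> 0 \<longrightarrow>
          fundamental_invariant m w =
            restrict (\<lambda>v. inverse (F r n w) * F r n v) (orbit_closure m w)))"
proof -
  let ?X = "orbit_closure m w"
  let ?a = "stabilizer_period m w"
  let ?e = "minimal_degree m w"
  let ?ok = "\<lambda>d. d > 0 \<and> (\<exists>f\<in>invariants m w d. \<exists>v\<in>?X. f v \<noteq> 0)"
  have wX: "w \<in> ?X"
  proof -
    have "act m (1\<^sub>m m, 1\<^sub>m m, 1\<^sub>m m) w \<in> orbit m (GL3 m) w"
      unfolding orbit_def by (rule imageI) (simp add: GL3_def one_GL)
    then show ?thesis using orbit_subset_closure act_one[OF assms(2)] by auto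
  qed
  obtain k0 P0 where P0: "k0 \<ge> 1" "relative_invariant m k0 P0" "P0 w \<noteq> 0"
    using polystable_nonzero_invariant[OF assms] by blast
  have a: "?a > 0" by (rule stabilizer_period_pos[OF P0(2,3,1) assms(2)])
  (* A witness that the minimum defining the minimal degree is taken over a nonempty set. *)
  have "?ok (k0 * m)"
  proof
    show "0 < k0 * m" using P0(1) assms(1) by simp
    show "\<exists>f\<in>invariants m w (k0 * m). \<exists>v\<in>?X. f v \<noteq> 0"
      using relative_invariant_restrict[OF P0(2), of w] wX P0(3)
      by (intro bexI[of _ "restrict P0 ?X"] bexI[of _ w]) simp_all
  qed
  then have "?ok ?e" unfolding minimal_degree_def by (rule LeastI)
  then obtain f v where e_pos: "?e > 0" and f: "f \<in> invariants m w ?e" and v: "v \<in> ?X" "f v \<noteq> 0"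
    by blast
  have "f w \<noteq> 0"
  proof
    assume 0: "f w = 0"
    have "restrict (\<lambda>_. 0) ?X \<in> invariants m w ?e"
      using polynomial_fun_const[of m 0] orbit_closure_tscale orbit_closure_act SL3_subset_GL3
      by (fastforce simp: invariants_def regular_funs_def)
    then have "f = restrict (\<lambda>_. 0) ?X"
      by (rule invariants_determined[OF assms(1) wX f]) (simp add: 0 wX)
    then show False using v by simp
  qed
  then obtain k e1 e2 e3 where e: "?e = k * m" and enum: "block_enum m k {..<?e} e1"
    "block_enum m k {..<?e} e2" "block_enum m k {..<?e} e3"
    and form: "block_form m k {..<?e} e1 e2 e3 w \<noteq> 0"
    using invariants_block_form[OF assms(1) wX f] by blast
  have k: "k \<ge> 1" using e e_pos by (cases k) auto
  have bound: "m \<le> k ^ 2" by (rule block_form_nonzero_bound[OF enum form k])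
  have exponent: "minimal_exponent m w = real k / real ?a"
    using assms(1) by (simp add: minimal_exponent_def e)
  have "sqrt (real m) \<le> real k"
  proof (rule real_le_lsqrt)
    show "real m \<le> (real k)\<^sup>2" using bound by (metis of_nat_le_iff of_nat_power)
  qed simp_all
  then have "sqrt (real m) / real ?a \<le> minimal_exponent m w"
    unfolding exponent by (intro divide_right_mono) simp_all
  moreover have "(sqrt (real m) / real ?a = minimal_exponent m w \<longleftrightarrow> F r n w \<noteq> 0) \<and>
       (F r n w \<noteq> 0 \<longrightarrow>
          fundamental_invariant m w = restrict (\<lambda>v. inverse (F r n w) * F r n v) ?X)"
    if m: "m = n ^ 2" and r: "linear_order_on (cube n) r" for n r
  proof -
    have n: "n \<ge> 1" using m assms(1) by (cases n) auto
    have eq_iff: "sqrt (real m) / real ?a = minimal_exponent m w \<longleftrightarrow> k = n"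
      unfolding exponent using a by (auto simp: m)
    let ?G = "\<lambda>v. inverse (F r n w) * F r n v"
    have inv: "restrict ?G ?X \<in> invariants m w (n * m)"
    proof (rule relative_invariant_restrict)
      have "relative_invariant m n (F r n)" unfolding m by (rule F_relative_invariant[OF r])
      then show "relative_invariant m n ?G"
        unfolding relative_invariant_def by (auto intro: polynomial_fun_mult polynomial_fun_const)
    qed
    have kn: "k = n" if "F r n w \<noteq> 0"
    proof -
      have "?ok (n * m)"
        using inv wX that n assms(1)
        by (intro conjI bexI[of _ "restrict ?G ?X"] bexI[of _ w]) simp_all
      then have "?e \<le> n * m" unfolding minimal_degree_def by (rule Least_le)
      then have "k \<le> n" using assms(1) by (simp add: e)
      moreover have "n \<le> k" using bound unfolding m by (simp add: power2_nat_le_eq_le)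
      ultimately show ?thesis by simp
    qed
    have "F r n w \<noteq> 0" if "k = n"
      by (rule block_form_nonzero_imp_F_nonzero[OF n r, of "{..<?e}" e1 e2 e3])
        (use enum form in \<open>simp_all add: m that\<close>)
    with kn eq_iff have "sqrt (real m) / real ?a = minimal_exponent m w \<longleftrightarrow> F r n w \<noteq> 0" by blast
    moreover have "fundamental_invariant m w = restrict ?G ?X" if nz: "F r n w \<noteq> 0"
      unfolding fundamental_invariant_def
    proof (rule the_equality)
      have deg: "?e = n * m" using kn[OF nz] e by simp
      show G: "restrict ?G ?X \<in> invariants m w ?e \<and> restrict ?G ?X w = 1"
        using inv nz wX by (simp add: deg)
      show "f = restrict ?G ?X" if "f \<in> invariants m w ?e \<and> f w = 1" for f
        using invariants_determined[OF assms(1) wX, of f ?e] that G by simp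
    qed
    ultimately show ?thesis by blast
  qed
  ultimately show ?thesis by blast
qed

end
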